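(* Let $0<\alpha<1$, let $k\ge 1$ be an integer, let $\lambda:[0,\infty)\to[0,\infty)$ be a rate function with $\Lambda(t)=\int_0^t\lambda(u)\,du<\infty$ for every $t>0$, let $N^n$ be the non-homogeneous Poisson process of order $k$ with rate function $\lambda$, and let $Y_\alpha$ be an inverse $\alpha$-stable subordinator independent of $N^n$. For $v\ge 0$ and $t\ge 0$ let $$I_\alpha(t,v)=N^n(Y_\alpha(t)+v)-N^n(v),\qquad p_m^*(t,v)=\mathbb{P}[I_\alpha(t,v)=m],\quad m=0,1,2,\dots$$ Then the marginal distributions $p_m^*(t,v)$ satisfy, for $t>0$ and $v\ge 0$, the fractional differential-difference integral equations $$D_t^\alpha p_0^*(t,v)=-k\int_0^\infty\lambda(u+v)\,p_0^n(u,v)\,h_\alpha(t,u)\,du,$$ $$D_t^\alpha p_m^*(t,v)=\int_0^\infty\Big[-k\lambda(u+v)\,p_m^n(u,v)+\lambda(u+v)\sum_{j=1}^{m\wedge k}p_{m-j}^n(u,v)\Big]h_\alpha(t,u)\,du,\qquad m=1,2,\dots,$$ with the initial condition $p_m^*(0,v)=\delta_{m,0}$.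
   Context: Non-homogeneous Poisson process of order $k$ with rate function $\lambda$: $N^n(t)=X_1+\dots+X_{N_1^1(k\Lambda(t))}$, $t\ge 0$ (an empty sum being $0$), where $X_1,X_2,\dots$ are i.i.d. with $\mathbb{P}[X_i=m]=1/k$ for $m=1,\dots,k$, and $N_1^1$ is a homogeneous Poisson process of unit intensity, independent of $\{X_i\}_{i\ge 1}$. Write $\Lambda(s,t)=\int_s^t\lambda(u)\,du=\Lambda(t)-\Lambda(s)$. For $u,v\ge0$, the increment distribution of $N^n$ is $$p_m^n(u,v)=\mathbb{P}[N^n(u+v)-N^n(v)=m]=e^{-k\Lambda(v,u+v)}\sum_{(n_1,\dots,n_k)\in\Omega(k,m)}\frac{[\Lambda(v,u+v)]^{n_1+\dots+n_k}}{n_1!\cdots n_k!},\quad m=0,1,\dots,$$ where $\Omega(k,m)=\{(n_1,\dots,n_k): n_1+2n_2+\dots+kn_k=m\}$ with the $n_i$ non-negative integers. Inverse $\alpha$-stable subordinator: let $\{\mathcal{L}_\alpha(t);\,t\ge 0\}$ be the $\alpha$-stable L\'evy subordinator, i.e. the L\'evy process with $\mathbb{E}[e^{-s\mathcal{L}_\alpha(t)}]=e^{-ts^\alpha}$, $s\ge 0$. Then $Y_\alpha(t)=\inf\{u>0:\mathcal{L}_\alpha(u)>t\}$, $t\ge 0$. For $t>0$, $h_\alpha(t,\cdot)$ denotes the probability density of $Y_\alpha(t)$ on $(0,\infty)$. $D_t^\alpha$ is the Caputo fractional derivative in $t$: for $0<\alpha<1$, $D_t^\alpha f(t)=\frac{1}{\Gamma(1-\alpha)}\int_0^t\frac{df(u)}{du}\frac{du}{(t-u)^\alpha}$.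 Notation: $m\wedge k=\min(m,k)$. *)

theory Defs
  imports "HOL-Probability.Probability"
begin

section \<open>Processes with independent and stationary increments\<close>

text \<open>Processes are families indexed by \<^typ>\<open>real\<close>; only the times \<open>t \<ge> 0\<close> are constrained.\<close>

definition independent_increments :: "'a measure \<Rightarrow> (real \<Rightarrow> 'a \<Rightarrow> real) \<Rightarrow> bool" where
  "independent_increments M Z \<longleftrightarrow>
     (\<forall>n (\<tau> :: nat \<Rightarrow> real). 0 \<le> \<tau> 0 \<and> (\<forall>i<n. \<tau> i \<le> \<tau> (Suc i)) \<longrightarrow>
        prob_space.indep_vars M (\<lambda>_. borel) (\<lambda>i \<omega>. Z (\<tau> (Suc i)) \<omega> - Z (\<tau> i) \<omega>) {..<n})"

definition stationary_increments :: "'a measure \<Rightarrow> (real \<Rightarrow> 'a \<Rightarrow> real) \<Rightarrow> bool" where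
  "stationary_increments M Z \<longleftrightarrow>
     (\<forall>s\<ge>0. \<forall>t\<ge>0. distr M borel (\<lambda>\<omega>. Z (s + t) \<omega> - Z s \<omega>) = distr M borel (Z t))"

definition cadlag :: "(real \<Rightarrow> real) \<Rightarrow> bool" where
  "cadlag f \<longleftrightarrow>
     (\<forall>t\<ge>0. continuous (at_right t) f) \<and> (\<forall>t>0. \<exists>l. (f \<longlongrightarrow> l) (at_left t))"

text \<open>Path regularity is required of every path rather than of almost every path: the time-changed
  process below evaluates a process at a random time, and on an incomplete probability space
  exceptional paths could make this non-measurable.\<close>

definition levy_process :: "'a measure \<Rightarrow> (real \<Rightarrow> 'a \<Rightarrow> real) \<Rightarrow> bool" where
  "levy_process M Z \<longleftrightarrow>
     prob_space M \<and>
     (\<forall>t\<ge>0. Z t \<in> borel_measurable M) \<and>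
     (AE \<omega> in M. Z 0 \<omega> = 0) \<and>
     independent_increments M Z \<and>
     stationary_increments M Z \<and>
     (\<forall>\<omega>\<in>space M. cadlag (\<lambda>t. Z t \<omega>))"

definition subordinator :: "'a measure \<Rightarrow> (real \<Rightarrow> 'a \<Rightarrow> real) \<Rightarrow> bool" where
  "subordinator M L \<longleftrightarrow>
     levy_process M L \<and> (\<forall>\<omega>\<in>space M. mono_on {0..} (\<lambda>t. L t \<omega>))"

definition stable_subordinator :: "'a measure \<Rightarrow> real \<Rightarrow> (real \<Rightarrow> 'a \<Rightarrow> real) \<Rightarrow> bool" where
  "stable_subordinator M \<alpha> L \<longleftrightarrow>
     subordinator M L \<and>
     (\<forall>t\<ge>0. \<forall>s\<ge>0. (\<integral>\<omega>. exp (- s * L t \<omega>) \<partial>M) = exp (- t * s powr \<alpha>))"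

text \<open>A stable subordinator is almost surely unbounded, so the set below is empty, and its
  infimum unspecified, only with probability zero.\<close>

definition inverse_process :: "(real \<Rightarrow> 'a \<Rightarrow> real) \<Rightarrow> real \<Rightarrow> 'a \<Rightarrow> real" where
  "inverse_process L t \<omega> = Inf {u. 0 < u \<and> t < L u \<omega>}"

definition poisson_process :: "'a measure \<Rightarrow> real \<Rightarrow> (real \<Rightarrow> 'a \<Rightarrow> nat) \<Rightarrow> bool" where
  "poisson_process M c N \<longleftrightarrow>
     (\<forall>t\<ge>0. N t \<in> measurable M (count_space UNIV)) \<and>
     subordinator M (\<lambda>t \<omega>. real (N t \<omega>)) \<and>
     (\<forall>t\<ge>0. \<forall>m. measure M {\<omega> \<in> space M. N t \<omega> = m} = exp (- (c * t)) * (c * t) ^ m / fact m)"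


section \<open>The Poisson process of order \<open>k\<close> and its increments\<close>

definition cumulative_rate :: "(real \<Rightarrow> real) \<Rightarrow> real \<Rightarrow> real" where
  "cumulative_rate r t = (LBINT u:{0..t}. r u)"

definition poisson_order ::
    "nat \<Rightarrow> (real \<Rightarrow> real) \<Rightarrow> (nat \<Rightarrow> 'a \<Rightarrow> nat) \<Rightarrow> (real \<Rightarrow> 'a \<Rightarrow> nat) \<Rightarrow> real \<Rightarrow> 'a \<Rightarrow> nat" where
  "poisson_order k r X N t \<omega> = (\<Sum>i = 1..N (real k * cumulative_rate r t) \<omega>. X i \<omega>)"

definition process_events :: "'a measure \<Rightarrow> 'i set \<Rightarrow> 'b measure \<Rightarrow> ('i \<Rightarrow> 'a \<Rightarrow> 'b) \<Rightarrow> 'a set set" where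
  "process_events M I S A = sigma_sets (space M) {A i -` E \<inter> space M | i E. i \<in> I \<and> E \<in> sets S}"

text \<open>Independence of two processes is independence of the sigma-algebras they generate; the
  library's \<^const>\<open>prob_space.indep_var\<close> is restricted to random variables of equal type.\<close>

definition indep_processes ::
    "'a measure \<Rightarrow> 'i set \<Rightarrow> 'b measure \<Rightarrow> ('i \<Rightarrow> 'a \<Rightarrow> 'b) \<Rightarrow>
     'j set \<Rightarrow> 'c measure \<Rightarrow> ('j \<Rightarrow> 'a \<Rightarrow> 'c) \<Rightarrow> bool" where
  "indep_processes M I S A J T B \<longleftrightarrow>
     prob_space.indep_set M (process_events M I S A) (process_events M J T B)"

text \<open>Differences are taken in \<^typ>\<open>int\<close> to avoid truncated subtraction.\<close>

definition incr_prob :: "'a measure \<Rightarrow> (real \<Rightarrow> 'a \<Rightarrow> nat) \<Rightarrow> nat \<Rightarrow> real \<Rightarrow> real \<Rightarrow> real" where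
  "incr_prob M N m u v =
     measure M {\<omega> \<in> space M. int (N (u + v) \<omega>) - int (N v \<omega>) = int m}"

definition time_changed_incr ::
    "(real \<Rightarrow> 'a \<Rightarrow> nat) \<Rightarrow> (real \<Rightarrow> 'a \<Rightarrow> real) \<Rightarrow> real \<Rightarrow> real \<Rightarrow> 'a \<Rightarrow> int" where
  "time_changed_incr N Y t v \<omega> = int (N (Y t \<omega> + v) \<omega>) - int (N v \<omega>)"

definition time_changed_incr_prob ::
    "'a measure \<Rightarrow> (real \<Rightarrow> 'a \<Rightarrow> nat) \<Rightarrow> (real \<Rightarrow> 'a \<Rightarrow> real) \<Rightarrow> nat \<Rightarrow> real \<Rightarrow> real \<Rightarrow> real" where
  "time_changed_incr_prob M N Y m t v =
     measure M {\<omega> \<in> space M. time_changed_incr N Y t v \<omega> = int m}"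

text \<open>\<open>g\<close> is a version of the density on \<open>(0, \<infinity>)\<close> of the real random variable \<open>Z\<close>; the values of
  \<open>g\<close> elsewhere are irrelevant.\<close>

definition has_density_on_pos :: "'a measure \<Rightarrow> ('a \<Rightarrow> real) \<Rightarrow> (real \<Rightarrow> real) \<Rightarrow> bool" where
  "has_density_on_pos M Z g \<longleftrightarrow>
     (\<forall>u>0. 0 \<le> g u) \<and>
     distributed M lborel Z (\<lambda>u. ennreal (indicator {0<..} u * g u))"


section \<open>The Caputo derivative\<close>

definition caputo_deriv :: "real \<Rightarrow> (real \<Rightarrow> real) \<Rightarrow> real \<Rightarrow> real" where
  "caputo_deriv \<alpha> f t =
     1 / Gamma (1 - \<alpha>) * (LBINT u:{0<..<t}. deriv f u / (t - u) powr \<alpha>)"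

text \<open>Since \<^const>\<open>deriv\<close> and the integral are total, existence of the Caputo derivative is a
  separate predicate.\<close>

definition caputo_differentiable :: "real \<Rightarrow> (real \<Rightarrow> real) \<Rightarrow> real \<Rightarrow> bool" where
  "caputo_differentiable \<alpha> f t \<longleftrightarrow>
     (\<forall>u\<in>{0<..<t}. f differentiable (at u)) \<and>
     set_integrable lborel {0<..<t} (\<lambda>u. deriv f u / (t - u) powr \<alpha>)"

end

theory Submission
  imports Defs "HOL-Complex_Analysis.Conformal_Mappings" "HOL-Real_Asymp.Real_Asymp"
begin

text \<open>
  Fix \<open>v\<close> and put \<open>A u = \<Lambda> (u + v) - \<Lambda> v\<close>. An increment of the process of order \<open>k\<close> is a Poisson number of
  uniform steps, so its distribution is \<open>p\<^sub>m(u, v) = P\<^sub>m(A u)\<close> (\<open>incr_prob_eq\<close>) with smooth functions \<open>P\<^sub>m\<close>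
  that solve the linear system \<open>P\<^sub>m' = - k P\<^sub>m + (\<Sum>j. P\<^sub>m\<^sub>-\<^sub>j)\<close>. The rate is only locally integrable, so
  \<open>p\<^sub>m(\<cdot>, v)\<close> need not be differentiable; but the image under \<open>A\<close> of the measure with density
  \<open>\<lambda>(\<cdot> + v)\<close> is Lebesgue measure (\<open>distr_cumulative_rate\<close>), and hence
  \<open>p\<^sub>m(u, v) = \<delta>\<^sub>m\<^sub>0 + \<integral>\<^sub>0\<^sup>u \<psi>\<^sub>m(w) dw\<close>, where \<open>\<psi>\<^sub>m\<close> is the factor in front of \<open>h\<close> in the theorem. The same
  substitution shows that \<open>\<psi>\<^sub>m\<close> is integrable over \<open>(0, \<infinity>)\<close>, because every \<open>P\<^sub>m\<close> is.

  By independence \<open>p\<^sub>m\<^sup>*(t, v)\<close> is the expectation of \<open>p\<^sub>m(Y(t), v)\<close> (\<open>time_changed_incr_prob\<close>). The events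
  \<open>Y(t) > w\<close> and \<open>L(w) \<le> t\<close> agree almost surely, so Fubini's theorem gives
  \<open>p\<^sub>m\<^sup>*(t, v) = \<delta>\<^sub>m\<^sub>0 + \<integral> \<psi>\<^sub>m(w) P[L(w) \<le> t] dw\<close> (\<open>expectation_inverse\<close>): all dependence on \<open>t\<close> now sits in
  the distribution functions of the stable laws. If \<open>g\<^sub>w\<close> is the density of \<open>L(w)\<close> and
  \<open>\<kappa>(x) = x\<^sup>-\<^sup>\<alpha> / \<Gamma>(1 - \<alpha>)\<close>, then \<open>d/dt p\<^sub>m\<^sup>*(t, v) = \<integral> \<psi>\<^sub>m(w) g\<^sub>w(t) dw\<close> (\<open>DERIV_mixture\<close>), and exchanging
  integrals once more shows that the Caputo derivative is \<open>\<integral> \<psi>\<^sub>m(w) (\<kappa> * g\<^sub>w)(t) dw\<close> (\<open>caputo_mixture\<close>). The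
  theorem therefore comes down to the identity \<open>h(t, w) = (\<kappa> * g\<^sub>w)(t)\<close> for almost every \<open>w\<close>.

  This identity is seen on Laplace transforms in \<open>t\<close>. That of \<open>\<kappa> * g\<^sub>w\<close> is \<open>s\<^sup>\<alpha>\<^sup>-\<^sup>1 exp(- w s\<^sup>\<alpha>)\<close>, whose integral
  over \<open>w > u\<close> is \<open>s\<^sup>-\<^sup>1 exp(- u s\<^sup>\<alpha>)\<close>, the transform of \<open>P[L(u) \<le> t]\<close>. Uniqueness of the Laplace transform
  gives \<open>P[L(u) \<le> t] = \<integral>\<^sub>u (\<kappa> * g\<^sub>w)(t) dw\<close> for almost every \<open>t\<close>, and continuity in \<open>t\<close> removes the
  exceptional set (\<open>cdf_eq_inverse_density_tail\<close>).

  Since nothing is known of \<open>\<psi>\<^sub>m\<close> but its integrability, every step needs bounds uniform in \<open>w\<close>. They come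
  from Fourier inversion: analytic continuation of the Laplace transform to the imaginary axis gives the
  characteristic function \<open>exp(- w (- i \<theta>)\<^sup>\<alpha>)\<close>, which is integrable, so that \<open>g\<^sub>w\<close> exists, is continuous and
  is at most a constant times \<open>w\<close> to the power \<open>- 1 / \<alpha>\<close>; an integration by parts bounds \<open>x g\<^sub>w(x)\<close>
  by a constant that depends on \<open>\<alpha>\<close> only.
\<close>

section \<open>Laplace transforms on the half-plane\<close>

definition laplace :: "real measure \<Rightarrow> complex \<Rightarrow> complex" where
  "laplace M z = (CLINT x|M. exp (- (z * of_real x)))"

lemma norm_exp_neg_mult_le_1:
  assumes "0 \<le> Re z" "0 \<le> x"
  shows "norm (exp (- (z * complex_of_real x))) \<le> 1"
  using assms by (simp add: norm_exp_eq_Re)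

lemma integrable_laplace:
  assumes "real_distribution M" "AE x in M. 0 \<le> x" "0 \<le> Re z"
  shows "integrable M (\<lambda>x. exp (- (z * complex_of_real x)))"
proof -
  interpret real_distribution M by fact
  show ?thesis
    using assms(2,3)
    by (intro integrable_const_bound[where B=1]) (auto elim!: eventually_mono intro: norm_exp_neg_mult_le_1)
qed

lemma continuous_on_laplace:
  assumes "real_distribution M" "AE x in M. 0 \<le> x"
  shows "continuous_on {z. 0 \<le> Re z} (laplace M)"
  unfolding continuous_on_sequentially
proof (intro allI ballI impI, elim conjE)
  interpret real_distribution M by fact
  fix w :: "nat \<Rightarrow> complex" and z
  assume z: "z \<in> {z. 0 \<le> Re z}" and w: "\<forall>n. w n \<in> {z. 0 \<le> Re z}" and lim: "w \<longlonglongrightarrow> z"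
  show "(laplace M \<circ> w) \<longlonglongrightarrow> laplace M z"
    unfolding laplace_def comp_def
  proof (rule integral_dominated_convergence[where w="\<lambda>_. 1"])
    show "AE x in M. (\<lambda>i. exp (- (w i * complex_of_real x))) \<longlonglongrightarrow> exp (- (z * complex_of_real x))"
      by (intro AE_I2 tendsto_intros lim)
    show "AE x in M. norm (exp (- (w i * complex_of_real x))) \<le> 1" for i
      using assms(2) w by (auto elim!: eventually_mono intro: norm_exp_neg_mult_le_1)
  qed auto
qed

text \<open>The mean value inequality on the half-plane to the right of \<open>\<delta>\<close>; together with the next lemma it dominates
  the difference quotients of the Laplace transform.\<close>

lemma norm_exp_diff_le:
  assumes "\<delta> \<le> Re w" "\<delta> \<le> Re z" "0 \<le> x"
  shows "norm (exp (- (w * complex_of_real x)) - exp (- (z * complex_of_real x)))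
           \<le> x * exp (- (\<delta> * x)) * norm (w - z)"
proof (rule field_differentiable_bound[where S="{z. \<delta> \<le> Re z}" and f'="\<lambda>z. - of_real x * exp (- (z * complex_of_real x))"])
  show "convex {z. \<delta> \<le> Re z}"
    by (rule convex_halfspace_Re_ge)
  fix y assume "y \<in> {z. \<delta> \<le> Re z}"
  then show "norm (- of_real x * exp (- (y * complex_of_real x))) \<le> x * exp (- (\<delta> * x))"
    using assms(3) by (auto simp: norm_mult norm_exp_eq_Re intro!: mult_left_mono mult_right_mono)
  show "((\<lambda>z. exp (- (z * complex_of_real x))) has_field_derivative - complex_of_real x * exp (- (y * complex_of_real x)))
      (at y within {z. \<delta> \<le> Re z})"
    by (auto intro!: derivative_eq_intros)
qed (use assms in auto)

lemma mult_exp_neg_le: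
  fixes x \<delta> :: real
  assumes "0 < \<delta>" "0 \<le> x"
  shows "x * exp (- (\<delta> * x)) \<le> 1 / \<delta>"
proof -
  have "\<delta> * x \<le> exp (\<delta> * x)"
    using exp_ge_add_one_self[of "\<delta> * x"] by linarith
  then show ?thesis using assms
    by (simp add: exp_minus field_simps)
qed

lemma holomorphic_on_laplace:
  assumes "real_distribution M" "AE x in M. 0 \<le> x"
  shows "laplace M holomorphic_on {z. 0 < Re z}"
proof (rule holomorphic_onI)
  interpret real_distribution M by fact
  fix z :: complex
  assume z: "z \<in> {z. 0 < Re z}"
  define \<delta> where "\<delta> = Re z / 2"
  have \<delta>: "0 < \<delta>" "\<delta> < Re z" using z by (auto simp: \<delta>_def)
  let ?e = "\<lambda>w x. exp (- (w * complex_of_real x))"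
  let ?D = "CLINT x|M. - of_real x * ?e z x"
  have "((\<lambda>w. (laplace M w - laplace M z) / (w - z)) \<longlongrightarrow> ?D) (at z)"
    unfolding tendsto_at_iff_sequentially
  proof (intro allI impI)
    fix w :: "nat \<Rightarrow> complex"
    assume w: "\<forall>i. w i \<in> UNIV - {z}" and lim: "w \<longlonglongrightarrow> z"
    have "(\<lambda>i. Re (w i)) \<longlonglongrightarrow> Re z" by (intro tendsto_intros lim)
    from order_tendstoD(1)[OF this \<delta>(2)]
    obtain N where N: "\<And>n. N \<le> n \<Longrightarrow> \<delta> < Re (w n)"
      by (auto simp: eventually_sequentially)
    have "(\<lambda>n. CLINT x|M. (?e (w (n + N)) x - ?e z x) / (w (n + N) - z)) \<longlonglongrightarrow> ?D"
    proof (rule integral_dominated_convergence[where w="\<lambda>_. 1 / \<delta>"])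
      show "AE x in M. (\<lambda>n. (?e (w (n + N)) x - ?e z x) / (w (n + N) - z)) \<longlonglongrightarrow> - of_real x * ?e z x"
      proof (rule AE_I2)
        fix x
        have "((\<lambda>w. ?e w x) has_field_derivative - complex_of_real x * ?e z x) (at z)"
          by (auto intro!: derivative_eq_intros)
        then have "((\<lambda>w. (?e w x - ?e z x) / (w - z)) \<longlongrightarrow> - of_real x * ?e z x) (at z)"
          by (simp add: has_field_derivative_iff)
        then have "((\<lambda>w. (?e w x - ?e z x) / (w - z)) \<circ> w) \<longlonglongrightarrow> - of_real x * ?e z x"
          using w lim unfolding tendsto_at_iff_sequentially by blast
        then show "(\<lambda>n. (?e (w (n + N)) x - ?e z x) / (w (n + N) - z)) \<longlonglongrightarrow> - of_real x * ?e z x"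
          unfolding comp_def by (rule LIMSEQ_ignore_initial_segment)
      qed
      show "AE x in M. norm ((?e (w (n + N)) x - ?e z x) / (w (n + N) - z)) \<le> 1 / \<delta>" for n
        using assms(2)
      proof eventually_elim
        fix x :: real assume x: "0 \<le> x"
        have "norm (?e (w (n + N)) x - ?e z x) \<le> x * exp (- (\<delta> * x)) * norm (w (n + N) - z)"
          using N[of "n + N"] \<delta> x by (intro norm_exp_diff_le) auto
        also have "\<dots> \<le> 1 / \<delta> * norm (w (n + N) - z)"
          using \<delta> x by (intro mult_right_mono mult_exp_neg_le) auto
        finally show "norm ((?e (w (n + N)) x - ?e z x) / (w (n + N) - z)) \<le> 1 / \<delta>"
          using w by (simp add: norm_divide divide_le_eq)
      qed
    qed (auto)
    moreover have "(CLINT x|M. (?e (w (n + N)) x - ?e z x) / (w (n + N) - z))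
         = (laplace M (w (n + N)) - laplace M z) / (w (n + N) - z)" for n
      unfolding laplace_def
      using \<delta> N[of "n + N"] by (simp add: integrable_laplace[OF assms] less_imp_le)
    ultimately have "(\<lambda>n. (laplace M (w (n + N)) - laplace M z) / (w (n + N) - z)) \<longlonglongrightarrow> ?D"
      by (simp only:)
    then show "((\<lambda>w. (laplace M w - laplace M z) / (w - z)) \<circ> w) \<longlonglongrightarrow> ?D"
      unfolding comp_def by (rule LIMSEQ_offset)
  qed
  then show "laplace M field_differentiable at z within {z. 0 < Re z}"
    by (metis has_field_derivative_iff field_differentiable_def field_differentiable_at_within)
qed

text \<open>The positive half-line has an accumulation point inside the right half-plane, so the identity theorem
  extends the equality to the open half-plane, and continuity extends it to the imaginary axis.\<close>

lemma laplace_eq_on_half_plane: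
  assumes M: "real_distribution M" "AE x in M. 0 \<le> x"
    and G: "G holomorphic_on {z. 0 < Re z}" "continuous_on {z. 0 \<le> Re z} G"
    and eq: "\<And>s::real. 0 < s \<Longrightarrow> laplace M (of_real s) = G (of_real s)"
    and z: "0 \<le> Re z"
  shows "laplace M z = G z"
proof -
  have inner: "laplace M w - G w = 0" if w: "0 < Re w" for w
  proof (rule analytic_continuation[where S="{z. 0 < Re z}" and U="of_real ` {0<..}" and \<xi>=1 and f="\<lambda>w. laplace M w - G w"])
    show "(\<lambda>w. laplace M w - G w) holomorphic_on {z. 0 < Re z}"
      by (intro holomorphic_intros holomorphic_on_laplace M G)
    show "open {z. 0 < Re z}" by (rule open_halfspace_Re_gt)
    show "connected {z. 0 < Re z}" by (intro convex_connected convex_halfspace_Re_gt)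
    show "(1::complex) islimpt of_real ` {0<..}"
      unfolding islimpt_sequential
    proof (intro exI[of _ "\<lambda>n. complex_of_real (1 + inverse (real (Suc n)))"] conjI allI)
      fix n show "complex_of_real (1 + inverse (real (Suc n))) \<in> of_real ` {0<..} - {1}"
        by (auto simp del: of_real_add simp: of_real_eq_1_iff add_pos_pos)
      have "(\<lambda>n. complex_of_real (1 + inverse (real (Suc n)))) \<longlonglongrightarrow> of_real (1 + 0)"
        by (intro tendsto_of_real tendsto_add tendsto_const LIMSEQ_inverse_real_of_nat)
      then show "(\<lambda>n. complex_of_real (1 + inverse (real (Suc n)))) \<longlonglongrightarrow> 1" by simp
    qed
  qed (use eq w in auto)
  have "(\<lambda>w. laplace M w - G w) z = 0"
  proof (rule LIMSEQ_unique)
    let ?w = "\<lambda>n. z + of_real (inverse (real (Suc n)))"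
    have "?w \<longlonglongrightarrow> z + of_real 0"
      by (intro tendsto_of_real tendsto_add tendsto_const LIMSEQ_inverse_real_of_nat)
    moreover have "continuous_on {z. 0 \<le> Re z} (\<lambda>w. laplace M w - G w)"
      by (intro continuous_intros continuous_on_laplace M G)
    ultimately have "((\<lambda>w. laplace M w - G w) \<circ> ?w) \<longlonglongrightarrow> laplace M z - G z"
      using z unfolding continuous_on_sequentially by (auto simp del: of_nat_Suc intro!: add_nonneg_nonneg)
    then show "(\<lambda>n. laplace M (?w n) - G (?w n)) \<longlonglongrightarrow> laplace M z - G z" by (simp add: comp_def)
    show "(\<lambda>n. laplace M (?w n) - G (?w n)) \<longlonglongrightarrow> 0"
      using z by (subst inner) (auto simp del: of_nat_Suc intro!: add_nonneg_pos)
  qed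
  then show ?thesis by simp
qed

lemma char_eq_laplace: "char M \<theta> = laplace M (- (\<i> * of_real \<theta>))"
  by (simp add: char_def laplace_def mult_ac)

lemma laplace_of_real:
  "laplace M (of_real s) = of_real (LINT x|M. exp (- (s * x)))"
proof -
  have *: "(\<lambda>x. exp (- (of_real s * complex_of_real x))) = (\<lambda>x. complex_of_real (exp (- (s * x))))"
    by (simp flip: exp_of_real)
  show ?thesis
    unfolding laplace_def * by (rule integral_complex_of_real)
qed

text \<open>The values on the imaginary axis are the characteristic function, which determines the law.\<close>

lemma laplace_unique:
  assumes M: "real_distribution M" "AE x in M. 0 \<le> x"
    and N: "real_distribution N" "AE x in N. 0 \<le> x"
    and eq: "\<And>s. 0 < s \<Longrightarrow> (LINT x|M. exp (- (s * x))) = (LINT x|N. exp (- (s * x)))"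
  shows "M = N"
proof (rule Levy_uniqueness)
  have "laplace M z = laplace N z" if "0 \<le> Re z" for z
    by (rule laplace_eq_on_half_plane[OF M holomorphic_on_laplace[OF N] continuous_on_laplace[OF N] _ that])
       (simp add: laplace_of_real eq)
  then show "char M = char N"
    by (simp add: fun_eq_iff char_eq_laplace)
qed (fact M N)+

section \<open>Fourier inversion for integrable characteristic functions\<close>

text \<open>The kernel of the Levy inversion formula.\<close>

definition inversion_kernel :: "real \<Rightarrow> real \<Rightarrow> real \<Rightarrow> complex" where
  "inversion_kernel a b t = (iexp (-(t * a)) - iexp (-(t * b))) / (\<i> * t)"

definition fourier_density :: "real measure \<Rightarrow> real \<Rightarrow> real" where
  "fourier_density M x = Re (CLBINT t. iexp (-(t * x)) * char M t) / (2 * pi)"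

lemma norm_inversion_kernel_le: "norm (inversion_kernel a b t) \<le> \<bar>b - a\<bar>"
proof -
  have le: "norm (inversion_kernel a b t) \<le> b - a" if "a \<le> b" for a b
    using Levy_Inversion_aux2[of "-b" "-a" t] that
    by (cases "t = 0") (auto simp: inversion_kernel_def)
  have "norm (inversion_kernel a b t) = norm (inversion_kernel b a t)"
    by (simp add: inversion_kernel_def norm_divide norm_minus_commute)
  then show ?thesis
    using le[of a b] le[of b a] by (cases "a \<le> b") auto
qed

lemma borel_measurable_inversion_kernel [measurable]: "inversion_kernel a b \<in> borel_measurable borel"
  unfolding inversion_kernel_def by measurable

context real_distribution
begin

lemma integrable_inversion_kernel:
  assumes "integrable lborel (char M)"
  shows "integrable lborel (\<lambda>t. inversion_kernel a b t * char M t)"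
proof (rule Bochner_Integration.integrable_bound[where f="\<lambda>t. \<bar>b - a\<bar> * norm (char M t)"])
  show "AE t in lborel. norm (inversion_kernel a b t * char M t) \<le> norm (\<bar>b - a\<bar> * norm (char M t))"
    by (auto simp: norm_mult intro!: mult_right_mono norm_inversion_kernel_le)
qed (use assms in auto)

text \<open>The inversion formula is a limit of integrals over \<open>(- n, n)\<close>; an integrable characteristic function
  turns it into one convergent integral.\<close>

lemma inversion_integrable_char_continuity_points:
  assumes int: "integrable lborel (char M)"
    and "a \<le> b" "measure M {a} = 0" "measure M {b} = 0"
  shows "2 * pi * measure M {a<..b} = Re (CLBINT t. inversion_kernel a b t * char M t)"
proof -
  let ?f = "\<lambda>t. inversion_kernel a b t * char M t"
  have "(\<lambda>n. CLBINT t. indicator {- real n<..<real n} t *\<^sub>R ?f t) \<longlonglongrightarrow> (CLBINT t. ?f t)"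
  proof (rule integral_dominated_convergence[where w="\<lambda>t. norm (?f t)"])
    show "AE t in lborel. (\<lambda>n. indicator {- real n<..<real n} t *\<^sub>R ?f t) \<longlonglongrightarrow> ?f t"
    proof (rule AE_I2)
      fix t :: real
      obtain N where N: "\<bar>t\<bar> < real N" using reals_Archimedean2 by blast
      have "eventually (\<lambda>n. indicator {- real n<..<real n} t *\<^sub>R ?f t = ?f t) sequentially"
        using eventually_ge_at_top[of N]
        by eventually_elim (use N in \<open>auto simp: indicator_def\<close>)
      then show "(\<lambda>n. indicator {- real n<..<real n} t *\<^sub>R ?f t) \<longlonglongrightarrow> ?f t"
        by (rule tendsto_eventually)
    qed
    show "integrable lborel (\<lambda>t. norm (?f t))"
      using integrable_inversion_kernel[OF int] by simp
  qed (auto simp: indicator_def)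
  moreover have "(CLBINT t=-real n..real n. (iexp (-(t * a)) - iexp (-(t * b))) / (\<i> * t) * char M t)
      = (CLBINT t. indicator {- real n<..<real n} t *\<^sub>R ?f t)" for n
    by (simp add: interval_lebesgue_integral_def inversion_kernel_def set_lebesgue_integral_def)
  moreover have "(\<lambda>n. 1 / (2 * pi) * (CLBINT t=-real n..real n. (iexp (-(t * a)) - iexp (-(t * b))) / (\<i> * t) * char M t))
      \<longlonglongrightarrow> measure M {a<..b}"
    using Levy_Inversion[OF assms(2-4)] by simp
  ultimately have "(\<lambda>n. 1 / (2 * pi) * (CLBINT t. indicator {- real n<..<real n} t *\<^sub>R ?f t)) \<longlonglongrightarrow> measure M {a<..b}"
    "(\<lambda>n. 1 / (2 * pi) * (CLBINT t. indicator {- real n<..<real n} t *\<^sub>R ?f t)) \<longlonglongrightarrow> 1 / (2 * pi) * (CLBINT t. ?f t)"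
    by (simp only:, intro tendsto_intros)
  from LIMSEQ_unique[OF this] have "complex_of_real (measure M {a<..b}) = 1 / (2 * pi) * (CLBINT t. ?f t)" .
  then have "complex_of_real (2 * pi * measure M {a<..b}) = (CLBINT t. ?f t)"
    by (simp add: field_simps)
  then show ?thesis by (metis Re_complex_of_real)
qed

text \<open>An interval between continuity points has measure at most its length times a constant, and there are
  such intervals of arbitrarily small length around every point.\<close>

lemma measure_singleton_integrable_char:
  assumes int: "integrable lborel (char M)"
  shows "measure M {x} = 0"
proof (rule ccontr)
  assume "measure M {x} \<noteq> 0"
  then have p: "0 < measure M {x}" by (simp add: less_le)
  define C where "C = (LBINT t. norm (char M t))"
  have C: "0 \<le> C" unfolding C_def by (rule Bochner_Integration.integral_nonneg) simp
  \<comment> \<open>An interval of length \<open>2 e\<close> has mass at most \<open>C e / \<pi>\<close>, which is less than the mass of the point.\<close>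
  define e where "e = measure M {x} / (C + 1)"
  have e: "0 < e" using p C by (simp add: e_def)
  have count: "countable {x. measure M {x} \<noteq> 0}" by (rule countable_support)
  obtain a where a: "x - e < a" "a < x" "measure M {a} = 0"
    using open_minus_countable[OF count, of "{x - e<..<x}"] e by auto
  obtain b where b: "x < b" "b < x + e" "measure M {b} = 0"
    using open_minus_countable[OF count, of "{x<..<x + e}"] e by auto
  have "2 * pi * measure M {x} \<le> 2 * pi * measure M {a<..b}"
    using a b by (intro mult_left_mono finite_measure_mono) auto
  also have "\<dots> = Re (CLBINT t. inversion_kernel a b t * char M t)"
    using a b by (intro inversion_integrable_char_continuity_points int) auto
  also have "\<dots> \<le> norm (CLBINT t. inversion_kernel a b t * char M t)"
    by (rule complex_Re_le_cmod)
  also have "\<dots> \<le> (LBINT t. norm (inversion_kernel a b t * char M t))"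
    by (rule integral_norm_bound)
  also have "\<dots> \<le> (LBINT t. \<bar>b - a\<bar> * norm (char M t))"
    using int integrable_norm[OF integrable_inversion_kernel[OF int]]
    by (intro integral_mono) (auto simp: norm_mult intro!: mult_right_mono norm_inversion_kernel_le)
  also have "\<dots> = (b - a) * C" using a b by (simp add: C_def)
  also have "\<dots> \<le> (2 * e) * C" using a b C by (intro mult_right_mono) auto
  also have "\<dots> < 2 * (e * (C + 1))" using e by (simp add: algebra_simps)
  also have "e * (C + 1) = measure M {x}" using C by (simp add: e_def)
  finally have "pi * measure M {x} < 1 * measure M {x}" by simp
  moreover have "1 * measure M {x} \<le> pi * measure M {x}"
    using pi_gt3 p by (intro mult_right_mono) auto
  ultimately show False by simp
qed

lemma cdf_diff_inversion:
  assumes int: "integrable lborel (char M)"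
  shows "cdf M b - cdf M a = Re (CLBINT t. inversion_kernel a b t * char M t) / (2 * pi)"
proof -
  have le: "cdf M b - cdf M a = Re (CLBINT t. inversion_kernel a b t * char M t) / (2 * pi)" if "a < b" for a b
    using inversion_integrable_char_continuity_points[OF int, of a b] that
      measure_singleton_integrable_char[OF int]
    by (simp add: cdf_diff_eq field_simps)
  have swap: "inversion_kernel a b t * char M t = - (inversion_kernel b a t * char M t)" for t
    unfolding inversion_kernel_def by (metis minus_diff_eq minus_divide_left mult_minus_left)
  have "(CLBINT t. inversion_kernel a b t * char M t) = - (CLBINT t. inversion_kernel b a t * char M t)"
    by (subst swap) simp
  then show ?thesis
    using le[of a b] le[of b a] by (cases a b rule: linorder_cases) (auto simp: inversion_kernel_def)
qed

text \<open>The distribution function is differentiated under the inversion integral: the difference quotient of the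
  kernel is bounded by \<open>1\<close> and converges to \<open>exp(- i t x)\<close>. This yields a derivative at every
  point, not just almost everywhere, and nonnegativity of the density follows from monotonicity.\<close>

lemma DERIV_cdf_fourier_density:
  assumes int: "integrable lborel (char M)"
  shows "(cdf M has_real_derivative fourier_density M x) (at x)"
  unfolding has_field_derivative_iff tendsto_at_iff_sequentially
proof (intro allI impI)
  fix y :: "nat \<Rightarrow> real"
  assume y: "\<forall>i. y i \<in> UNIV - {x}" and lim: "y \<longlonglongrightarrow> x"
  let ?q = "\<lambda>n t. inversion_kernel x (y n) t / of_real (y n - x) * char M t"
  have "(\<lambda>n. CLBINT t. ?q n t) \<longlonglongrightarrow> (CLBINT t. iexp (-(t * x)) * char M t)"
  proof (rule integral_dominated_convergence[where w="\<lambda>t. norm (char M t)"])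
    show "AE t in lborel. (\<lambda>n. ?q n t) \<longlonglongrightarrow> iexp (-(t * x)) * char M t"
      using AE_lborel_singleton[of 0]
    proof eventually_elim
      fix t :: real assume t: "t \<noteq> 0"
      let ?f = "\<lambda>z. exp (- (\<i> * of_real t * z))"
      have "(?f has_field_derivative - (\<i> * of_real t) * ?f (of_real x)) (at (of_real x))"
        by (auto intro!: derivative_eq_intros)
      then have "((\<lambda>z. (?f z - ?f (of_real x)) / (z - of_real x)) \<longlongrightarrow> - (\<i> * of_real t) * ?f (of_real x)) (at (of_real x))"
        by (simp add: has_field_derivative_iff)
      note this[unfolded tendsto_at_iff_sequentially, rule_format, of "\<lambda>n. of_real (y n)"]
      then have "((\<lambda>z. (?f z - ?f (of_real x)) / (z - of_real x)) \<circ> (\<lambda>n. of_real (y n))) \<longlonglongrightarrow> - (\<i> * of_real t) * ?f (of_real x)"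
        using y tendsto_of_real[OF lim] by simp
      then have "(\<lambda>n. - (1 / (\<i> * of_real t)) * ((?f (of_real (y n)) - ?f (of_real x)) / (of_real (y n) - of_real x)) * char M t)
          \<longlonglongrightarrow> - (1 / (\<i> * of_real t)) * (- (\<i> * of_real t) * ?f (of_real x)) * char M t"
        unfolding comp_def by (intro tendsto_intros)
      moreover have "- (1 / (\<i> * of_real t)) * (- (\<i> * of_real t) * ?f (of_real x)) * char M t = iexp (-(t * x)) * char M t"
        using t by (simp add: mult_ac)
      moreover have "- (1 / (\<i> * of_real t)) * ((?f (of_real (y n)) - ?f (of_real x)) / (of_real (y n) - of_real x)) * char M t
          = ?q n t" for n
      proof -
        have alg: "- (1 / p) * ((E - F) / d) * c = (F - E) / p / d * c" for p E F d c :: complex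
          by (simp add: divide_inverse algebra_simps)
        have iexp: "iexp (-(t * z)) = ?f (of_real z)" for z
          by (simp add: mult.assoc)
        show ?thesis
          unfolding inversion_kernel_def alg iexp of_real_diff ..
      qed
      ultimately show "(\<lambda>n. ?q n t) \<longlonglongrightarrow> iexp (-(t * x)) * char M t"
        by (simp only:)
    qed
    show "AE t in lborel. norm (?q n t) \<le> norm (char M t)" for n
    proof (rule AE_I2)
      fix t
      have "norm (inversion_kernel x (y n) t / of_real (y n - x)) \<le> 1"
        using norm_inversion_kernel_le[of x "y n" t] y
        by (simp add: norm_divide del: of_real_diff)
      then show "norm (?q n t) \<le> norm (char M t)"
        using mult_right_mono[OF _ norm_ge_zero[of "char M t"]] by (fastforce simp only: norm_mult mult_1)
    qed
  qed (use int in auto)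
  then have "(\<lambda>n. Re (CLBINT t. ?q n t) / (2 * pi)) \<longlonglongrightarrow> fourier_density M x"
    unfolding fourier_density_def by (intro tendsto_intros) auto
  moreover have "Re (CLBINT t. ?q n t) / (2 * pi) = (cdf M (y n) - cdf M x) / (y n - x)" for n
  proof -
    have "(CLBINT t. ?q n t) = (CLBINT t. inversion_kernel x (y n) t * char M t) / of_real (y n - x)"
      unfolding times_divide_eq_left by (rule integral_divide_zero)
    then show ?thesis
      by (simp add: cdf_diff_inversion[OF int] Re_divide_of_real del: of_real_diff)
  qed
  ultimately show "((\<lambda>y. (cdf M y - cdf M x) / (y - x)) \<circ> y) \<longlonglongrightarrow> fourier_density M x"
    by (simp add: comp_def)
qed

lemma fourier_density_nonneg:
  assumes int: "integrable lborel (char M)"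
  shows "0 \<le> fourier_density M x"
proof (rule mono_on_imp_deriv_nonneg)
  show "mono_on UNIV (cdf M)" by (intro mono_onI cdf_nondecreasing)
qed (use DERIV_cdf_fourier_density[OF int] in auto)

lemma continuous_on_fourier_density:
  assumes int: "integrable lborel (char M)"
  shows "continuous_on UNIV (fourier_density M)"
  unfolding continuous_on_sequentially
proof (intro allI ballI impI, elim conjE)
  fix y :: "nat \<Rightarrow> real" and x
  assume lim: "y \<longlonglongrightarrow> x"
  have "(\<lambda>n. CLBINT t. iexp (-(t * y n)) * char M t) \<longlonglongrightarrow> (CLBINT t. iexp (-(t * x)) * char M t)"
    by (rule integral_dominated_convergence[where w="\<lambda>t. norm (char M t)"])
       (use int in \<open>auto intro!: AE_I2 tendsto_intros lim simp: norm_mult\<close>)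
  then show "(fourier_density M \<circ> y) \<longlonglongrightarrow> fourier_density M x"
    unfolding fourier_density_def comp_def by (intro tendsto_intros) auto
qed

lemma fourier_density_le:
  assumes int: "integrable lborel (char M)"
  shows "fourier_density M x \<le> (LBINT t. norm (char M t)) / (2 * pi)"
proof -
  have "Re (CLBINT t. iexp (-(t * x)) * char M t) \<le> norm (CLBINT t. iexp (-(t * x)) * char M t)"
    by (rule complex_Re_le_cmod)
  also have "\<dots> \<le> (LBINT t. norm (iexp (-(t * x)) * char M t))"
    by (rule integral_norm_bound)
  also have "\<dots> = (LBINT t. norm (char M t))" by (simp add: norm_mult)
  finally show ?thesis unfolding fourier_density_def by (intro divide_right_mono) auto
qed

lemma eq_density_fourier_density:
  assumes int: "integrable lborel (char M)"
  shows "M = density lborel (\<lambda>x. ennreal (fourier_density M x))"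
proof (rule measure_eqI_lessThan)
  have meas [measurable]: "fourier_density M \<in> borel_measurable borel"
    using continuous_on_fourier_density[OF int] by (rule borel_measurable_continuous_onI)
  fix x
  have "emeasure M {x<..} = ennreal (1 - cdf M x)"
  proof -
    have "{x<..} = space M - {..x}" by auto
    then show ?thesis
      using prob_compl[of "{..x}"] by (simp add: emeasure_eq_measure cdf_def2)
  qed
  also have "\<dots> = (\<integral>\<^sup>+y. ennreal (fourier_density M y) * indicator {x..} y \<partial>lborel)"
    by (subst nn_integral_FTC_atLeast[OF meas DERIV_cdf_fourier_density[OF int] fourier_density_nonneg[OF int] cdf_lim_at_top_prob]) auto
  also have "\<dots> = (\<integral>\<^sup>+y. ennreal (fourier_density M y) * indicator {x<..} y \<partial>lborel)"
    by (rule nn_integral_cong_AE) (use AE_lborel_singleton[of x] in \<open>auto elim!: eventually_mono simp: indicator_def\<close>)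
  also have "\<dots> = emeasure (density lborel (\<lambda>x. ennreal (fourier_density M x))) {x<..}"
    by (simp add: emeasure_density)
  finally show "emeasure M {x<..} = emeasure (density lborel (\<lambda>x. ennreal (fourier_density M x))) {x<..}" .
qed (auto simp: emeasure_eq_measure less_top)

end

section \<open>One-sided stable laws: characteristic function and density bounds\<close>

text \<open>The law of a stable subordinator at time \<open>u\<close>.\<close>

locale stable_law = real_distribution M for M :: "real measure" +
  fixes \<alpha> u :: real
  assumes alpha: "0 < \<alpha>" "\<alpha> < 1" and u_pos: "0 < u"
    and AE_nonneg: "AE x in M. 0 \<le> x"
    and laplace_transform: "\<And>s. 0 < s \<Longrightarrow> (LINT x|M. exp (- (s * x))) = exp (- (u * s powr \<alpha>))"

definition stretched_exp_integral :: "real \<Rightarrow> real" where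
  "stretched_exp_integral \<alpha> = (LBINT y. exp (- (\<bar>y\<bar> powr \<alpha>)))"

text \<open>The exponential of \<open>z = \<bar>y\<bar>\<^sup>\<alpha>\<close> exceeds \<open>z ^ n / n!\<close>, which is at least \<open>y\<^sup>2 / n!\<close> when
  \<open>n \<alpha> \<ge> 2\<close> and \<open>\<bar>y\<bar> \<ge> 1\<close>; so the Cauchy density dominates.\<close>

lemma integrable_stretched_exp:
  assumes "0 < (\<alpha>::real)"
  shows "integrable lborel (\<lambda>y. exp (- (\<bar>y\<bar> powr \<alpha>)))"
proof -
  obtain n :: nat where n: "2 / \<alpha> < real n" using reals_Archimedean2 by blast
  show ?thesis
  proof (rule Bochner_Integration.integrable_bound[where f="\<lambda>y. 2 * fact n * inverse (1 + y\<^sup>2)"])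
    show "integrable lborel (\<lambda>y::real. 2 * fact n * inverse (1 + y\<^sup>2))"
      using integrable_inverse_1_plus_square by (simp add: set_integrable_def einterval_def)
    have "exp (- (\<bar>y\<bar> powr \<alpha>)) \<le> 2 * fact n * inverse (1 + y\<^sup>2)" for y :: real
    proof (cases "\<bar>y\<bar> \<le> 1")
      case True
      have "y\<^sup>2 \<le> 1" using True by (simp add: abs_square_le_1)
      have "exp (- (\<bar>y\<bar> powr \<alpha>)) \<le> 1" by simp
      also have "1 \<le> 2 * inverse (1 + y\<^sup>2)"
        using \<open>y\<^sup>2 \<le> 1\<close> by (simp add: field_simps add_pos_nonneg)
      also have "\<dots> \<le> 2 * fact n * inverse (1 + y\<^sup>2)"
        by (intro mult_right_mono) (auto simp: fact_ge_1)
      finally show ?thesis .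
    next
      case False
      then have y: "1 < \<bar>y\<bar>" by simp
      let ?z = "\<bar>y\<bar> powr \<alpha>"
      have z: "0 < ?z" using y by simp
      have "?z ^ n / fact n \<le> exp ?z"
      proof -
        have "(\<Sum>i<Suc n. ?z ^ i /\<^sub>R fact i) \<le> (\<Sum>i. ?z ^ i /\<^sub>R fact i)"
          using summable_exp_generic[of ?z] by (intro sum_le_suminf) auto
        moreover have "?z ^ n / fact n \<le> (\<Sum>i<Suc n. ?z ^ i /\<^sub>R fact i)"
          using z by (simp add: sum_nonneg divide_inverse mult.commute)
        moreover have "(\<Sum>i. ?z ^ i /\<^sub>R fact i) = exp ?z"
          by (simp add: exp_def)
        ultimately show ?thesis by linarith
      qed
      moreover have "?z ^ n = \<bar>y\<bar> powr (\<alpha> * real n)"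
        using y by (simp add: powr_powr flip: powr_realpow)
      moreover have "\<bar>y\<bar> powr 2 \<le> \<bar>y\<bar> powr (\<alpha> * real n)"
        using y n assms by (intro powr_mono) (auto simp: field_simps)
      moreover have "\<bar>y\<bar> powr 2 = y\<^sup>2"
        using y by simp
      ultimately have "y\<^sup>2 \<le> fact n * exp ?z"
        by (simp add: field_simps)
      moreover have "1 \<le> \<bar>y\<bar>\<^sup>2" using y by (intro one_le_power) simp
      ultimately have "1 + y\<^sup>2 \<le> 2 * fact n * exp ?z" by simp
      then show ?thesis
        by (simp add: exp_minus field_simps add_pos_nonneg)
    qed
    then show "AE y in lborel. norm (exp (- (\<bar>y\<bar> powr \<alpha>))) \<le> norm (2 * fact n * inverse (1 + y\<^sup>2))"
      by (auto intro: order_trans[OF _ abs_ge_self])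
  qed auto
qed

lemma stretched_exp_scaled:
  assumes "0 < (\<alpha>::real)" "0 < \<kappa>"
  shows "integrable lborel (\<lambda>y. exp (- (\<kappa> * \<bar>y\<bar> powr \<alpha>)))"
    and "(LBINT y. exp (- (\<kappa> * \<bar>y\<bar> powr \<alpha>))) = \<kappa> powr (- 1 / \<alpha>) * stretched_exp_integral \<alpha>"
proof -
  let ?c = "\<kappa> powr (1 / \<alpha>)"
  have c: "0 < ?c" using assms by simp
  have eq: "exp (- (\<bar>0 + ?c * y\<bar> powr \<alpha>)) = exp (- (\<kappa> * \<bar>y\<bar> powr \<alpha>))" for y
    using assms by (simp add: abs_mult powr_mult powr_powr)
  show "integrable lborel (\<lambda>y. exp (- (\<kappa> * \<bar>y\<bar> powr \<alpha>)))"
    using lborel_integrable_real_affine[OF integrable_stretched_exp[OF assms(1)], of ?c 0] c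
    unfolding eq by simp
  have "stretched_exp_integral \<alpha> = ?c * (LBINT y. exp (- (\<kappa> * \<bar>y\<bar> powr \<alpha>)))"
    unfolding stretched_exp_integral_def
    using c by (subst lborel_integral_real_affine[of ?c _ 0]) (simp_all only: eq, auto)
  then show "(LBINT y. exp (- (\<kappa> * \<bar>y\<bar> powr \<alpha>))) = \<kappa> powr (- 1 / \<alpha>) * stretched_exp_integral \<alpha>"
    using assms by (simp add: powr_minus_divide)
qed

lemma exponent_imaginary_axis:
  fixes \<theta> \<alpha> :: real
  assumes "0 \<le> \<theta>"
  shows "(- (\<i> * of_real \<theta>)) powr of_real \<alpha> = of_real (\<theta> powr \<alpha>) * exp (- (\<i> * of_real (pi * \<alpha> / 2)))"
proof -
  have "(- (\<i> * of_real \<theta>)) powr of_real \<alpha> = (of_real \<theta> * (- \<i>)) powr of_real \<alpha>"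
    by (simp add: mult.commute)
  also have "\<dots> = of_real \<theta> powr of_real \<alpha> * (- \<i>) powr of_real \<alpha>"
    using assms by (intro powr_times_real_left) auto
  also have "of_real \<theta> powr of_real \<alpha> = complex_of_real (\<theta> powr \<alpha>)"
    using assms by (simp add: powr_of_real)
  also have "(- \<i>) powr complex_of_real \<alpha> = exp (- (\<i> * of_real (pi * \<alpha> / 2)))"
    by (simp add: powr_def Ln_minus_ii mult_ac)
  finally show ?thesis .
qed

lemma Re_exponent_imaginary_axis:
  fixes \<theta> \<alpha> :: real
  shows "Re ((- (\<i> * of_real \<theta>)) powr of_real \<alpha>) = \<bar>\<theta>\<bar> powr \<alpha> * cos (pi * \<alpha> / 2)"
proof -
  have pos: "Re ((- (\<i> * of_real \<theta>)) powr of_real \<alpha>) = \<bar>\<theta>\<bar> powr \<alpha> * cos (pi * \<alpha> / 2)" if "0 \<le> \<theta>" for \<theta>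
    using that by (simp add: exponent_imaginary_axis Re_exp)
  have "cnj ((- (\<i> * of_real \<theta>)) powr of_real \<alpha>) = (- (\<i> * of_real (- \<theta>))) powr of_real \<alpha>"
    by (subst cnj_powr) auto
  then have "Re ((- (\<i> * of_real \<theta>)) powr of_real \<alpha>) = Re ((- (\<i> * of_real (- \<theta>))) powr of_real \<alpha>)"
    by (metis complex_cnj(1) cnj.simps(1))
  then show ?thesis using pos[of \<theta>] pos[of "- \<theta>"] by (cases "0 \<le> \<theta>") auto
qed

context stable_law
begin

text \<open>On the imaginary axis the real part of \<open>(- i \<theta>)\<^sup>\<alpha>\<close> is \<open>decay * \<bar>\<theta>\<bar>\<^sup>\<alpha>\<close>; it is positive because
  \<open>\<alpha> < 1\<close>.\<close>

definition decay :: real where "decay = cos (pi * \<alpha> / 2)"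

lemma decay_pos: "0 < decay"
  unfolding decay_def using alpha by (intro cos_gt_zero_pi) (auto simp: field_simps intro: less_le_trans[of _ 0])

text \<open>With the principal branch, \<open>z\<^sup>\<alpha>\<close> is holomorphic on the open right half-plane and continuous up to its
  boundary, including the origin since \<open>\<alpha> > 0\<close>.\<close>

lemma char_eq: "char M \<theta> = exp (- (of_real u * (- (\<i> * of_real \<theta>)) powr of_real \<alpha>))"
  unfolding char_eq_laplace
proof (rule laplace_eq_on_half_plane[where G="\<lambda>z. exp (- (of_real u * z powr of_real \<alpha>))"])
  show "(\<lambda>z. exp (- (of_real u * z powr of_real \<alpha>))) holomorphic_on {z. 0 < Re z}"
    by (intro holomorphic_intros) (auto simp: complex_nonpos_Reals_iff)
  show "continuous_on {z. 0 \<le> Re z} (\<lambda>z. exp (- (of_real u * z powr of_real \<alpha>)))"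
    using alpha by (intro continuous_intros) auto
  fix s :: real assume s: "0 < s"
  have "complex_of_real s powr of_real \<alpha> = of_real (s powr \<alpha>)"
    using s by (simp add: powr_of_real)
  then show "laplace M (of_real s) = exp (- (of_real u * of_real s powr of_real \<alpha>))"
    by (simp add: laplace_of_real laplace_transform[OF s] flip: exp_of_real)
qed (use AE_nonneg real_distribution_axioms in auto)

lemma norm_char: "norm (char M \<theta>) = exp (- (u * decay * \<bar>\<theta>\<bar> powr \<alpha>))"
  by (simp add: char_eq norm_exp_eq_Re Re_exponent_imaginary_axis decay_def mult_ac)

lemma integrable_char: "integrable lborel (char M)"
proof (subst integrable_norm_iff[symmetric])
  show "integrable lborel (\<lambda>\<theta>. norm (char M \<theta>))"
    unfolding norm_char using alpha u_pos decay_pos by (intro stretched_exp_scaled) auto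
qed auto

lemma fourier_density_le_scale:
  "fourier_density M x \<le> (decay powr (- 1 / \<alpha>) * stretched_exp_integral \<alpha> / (2 * pi)) * u powr (- 1 / \<alpha>)"
proof -
  have "fourier_density M x \<le> (LBINT t. norm (char M t)) / (2 * pi)"
    by (rule fourier_density_le[OF integrable_char])
  also have "(LBINT t. norm (char M t)) = (u * decay) powr (- 1 / \<alpha>) * stretched_exp_integral \<alpha>"
    unfolding norm_char using alpha u_pos decay_pos by (intro stretched_exp_scaled) auto
  finally show ?thesis using u_pos decay_pos by (simp add: powr_mult mult_ac)
qed

lemma DERIV_exponent:
  "0 < t \<Longrightarrow> ((\<lambda>t. - exp (- (u * decay * t powr \<alpha>)) / decay) has_real_derivative u * \<alpha> * t powr (\<alpha> - 1) * exp (- (u * decay * t powr \<alpha>))) (at t)"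
  using decay_pos by (auto intro!: derivative_eq_intros simp: field_simps)

lemma powr_at_right_0: "((\<lambda>t. t powr \<alpha>) \<longlongrightarrow> 0) (at_right 0)"
proof -
  have "((\<lambda>t. t powr \<alpha>) \<longlongrightarrow> 0 powr \<alpha>) (at_right 0)"
    using alpha by (intro tendsto_powr' tendsto_intros) (auto simp: eventually_at_filter)
  then show ?thesis by simp
qed

lemma powr_at_top: "LIM t at_top. u * decay * t powr \<alpha> :> at_top"
proof (intro filterlim_tendsto_pos_mult_at_top[OF tendsto_const])
  have "LIM t at_top. exp (\<alpha> * ln t) :> at_top"
    using alpha
    by (intro filterlim_compose[OF exp_at_top] filterlim_tendsto_pos_mult_at_top[OF tendsto_const _ ln_at_top])
  then show "LIM t at_top. t powr \<alpha> :> at_top"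
    by (rule filterlim_mono_eventually[OF _ order_refl order_refl])
       (use eventually_gt_at_top[of 0] in \<open>auto elim!: eventually_mono simp: powr_def\<close>)
qed (use u_pos decay_pos in auto)

lemma integral_exponent_derivative:
  shows "set_integrable lborel {0<..} (\<lambda>t. u * \<alpha> * t powr (\<alpha> - 1) * exp (- (u * decay * t powr \<alpha>)))"
    and "(LBINT t:{0<..}. u * \<alpha> * t powr (\<alpha> - 1) * exp (- (u * decay * t powr \<alpha>))) = 1 / decay"
proof -
  have A: "(((\<lambda>t. - exp (- (u * decay * t powr \<alpha>)) / decay) \<circ> real_of_ereal) \<longlongrightarrow> - 1 / decay) (at_right 0)"
    unfolding zero_ereal_def ereal_tendsto_simps
  proof -
    have "((\<lambda>t. - exp (- (u * decay * t powr \<alpha>)) / decay) \<longlongrightarrow> - exp (- (u * decay * 0)) / decay) (at_right 0)"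
      using decay_pos by (intro tendsto_intros powr_at_right_0) auto
    then show "((\<lambda>t. - exp (- (u * decay * t powr \<alpha>)) / decay) \<longlongrightarrow> - 1 / decay) (at_right 0)" by simp
  qed
  have "((\<lambda>t. exp (- (u * decay * t powr \<alpha>))) \<longlongrightarrow> 0) at_top"
    by (rule filterlim_compose[OF exp_at_bot]) (simp add: filterlim_uminus_at_bot powr_at_top)
  then have B: "(((\<lambda>t. - exp (- (u * decay * t powr \<alpha>)) / decay) \<circ> real_of_ereal) \<longlongrightarrow> 0) (at_left \<infinity>)"
    unfolding ereal_tendsto_simps
    using decay_pos tendsto_divide[OF tendsto_minus tendsto_const, of _ 0 at_top decay] by force
  note FTC = interval_integral_FTC_nonneg[where a=0 and b="\<infinity>", OF _ DERIV_exponent _ _ A B]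
  have 1: "isCont (\<lambda>t. u * \<alpha> * t powr (\<alpha> - 1) * exp (- (u * decay * t powr \<alpha>))) t" if "0 < t" for t
    using that by (intro continuous_intros) auto
  show "set_integrable lborel {0<..} (\<lambda>t. u * \<alpha> * t powr (\<alpha> - 1) * exp (- (u * decay * t powr \<alpha>)))"
    using FTC(1) 1 alpha u_pos by (auto simp: zero_ereal_def)
  have "(LBINT t=0..\<infinity>. u * \<alpha> * t powr (\<alpha> - 1) * exp (- (u * decay * t powr \<alpha>))) = 0 - - 1 / decay"
    using FTC(2) 1 alpha u_pos by (auto simp: zero_ereal_def)
  then show "(LBINT t:{0<..}. u * \<alpha> * t powr (\<alpha> - 1) * exp (- (u * decay * t powr \<alpha>))) = 1 / decay"
    by (simp add: interval_lebesgue_integral_def zero_ereal_def)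
qed

lemma cnj_char: "cnj (char M \<theta>) = char M (- \<theta>)"
proof -
  have "cnj ((- (\<i> * of_real \<theta>)) powr of_real \<alpha>) = (- (\<i> * of_real (- \<theta>))) powr of_real \<alpha>"
    by (subst cnj_powr) auto
  then show ?thesis
    by (simp add: char_eq exp_cnj)
qed

text \<open>The integrand at \<open>- t\<close> is the complex conjugate of that at \<open>t\<close>. The power \<open>(- i t)\<^sup>\<alpha>\<close> is smooth
  only away from \<open>0\<close>, so the integration by parts below takes place on the half-line.\<close>

lemma fourier_density_half_line:
  "fourier_density M x = Re (CLBINT t:{0<..}. iexp (-(t * x)) * char M t) / pi"
proof -
  let ?F = "\<lambda>t. iexp (-(t * x)) * char M t"
  define g where "g t = Re (?F t)" for t
  have int: "integrable lborel ?F"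
    by (rule Bochner_Integration.integrable_bound[OF integrable_char]) (auto simp: norm_mult)
  have int_half: "integrable lborel (\<lambda>t. indicator {0<..} t *\<^sub>R ?F t)"
    using int by (intro integrable_mult_indicator) auto
  have int_g: "integrable lborel g"
    unfolding g_def using int by (rule integrable_Re)
  have even: "g (- t) = g t" for t
  proof -
    have "?F (- t) = cnj (?F t)"
      by (simp add: cnj_char exp_cnj)
    then show ?thesis unfolding g_def by simp
  qed
  have [simp]: "integrable lborel (\<lambda>t. indicator {0<..} t * g t)" "integrable lborel (\<lambda>t. indicator {..<0} t * g t)"
    using integrable_mult_indicator[OF _ int_g] by auto
  have "(LBINT t. g t) = (LBINT t. indicator {0<..} t * g t + indicator {..<0} t * g t)"
    using int_g by (intro integral_cong_AE) (use AE_lborel_singleton[of "0::real"] in \<open>auto elim!: eventually_mono simp: indicator_def\<close>)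
  also have "\<dots> = (LBINT t. indicator {0<..} t * g t) + (LBINT t. indicator {..<0} t * g t)"
    by (rule Bochner_Integration.integral_add) auto
  also have "(LBINT t. indicator {..<0} t * g t) = (LBINT t. indicator {0<..} t * g t)"
    by (subst lborel_integral_real_affine[of "-1" _ 0]) (auto simp: even indicator_def)
  also have "(LBINT t. indicator {0<..} t * g t) = Re (CLBINT t. indicator {0<..} t *\<^sub>R ?F t)"
    by (subst integral_Re[OF int_half, symmetric]) (simp add: g_def)
  finally have "(LBINT t. g t) = 2 * Re (CLBINT t:{0<..}. ?F t)"
    by (simp add: set_lebesgue_integral_def)
  moreover have "(LBINT t. g t) = Re (CLBINT t. ?F t)"
    unfolding g_def by (rule integral_Re[OF int])
  ultimately show ?thesis by (simp add: fourier_density_def)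
qed

text \<open>Let \<open>G(t) = exp(- i t x) * char t\<close>. On \<open>t > 0\<close> its derivative is \<open>(- i x - k(t) e) G(t)\<close> with
  \<open>k(t) = u \<alpha> t\<^sup>\<alpha>\<^sup>-\<^sup>1\<close> and a number \<open>e\<close> of modulus \<open>1\<close>; integrating it from \<open>0\<close> to infinity gives
  \<open>- 1\<close>. So \<open>x\<close> times the integral of \<open>G\<close> is bounded by \<open>1\<close> plus the integral of \<open>k \<bar>G\<bar>\<close>, and the latter
  is an exact derivative with integral \<open>1 / decay\<close>. That \<open>u\<close> cancels is the point: the density at a
  fixed \<open>x > 0\<close> is bounded uniformly in the time \<open>u\<close>.\<close>

lemma abs_mult_fourier_density_le: "\<bar>x * fourier_density M x\<bar> \<le> (1 + 1 / decay) / pi"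
proof -
  define e where "e = exp (- (\<i> * of_real (pi * \<alpha> / 2)))"
  define G where "G t = iexp (-(t * x)) * char M t" for t
  define k where "k t = u * \<alpha> * t powr (\<alpha> - 1)" for t
  have norm_e: "norm e = 1" by (simp add: e_def norm_exp_eq_Re)
  have [measurable]: "k \<in> borel_measurable borel" "G \<in> borel_measurable borel"
    unfolding k_def G_def by measurable
  have norm_G: "norm (G t) = exp (- (u * decay * \<bar>t\<bar> powr \<alpha>))" for t
    by (simp add: G_def norm_mult norm_char)
  have G_eq: "G t = exp (- (\<i> * x) * of_real t - of_real u * e * of_real (t powr \<alpha>))" if "0 \<le> t" for t
  proof -
    have "char M t = exp (- (of_real u * (of_real (t powr \<alpha>) * e)))"
      unfolding char_eq exponent_imaginary_axis[OF that] e_def ..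
    then show ?thesis
      unfolding G_def by (simp only: exp_add[symmetric]) (simp add: algebra_simps)
  qed
  have deriv: "(G has_vector_derivative (- (\<i> * x) - of_real (k t) * e) * G t) (at t)" if t: "0 < t" for t
  proof -
    let ?h = "\<lambda>t. - (\<i> * x) * of_real t - of_real u * e * of_real (t powr \<alpha>)"
    have "((\<lambda>t. t powr \<alpha>) has_real_derivative \<alpha> * t powr (\<alpha> - 1)) (at t)"
      using t by (auto intro!: derivative_eq_intros)
    then have "((\<lambda>t. complex_of_real (t powr \<alpha>)) has_vector_derivative of_real (\<alpha> * t powr (\<alpha> - 1))) (at t)"
      by (rule has_vector_derivative_of_real[unfolded has_real_derivative_iff_has_vector_derivative[symmetric]])
    then have "(?h has_vector_derivative - (\<i> * x) - of_real (k t) * e) (at t)"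
      using t by (auto intro!: derivative_eq_intros simp: k_def mult_ac)
    from field_vector_diff_chain_at[OF this DERIV_exp]
    have "((\<lambda>t. exp (?h t)) has_vector_derivative (- (\<i> * x) - of_real (k t) * e) * exp (?h t)) (at t)"
      by (simp only: comp_def)
    then have "((\<lambda>t. exp (?h t)) has_vector_derivative (- (\<i> * x) - of_real (k t) * e) * G t) (at t)"
      using t by (simp only: G_eq less_imp_le)
    then show ?thesis
      by (rule has_vector_derivative_transform_within_open[where S="{0<..}"]) (use t in \<open>auto simp: G_eq\<close>)
  qed
  have G_cont: "isCont G t" if "0 < t" for t
    using deriv[OF that] by (rule has_vector_derivative_continuous)
  have G_int: "set_integrable lborel {0<..} G"
  proof -
    have "integrable lborel G"
      unfolding G_def by (rule Bochner_Integration.integrable_bound[OF integrable_char]) (auto simp: norm_mult)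
    then show ?thesis unfolding set_integrable_def by (intro integrable_mult_indicator) auto
  qed
  have kG_norm: "norm (of_real (k t) * e * G t) = u * \<alpha> * t powr (\<alpha> - 1) * exp (- (u * decay * t powr \<alpha>))" if "0 < t" for t
    using that u_pos alpha by (simp add: norm_mult norm_e norm_G k_def)
  have kG_int: "set_integrable lborel {0<..} (\<lambda>t. of_real (k t) * e * G t)"
    by (rule set_integrable_bound[OF integral_exponent_derivative(1)])
       (auto simp: set_borel_measurable_def kG_norm)
  have lim0: "(G \<longlongrightarrow> 1) (at_right 0)"
  proof -
    have "((\<lambda>t. exp (- (\<i> * x) * of_real t - of_real u * e * of_real (t powr \<alpha>))) \<longlongrightarrow> exp (- (\<i> * x) * of_real 0 - of_real u * e * of_real 0)) (at_right 0)"
      by (intro tendsto_intros powr_at_right_0)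
    then show ?thesis
      by (rule filterlim_mono_eventually[OF _ _ order_refl]) (auto simp: eventually_at_filter G_eq)
  qed
  have "((\<lambda>t. exp (- (u * decay * t powr \<alpha>))) \<longlongrightarrow> 0) at_top"
    by (rule filterlim_compose[OF exp_at_bot]) (simp add: filterlim_uminus_at_bot powr_at_top)
  then have lim_top: "(G \<longlongrightarrow> 0) at_top"
    by (rule Lim_null_comparison[rotated])
       (rule eventually_mono[OF eventually_ge_at_top[of 0]], simp add: norm_G)
  have "(CLBINT t=0..\<infinity>. (- (\<i> * x) - of_real (k t) * e) * G t) = 0 - 1"
  proof (rule interval_integral_FTC_integrable[where F=G])
    show "((G \<circ> real_of_ereal) \<longlongrightarrow> 1) (at_right 0)" "((G \<circ> real_of_ereal) \<longlongrightarrow> 0) (at_left \<infinity>)"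
      unfolding zero_ereal_def ereal_tendsto_simps by (fact lim0 lim_top)+
    show "set_integrable lborel (einterval 0 \<infinity>) (\<lambda>t. (- (\<i> * x) - of_real (k t) * e) * G t)"
      using set_integral_diff(1)[OF set_integrable_mult_right[OF G_int, of "- (\<i> * x)"] kG_int]
      by (simp add: zero_ereal_def left_diff_distrib)
    fix t :: real assume "0 < ereal t"
    then have t: "0 < t" by simp
    show "(G has_vector_derivative (- (\<i> * x) - of_real (k t) * e) * G t) (at t)" by (rule deriv[OF t])
    show "isCont (\<lambda>t. (- (\<i> * x) - of_real (k t) * e) * G t) t"
      unfolding k_def using t by (intro continuous_intros G_cont) auto
  qed simp
  moreover have "(CLBINT t=0..\<infinity>. (- (\<i> * x) - of_real (k t) * e) * G t)
      = - (\<i> * x) * (CLBINT t:{0<..}. G t) - (CLBINT t:{0<..}. of_real (k t) * e * G t)"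
  proof -
    have half: "(CLBINT t=0..\<infinity>. f t) = (CLBINT t:{0<..}. f t)" for f
      by (simp add: interval_lebesgue_integral_def zero_ereal_def)
    show ?thesis
      unfolding half left_diff_distrib
      by (subst set_integral_diff(2)[OF set_integrable_mult_right[OF G_int] kG_int])
         (simp only: set_integral_mult_right)
  qed
  ultimately have "\<i> * x * (CLBINT t:{0<..}. G t) = 1 - (CLBINT t:{0<..}. of_real (k t) * e * G t)"
    by (simp add: algebra_simps)
  then have "norm (\<i> * x * (CLBINT t:{0<..}. G t)) = norm (1 - (CLBINT t:{0<..}. of_real (k t) * e * G t))"
    by simp
  also have "\<dots> \<le> norm (1::complex) + norm (CLBINT t:{0<..}. of_real (k t) * e * G t)"
    by (rule norm_triangle_ineq4)
  also have "norm (CLBINT t:{0<..}. of_real (k t) * e * G t) \<le> (LBINT t:{0<..}. norm (of_real (k t) * e * G t))"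
    by (rule set_integral_norm_bound[OF kG_int])
  also have "\<dots> = (LBINT t:{0<..}. u * \<alpha> * t powr (\<alpha> - 1) * exp (- (u * decay * t powr \<alpha>)))"
    by (rule set_lebesgue_integral_cong) (auto simp: kG_norm)
  also have "\<dots> = 1 / decay" by (rule integral_exponent_derivative)
  finally have *: "\<bar>x\<bar> * norm (CLBINT t:{0<..}. G t) \<le> 1 + 1 / decay" by (simp add: norm_mult)
  have "\<bar>x * fourier_density M x\<bar> = \<bar>x\<bar> * \<bar>Re (CLBINT t:{0<..}. G t)\<bar> / pi"
    unfolding fourier_density_half_line G_def[symmetric] by (simp add: abs_mult)
  also have "\<dots> \<le> \<bar>x\<bar> * norm (CLBINT t:{0<..}. G t) / pi"
    by (intro divide_right_mono mult_left_mono abs_Re_le_cmod) auto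
  also have "\<dots> \<le> (1 + 1 / decay) / pi"
    using * by (intro divide_right_mono) auto
  finally show ?thesis .
qed

end

section \<open>Laplace uniqueness for functions; the Caputo kernel\<close>

text \<open>Multiplied by \<open>exp(- t)\<close> and normalised, \<open>a\<close> and \<open>b\<close> become probability densities on the half-line whose
  Laplace transforms are those of \<open>a\<close> and \<open>b\<close> shifted by \<open>1\<close>.\<close>

lemma AE_eq_if_Laplace_eq:
  fixes a b :: "real \<Rightarrow> ennreal"
  assumes [measurable]: "a \<in> borel_measurable borel" "b \<in> borel_measurable borel"
    and zero: "\<And>t. t < 0 \<Longrightarrow> a t = 0" "\<And>t. t < 0 \<Longrightarrow> b t = 0"
    and eq: "\<And>s. 0 < s \<Longrightarrow> (\<integral>\<^sup>+t. ennreal (exp (- (s * t))) * a t \<partial>lborel) = (\<integral>\<^sup>+t. ennreal (exp (- (s * t))) * b t \<partial>lborel)"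
    and fin: "\<And>s. 0 < s \<Longrightarrow> (\<integral>\<^sup>+t. ennreal (exp (- (s * t))) * a t \<partial>lborel) < \<infinity>"
  shows "AE t in lborel. a t = b t"
proof (cases "(\<integral>\<^sup>+t. ennreal (exp (- t)) * a t \<partial>lborel) = 0")
  case True
  then have "AE t in lborel. a t = 0"
    by (subst (asm) nn_integral_0_iff_AE) auto
  moreover have "(\<integral>\<^sup>+t. ennreal (exp (- t)) * b t \<partial>lborel) = 0"
    using True eq[of 1] by simp
  then have "AE t in lborel. b t = 0"
    by (subst (asm) nn_integral_0_iff_AE) auto
  ultimately show ?thesis by eventually_elim simp
next
  case False
  define Z where "Z = (\<integral>\<^sup>+t. ennreal (exp (- t)) * a t \<partial>lborel)"
  have Z: "Z \<noteq> 0" "Z \<noteq> \<infinity>"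
    using False fin[of 1] by (auto simp: Z_def)
  define A where "A f t = ennreal (exp (- t)) * f t / Z" for f :: "real \<Rightarrow> ennreal" and t
  have A_meas [measurable]: "A f \<in> borel_measurable borel" if [measurable]: "f \<in> borel_measurable borel" for f
    unfolding A_def by measurable
  have Z_b: "(\<integral>\<^sup>+t. ennreal (exp (- t)) * b t \<partial>lborel) = Z"
    using eq[of 1] by (simp add: Z_def)
  have prob: "real_distribution (density lborel (A f))"
    if [measurable]: "f \<in> borel_measurable borel" and "(\<integral>\<^sup>+t. ennreal (exp (- t)) * f t \<partial>lborel) = Z" for f
  proof -
    have "(\<integral>\<^sup>+t. A f t \<partial>lborel) = Z / Z"
      unfolding A_def using that by (subst nn_integral_divide) auto
    also have "\<dots> = 1" using Z by (simp add: ennreal_divide_self less_top)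
    finally have "prob_space (density lborel (A f))"
      by (intro prob_spaceI) (simp add: emeasure_density)
    then show ?thesis by (simp add: real_distribution_def real_distribution_axioms_def)
  qed
  have nonneg: "AE t in density lborel (A f). 0 \<le> t"
    if [measurable]: "f \<in> borel_measurable borel" and "\<And>t. t < 0 \<Longrightarrow> f t = 0" for f
    by (subst AE_density) (use that in \<open>auto simp: A_def not_less[symmetric]\<close>)
  have lap: "(LINT t|density lborel (A f). exp (- (s * t)))
        = enn2real ((\<integral>\<^sup>+t. ennreal (exp (- ((s + 1) * t))) * f t \<partial>lborel) / Z)"
    if [measurable]: "f \<in> borel_measurable borel" for f and s :: real
  proof -
    have "(LINT t|density lborel (A f). exp (- (s * t)))
        = enn2real (\<integral>\<^sup>+t. A f t * ennreal (exp (- (s * t))) \<partial>lborel)"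
      by (subst integral_eq_nn_integral) (auto simp: nn_integral_density)
    also have "(\<integral>\<^sup>+t. A f t * ennreal (exp (- (s * t))) \<partial>lborel)
        = (\<integral>\<^sup>+t. ennreal (exp (- ((s + 1) * t))) * f t / Z \<partial>lborel)"
    proof (intro nn_integral_cong)
      fix t
      have "ennreal (exp (- ((s + 1) * t))) = ennreal (exp (- t)) * ennreal (exp (- (s * t)))"
        by (simp add: ennreal_mult' [symmetric] exp_add[symmetric] algebra_simps)
      then show "A f t * ennreal (exp (- (s * t))) = ennreal (exp (- ((s + 1) * t))) * f t / Z"
        by (simp add: A_def divide_ennreal_def mult_ac)
    qed
    also have "\<dots> = (\<integral>\<^sup>+t. ennreal (exp (- ((s + 1) * t))) * f t \<partial>lborel) / Z"
      by (rule nn_integral_divide) auto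
    finally show ?thesis .
  qed
  have "density lborel (A a) = density lborel (A b)"
    by (rule laplace_unique) (auto intro!: prob nonneg zero simp: lap eq Z_b Z_def[symmetric])
  then have "AE t in lborel. A a t = A b t"
    by (intro sigma_finite_measure.density_unique[OF lborel.sigma_finite_measure_axioms]) auto
  then show ?thesis
  proof eventually_elim
    fix t assume "A a t = A b t"
    then have "ennreal (exp (- t)) * a t / Z * Z = ennreal (exp (- t)) * b t / Z * Z"
      by (simp add: A_def)
    then have "ennreal (exp (- t)) * a t = ennreal (exp (- t)) * b t"
      using Z ennreal_divide_self[of Z] by (simp add: divide_ennreal_def mult.assoc mult.commute[of "inverse Z"] less_top)
    then show "a t = b t"
      by (simp add: ennreal_mult_cancel_left)
  qed
qed

lemma AE_eq_if_tail_integrals_eq: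
  fixes f g :: "real \<Rightarrow> ennreal"
  assumes [measurable]: "f \<in> borel_measurable borel" "g \<in> borel_measurable borel"
    and eq: "\<And>u. 0 < u \<Longrightarrow> (\<integral>\<^sup>+w. f w * indicator {u<..} w \<partial>lborel) = (\<integral>\<^sup>+w. g w * indicator {u<..} w \<partial>lborel)"
    and fin: "\<And>u. 0 < u \<Longrightarrow> (\<integral>\<^sup>+w. f w * indicator {u<..} w \<partial>lborel) < \<infinity>"
  shows "AE w in lborel. 0 < w \<longrightarrow> f w = g w"
proof -
  have "AE w in lborel. f w * indicator {inverse (real (Suc n))<..} w = g w * indicator {inverse (real (Suc n))<..} w" for n
  proof (intro sigma_finite_measure.density_unique[OF lborel.sigma_finite_measure_axioms])
    let ?e = "inverse (real (Suc n))"
    have tail: "emeasure (density lborel (\<lambda>w. F w * indicator {?e<..} w)) {x<..}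
        = (\<integral>\<^sup>+w. F w * indicator {max x ?e<..} w \<partial>lborel)"
      if [measurable]: "F \<in> borel_measurable borel" for F :: "real \<Rightarrow> ennreal" and x
      by (subst emeasure_density) (auto intro!: nn_integral_cong simp: indicator_def)
    have pos: "0 < max x ?e" for x by (simp add: less_max_iff_disj)
    show "density lborel (\<lambda>w. f w * indicator {?e<..} w) = density lborel (\<lambda>w. g w * indicator {?e<..} w)"
      by (rule measure_eqI_lessThan) (simp_all only: tail assms(1,2) eq[OF pos] fin[OF pos, unfolded eq[OF pos]] sets_density sets_lborel)
  qed auto
  then have "AE w in lborel. \<forall>n. f w * indicator {inverse (real (Suc n))<..} w = g w * indicator {inverse (real (Suc n))<..} w"
    by (simp add: AE_all_countable)
  then show ?thesis
  proof eventually_elim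
    fix w assume *: "\<forall>n. f w * indicator {inverse (real (Suc n))<..} w = g w * indicator {inverse (real (Suc n))<..} w"
    show "0 < w \<longrightarrow> f w = g w"
    proof
      assume "0 < w"
      from reals_Archimedean[OF this] obtain n where "inverse (real (Suc n)) < w" by auto
      then show "f w = g w" using *[rule_format, of n] by simp
    qed
  qed
qed

lemma nn_integral_exp_tail:
  fixes a u :: real
  assumes "0 < a"
  shows "(\<integral>\<^sup>+w. ennreal (exp (- (a * w))) * indicator {u..} w \<partial>lborel) = ennreal (1 / a) * ennreal (exp (- (a * u)))"
proof -
  have "(\<integral>\<^sup>+w. ennreal (exp (- (a * w))) * indicator {u..} w \<partial>lborel) = ennreal (0 - (- (1 / a) * exp (- (a * u))))"
  proof (rule nn_integral_FTC_atLeast[where F="\<lambda>w. - (1 / a) * exp (- (a * w))"])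
    show "((\<lambda>w. - (1 / a) * exp (- (a * w))) has_real_derivative exp (- (a * x))) (at x)" for x
      using assms by (auto intro!: derivative_eq_intros simp: field_simps)
    have "LIM w at_top. a * w :> at_top"
      using assms by (intro filterlim_tendsto_pos_mult_at_top[OF tendsto_const _ filterlim_ident])
    then have "((\<lambda>w. exp (- (a * w))) \<longlongrightarrow> 0) at_top"
      by (intro filterlim_compose[OF exp_at_bot]) (simp add: filterlim_uminus_at_bot)
    then show "((\<lambda>w. - (1 / a) * exp (- (a * w))) \<longlongrightarrow> 0) at_top"
      by (rule tendsto_mult_right_zero)
  qed auto
  then show ?thesis using assms by (simp add: ennreal_mult[symmetric])
qed

lemma LIMSEQ_bounded_above:
  fixes y :: "nat \<Rightarrow> real"
  assumes "y \<longlonglongrightarrow> t"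
  obtains T where "\<And>n. y n \<le> T"
  using convergent_imp_bounded[OF assms] by (auto simp: bounded_iff) (meson abs_le_D1 real_norm_def)

text \<open>The Caputo derivative of a differentiable function is the convolution of its derivative with this kernel.\<close>

definition caputo_kernel :: "real \<Rightarrow> real \<Rightarrow> real" where
  "caputo_kernel \<alpha> x = indicator {0<..} x * x powr (- \<alpha>) / Gamma (1 - \<alpha>)"

lemma borel_measurable_caputo_kernel [measurable]: "caputo_kernel \<alpha> \<in> borel_measurable borel"
  unfolding caputo_kernel_def by measurable

lemma caputo_kernel_nonneg: "\<alpha> < 1 \<Longrightarrow> 0 \<le> caputo_kernel \<alpha> x"
  by (auto simp: caputo_kernel_def Gamma_real_nonneg)

lemma laplace_caputo_kernel:
  assumes "\<alpha> < 1" "0 < s"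
  shows "(\<integral>\<^sup>+x. ennreal (exp (- (s * x))) * ennreal (caputo_kernel \<alpha> x) \<partial>lborel) = ennreal (s powr (\<alpha> - 1))"
proof -
  let ?G = "Gamma (1 - \<alpha>)"
  have G: "0 < ?G" using assms by (intro Gamma_real_pos) auto
  have "ennreal ?G = (\<integral>\<^sup>+t. ennreal (indicator {0..} t * t powr (1 - \<alpha> - 1) / exp t) \<partial>lborel)"
    using assms by (intro Gamma_conv_nn_integral_real) auto
  also have "\<dots> = ennreal s * (\<integral>\<^sup>+x. ennreal (indicator {0..} (0 + s * x) * (0 + s * x) powr (1 - \<alpha> - 1) / exp (0 + s * x)) \<partial>lborel)"
    using assms by (subst nn_integral_real_affine[where c=s and t=0]) auto
  also have "(\<integral>\<^sup>+x. ennreal (indicator {0..} (0 + s * x) * (0 + s * x) powr (1 - \<alpha> - 1) / exp (0 + s * x)) \<partial>lborel)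
     = (\<integral>\<^sup>+x. ennreal (s powr (- \<alpha>) * ?G) * (ennreal (exp (- (s * x))) * ennreal (caputo_kernel \<alpha> x)) \<partial>lborel)"
  proof (intro nn_integral_cong)
    fix x :: real
    have "indicator {0..} (0 + s * x) * (0 + s * x) powr (1 - \<alpha> - 1) / exp (0 + s * x)
      = s powr (- \<alpha>) * ?G * (exp (- (s * x)) * caputo_kernel \<alpha> x)"
    proof (cases "0 < x")
      case True
      moreover have "?G \<noteq> 0" using G by simp
      ultimately show ?thesis using assms
        by (simp add: caputo_kernel_def powr_mult exp_minus field_simps)
    next
      case False
      then show ?thesis using assms
        by (cases "x = 0") (auto simp: caputo_kernel_def indicator_def mult_pos_neg zero_le_mult_iff)
    qed
    then show "ennreal (indicator {0..} (0 + s * x) * (0 + s * x) powr (1 - \<alpha> - 1) / exp (0 + s * x))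
      = ennreal (s powr (- \<alpha>) * ?G) * (ennreal (exp (- (s * x))) * ennreal (caputo_kernel \<alpha> x))"
      using G assms by (simp add: ennreal_mult[symmetric] caputo_kernel_nonneg del: mult_minus_left)
  qed
  also have "\<dots> = ennreal (s powr (- \<alpha>) * ?G) * (\<integral>\<^sup>+x. ennreal (exp (- (s * x))) * ennreal (caputo_kernel \<alpha> x) \<partial>lborel)"
    by (rule nn_integral_cmult) measurable
  finally have *: "ennreal ?G = ennreal s * (ennreal (s powr (- \<alpha>) * ?G) * (\<integral>\<^sup>+x. ennreal (exp (- (s * x))) * ennreal (caputo_kernel \<alpha> x) \<partial>lborel))"
    (is "_ = _ * (_ * ?I)") .
  have s1: "s * s powr (- \<alpha>) = s powr (1 - \<alpha>)" using assms by (simp add: powr_diff powr_minus field_simps)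
  have "ennreal (s powr (1 - \<alpha>) * ?G) * ?I = ennreal ?G"
    using * assms G by (simp add: ennreal_mult mult.assoc flip: s1)
  also have "\<dots> = ennreal (s powr (1 - \<alpha>) * ?G) * ennreal (s powr (\<alpha> - 1))"
    using assms G by (subst ennreal_mult[symmetric]) (auto simp: mult.assoc mult.left_commute powr_add[symmetric])
  finally show ?thesis
    using assms G by (subst (asm) ennreal_mult_cancel_left) auto
qed

text \<open>The factor \<open>exp(T - x)\<close> is at least \<open>1\<close> on the range of integration, so the Laplace transform at \<open>1\<close>
  gives the bound.\<close>

lemma caputo_kernel_integral_bound:
  assumes "\<alpha> < 1"
  shows "(\<integral>\<^sup>+x. ennreal (caputo_kernel \<alpha> x) * indicator {..<T} x \<partial>lborel) \<le> ennreal (exp T)"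
proof -
  have "(\<integral>\<^sup>+x. ennreal (caputo_kernel \<alpha> x) * indicator {..<T} x \<partial>lborel)
     \<le> (\<integral>\<^sup>+x. ennreal (exp T) * (ennreal (exp (- (1 * x))) * ennreal (caputo_kernel \<alpha> x)) \<partial>lborel)"
  proof (intro nn_integral_mono)
    fix x
    have "caputo_kernel \<alpha> x * indicator {..<T} x \<le> exp T * (exp (- (1 * x)) * caputo_kernel \<alpha> x)"
    proof (cases "x < T")
      case True
      have "1 * caputo_kernel \<alpha> x \<le> (exp T * exp (- x)) * caputo_kernel \<alpha> x"
        using True assms by (intro mult_right_mono caputo_kernel_nonneg) (auto simp flip: exp_add)
      then show ?thesis using True by (simp add: mult.assoc)
    qed (simp add: caputo_kernel_nonneg assms)
    then have "ennreal (caputo_kernel \<alpha> x * indicator {..<T} x) \<le> ennreal (exp T * (exp (- (1 * x)) * caputo_kernel \<alpha> x))"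
      by (rule ennreal_leI)
    then show "ennreal (caputo_kernel \<alpha> x) * indicator {..<T} x \<le> ennreal (exp T) * (ennreal (exp (- (1 * x))) * ennreal (caputo_kernel \<alpha> x))"
      by (simp add: ennreal_mult caputo_kernel_nonneg assms ennreal_indicator[symmetric] del: ennreal_indicator)
  qed
  also have "\<dots> = ennreal (exp T)"
    by (subst nn_integral_cmult) (use laplace_caputo_kernel[OF assms, of 1] in auto)
  finally show ?thesis .
qed

section \<open>The density of the inverse stable subordinator\<close>

lemma borel_measurable_compose_pair:
  assumes "(\<lambda>p. F (fst p) (snd p)) \<in> borel_measurable (borel \<Otimes>\<^sub>M borel)"
    and [measurable]: "f \<in> borel_measurable N" "h \<in> borel_measurable N"
  shows "(\<lambda>x. F (f x) (h x)) \<in> borel_measurable N"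
proof -
  have "(\<lambda>x. (f x, h x)) \<in> N \<rightarrow>\<^sub>M borel \<Otimes>\<^sub>M borel" by measurable
  from measurable_compose[OF this assms(1)] show ?thesis by simp
qed

text \<open>The laws of a stable subordinator at all positive times.\<close>

locale stable_family =
  fixes \<mu> :: "real \<Rightarrow> real measure" and \<alpha> :: real
  assumes stable_law: "\<And>u. 0 < u \<Longrightarrow> stable_law (\<mu> u) \<alpha> u"
begin

lemma alpha: "0 < \<alpha>" "\<alpha> < 1"
  using stable_law.alpha[OF stable_law[of 1]] by auto

lemma real_distribution: "0 < u \<Longrightarrow> real_distribution (\<mu> u)"
  using stable_law stable_law.axioms(1) by blast

text \<open>The Fourier integral is written out instead of using \<open>fourier_density (\<mu> u)\<close>, since joint measurability in
  \<open>u\<close> and \<open>x\<close> is visible only in the explicit formula.\<close>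

definition stable_density :: "real \<Rightarrow> real \<Rightarrow> real" where
  "stable_density u x = (if 0 < u then Re (CLBINT t. iexp (-(t * x)) * exp (- (of_real u * (- (\<i> * of_real t)) powr of_real \<alpha>))) / (2 * pi) else 0)"

lemma stable_density_eq: "0 < u \<Longrightarrow> stable_density u = fourier_density (\<mu> u)"
  by (simp add: stable_density_def fourier_density_def stable_law.char_eq[OF stable_law] fun_eq_iff)

lemma borel_measurable_stable_density [measurable]:
  "(\<lambda>p. stable_density (fst p) (snd p)) \<in> borel_measurable (borel \<Otimes>\<^sub>M borel)"
proof -
  have "continuous_on UNIV (\<lambda>t. (- (\<i> * complex_of_real t)) powr complex_of_real \<alpha>)"
    using alpha by (intro continuous_intros) auto
  then have [measurable]: "(\<lambda>t. (- (\<i> * complex_of_real t)) powr complex_of_real \<alpha>) \<in> borel_measurable borel"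
    by (rule borel_measurable_continuous_onI)
  show ?thesis unfolding stable_density_def by measurable
qed

lemma borel_measurable_stable_density_compose [measurable (raw)]:
  "f \<in> borel_measurable N \<Longrightarrow> h \<in> borel_measurable N \<Longrightarrow> (\<lambda>x. stable_density (f x) (h x)) \<in> borel_measurable N"
  by (rule borel_measurable_compose_pair[OF borel_measurable_stable_density])

lemma stable_density_nonneg: "0 \<le> stable_density u x"
  using real_distribution.fourier_density_nonneg[OF real_distribution stable_law.integrable_char[OF stable_law]]
  by (cases "0 < u") (auto simp: stable_density_eq, simp add: stable_density_def)

lemma continuous_on_stable_density: "continuous_on UNIV (stable_density u)"
proof (cases "0 < u")
  case True
  then show ?thesis
    using real_distribution.continuous_on_fourier_density[OF real_distribution stable_law.integrable_char[OF stable_law]]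
    by (simp add: stable_density_eq)
qed (simp add: stable_density_def)

lemma DERIV_cdf: "0 < u \<Longrightarrow> (cdf (\<mu> u) has_real_derivative stable_density u x) (at x)"
  using real_distribution.DERIV_cdf_fourier_density[OF real_distribution stable_law.integrable_char[OF stable_law]]
  by (simp add: stable_density_eq)

lemma density_eq: "0 < u \<Longrightarrow> \<mu> u = density lborel (\<lambda>x. ennreal (stable_density u x))"
  using real_distribution.eq_density_fourier_density[OF real_distribution stable_law.integrable_char[OF stable_law]]
  by (simp add: stable_density_eq)

definition scale_bound :: real where
  "scale_bound = cos (pi * \<alpha> / 2) powr (- 1 / \<alpha>) * stretched_exp_integral \<alpha> / (2 * pi)"

lemma scale_bound_nonneg: "0 \<le> scale_bound"
  unfolding scale_bound_def stretched_exp_integral_def by simp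

lemma stable_density_le_scale: "0 < u \<Longrightarrow> stable_density u x \<le> scale_bound * u powr (- 1 / \<alpha>)"
  using stable_law.fourier_density_le_scale[OF stable_law]
  by (simp add: stable_density_eq scale_bound_def stable_law.decay_def[OF stable_law])

definition tail_bound :: real where
  "tail_bound = (1 + 1 / cos (pi * \<alpha> / 2)) / pi"

lemma mult_stable_density_le: "x * stable_density u x \<le> tail_bound"
proof (cases "0 < u")
  case True
  then show ?thesis
    using stable_law.abs_mult_fourier_density_le[OF stable_law, of u x]
    by (simp add: stable_density_eq tail_bound_def stable_law.decay_def[OF stable_law])
next
  case False
  have "0 < cos (pi * \<alpha> / 2)"
    using stable_law.decay_pos[OF stable_law[of 1]] by (simp add: stable_law.decay_def[OF stable_law[of 1]])
  then show ?thesis using False by (simp add: stable_density_def tail_bound_def)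
qed

lemma stable_density_le_tail: "0 < x \<Longrightarrow> stable_density u x \<le> tail_bound / x"
  using mult_stable_density_le[of x u] by (simp add: field_simps)

lemma cdf_eq_0: "0 < u \<Longrightarrow> x < 0 \<Longrightarrow> cdf (\<mu> u) x = 0"
proof -
  assume u: "0 < u" and x: "x < 0"
  interpret real_distribution "\<mu> u" by (rule real_distribution[OF u])
  have "AE y in \<mu> u. y \<notin> {..x}"
    using stable_law.AE_nonneg[OF stable_law[OF u]] by eventually_elim (use x in auto)
  then show ?thesis unfolding cdf_def2
    by (simp add: prob_eq_0)
qed

lemma stable_density_eq_0: assumes "x \<le> 0" shows "stable_density u x = 0"
proof (cases "0 < u")
  case u: True
  have neg: "stable_density u x = 0" if "x < 0" for x
  proof (rule DERIV_unique[OF DERIV_cdf[OF u]])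
    show "(cdf (\<mu> u) has_real_derivative 0) (at x)"
      by (rule has_field_derivative_transform_within_open[where f="\<lambda>_. 0" and S="{..<0}"])
         (use that u in \<open>auto simp: cdf_eq_0\<close>)
  qed
  show ?thesis
  proof (cases "x = 0")
    case True
    have "(\<lambda>n. - inverse (real (Suc n))) \<longlonglongrightarrow> - 0"
      by (intro tendsto_intros LIMSEQ_inverse_real_of_nat)
    then have "(\<lambda>n. stable_density u (- inverse (real (Suc n)))) \<longlonglongrightarrow> stable_density u 0"
      using continuous_on_stable_density[of u] unfolding continuous_on_sequentially by (auto simp: comp_def)
    moreover have "stable_density u (- inverse (real (Suc n))) = 0" for n
      by (intro neg) simp
    ultimately have "(\<lambda>n::nat. 0) \<longlonglongrightarrow> stable_density u 0" by simp
    then show ?thesis using True by (simp add: LIMSEQ_const_iff)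
  qed (use assms neg in auto)
qed (simp add: stable_density_def)

lemma nn_integral_exp_stable_density:
  assumes "0 < u" "0 < s"
  shows "(\<integral>\<^sup>+x. ennreal (exp (- (s * x))) * ennreal (stable_density u x) \<partial>lborel) = ennreal (exp (- (u * s powr \<alpha>)))"
proof -
  interpret real_distribution "\<mu> u" by (rule real_distribution[OF assms(1)])
  have int: "(LINT x|\<mu> u. exp (- (s * x))) = exp (- (u * s powr \<alpha>))"
    by (rule stable_law.laplace_transform[OF stable_law[OF assms(1)] assms(2)])
  have "(\<integral>\<^sup>+x. ennreal (exp (- (s * x))) * ennreal (stable_density u x) \<partial>lborel) = (\<integral>\<^sup>+x. ennreal (exp (- (s * x))) \<partial>\<mu> u)"
    by (subst density_eq[OF assms(1)]) (simp add: nn_integral_density mult.commute)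
  also have "\<dots> = ennreal (LINT x|\<mu> u. exp (- (s * x)))"
  proof (rule nn_integral_eq_integral)
    show "integrable (\<mu> u) (\<lambda>x. exp (- (s * x)))"
      using int not_integrable_integral_eq by fastforce
  qed auto
  finally show ?thesis by (simp add: int)
qed

lemma nn_integral_stable_density: "0 < u \<Longrightarrow> (\<integral>\<^sup>+x. ennreal (stable_density u x) \<partial>lborel) = 1"
proof -
  assume u: "0 < u"
  interpret real_distribution "\<mu> u" by (rule real_distribution[OF u])
  show ?thesis
    using emeasure_space_1 by (subst (asm) density_eq[OF u]) (simp add: emeasure_density)
qed

lemma cdf_eq_nn_integral:
  assumes "0 < u" shows "ennreal (cdf (\<mu> u) t) = (\<integral>\<^sup>+x. ennreal (stable_density u x) * indicator {..t} x \<partial>lborel)"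
proof -
  interpret real_distribution "\<mu> u" by (rule real_distribution[OF assms])
  have "ennreal (cdf (\<mu> u) t) = emeasure (\<mu> u) {..t}"
    by (simp add: cdf_def2 emeasure_eq_measure)
  then show ?thesis
    by (subst (asm) (2) density_eq[OF assms]) (simp add: emeasure_density)
qed

text \<open>The convolution of the Caputo kernel with the stable density, as a function of the time \<open>t\<close>. Below it turns
  out to be the density at \<open>u\<close> of the inverse subordinator at time \<open>t\<close>.\<close>

definition inverse_density :: "real \<Rightarrow> real \<Rightarrow> ennreal" where
  "inverse_density t u = (\<integral>\<^sup>+x. ennreal (caputo_kernel \<alpha> x) * ennreal (stable_density u (t - x)) \<partial>lborel)"

lemma borel_measurable_inverse_density [measurable (raw)]:
  "f \<in> borel_measurable N \<Longrightarrow> h \<in> borel_measurable N \<Longrightarrow> (\<lambda>x. inverse_density (f x) (h x)) \<in> borel_measurable N"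
proof -
  assume [measurable]: "f \<in> borel_measurable N" "h \<in> borel_measurable N"
  have "(\<lambda>p. inverse_density (fst p) (snd p)) \<in> borel_measurable (borel \<Otimes>\<^sub>M borel)"
    unfolding inverse_density_def by measurable
  then show "(\<lambda>x. inverse_density (f x) (h x)) \<in> borel_measurable N"
    by (rule borel_measurable_compose_pair) measurable
qed

lemma inverse_density_eq: "inverse_density t u = (\<integral>\<^sup>+s. ennreal (caputo_kernel \<alpha> (t - s)) * ennreal (stable_density u s) \<partial>lborel)"
  unfolding inverse_density_def by (subst nn_integral_real_affine[where c="-1" and t=t]) auto

lemma inverse_density_eq_0: "t \<le> 0 \<Longrightarrow> inverse_density t u = 0"
  unfolding inverse_density_def
proof -
  assume "t \<le> 0"
  then have "(\<lambda>x. ennreal (caputo_kernel \<alpha> x) * ennreal (stable_density u (t - x))) = (\<lambda>x. 0)"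
    by (auto simp: fun_eq_iff caputo_kernel_def stable_density_eq_0 indicator_def)
  then show "(\<integral>\<^sup>+x. ennreal (caputo_kernel \<alpha> x) * ennreal (stable_density u (t - x)) \<partial>lborel) = 0" by simp
qed

text \<open>The exponent \<open>- 1 / \<alpha>\<close> is less than \<open>- 1\<close>; this makes the bound \<open>stable_density_le_scale\<close> integrable
  in the time variable.\<close>

lemma nn_integral_powr_tail:
  assumes "0 < u"
  shows "(\<integral>\<^sup>+w. ennreal (w powr (- 1 / \<alpha>)) * indicator {u<..} w \<partial>lborel) < \<infinity>"
proof -
  let ?p = "1 - 1 / \<alpha>"
  have p: "?p < 0" using alpha by (simp add: field_simps)
  have "(\<integral>\<^sup>+w. ennreal (w powr (- 1 / \<alpha>)) * indicator {u<..} w \<partial>lborel)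
      \<le> (\<integral>\<^sup>+w. ennreal (w powr (- 1 / \<alpha>)) * indicator {u..} w \<partial>lborel)"
    by (intro nn_integral_mono) (auto simp: indicator_def)
  also have "\<dots> = ennreal (0 - u powr ?p / ?p)"
  proof (rule nn_integral_FTC_atLeast[where F="\<lambda>w. w powr ?p / ?p"])
    show "((\<lambda>w. w powr ?p / ?p) \<longlongrightarrow> 0) at_top"
      using tendsto_divide[OF tendsto_neg_powr[OF p filterlim_ident] tendsto_const, of ?p] p alpha by simp
    fix x assume "u \<le> x"
    then show "((\<lambda>w. w powr ?p / ?p) has_real_derivative x powr (- 1 / \<alpha>)) (at x)"
      using assms p by (auto intro!: derivative_eq_intros)
  qed auto
  also have "\<dots> < \<infinity>" by simp
  finally show ?thesis .
qed

lemma kernel_stable_density_le_scale: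
  assumes "0 < u" "t \<le> T"
  shows "ennreal (caputo_kernel \<alpha> x) * ennreal (stable_density u (t - x))
     \<le> ennreal (scale_bound * u powr (- 1 / \<alpha>)) * (ennreal (caputo_kernel \<alpha> x) * indicator {..<T} x)"
proof (cases "x < T")
  case True
  then show ?thesis using stable_density_le_scale[OF assms(1), of "t - x"]
    by (auto simp: mult.commute intro!: mult_left_mono ennreal_leI)
qed (use assms in \<open>simp add: stable_density_eq_0\<close>)

lemma inverse_density_le_scale:
  assumes "0 < u" "t \<le> T"
  shows "inverse_density t u \<le> ennreal (scale_bound * exp T) * ennreal (u powr (- 1 / \<alpha>))"
proof -
  have "inverse_density t u \<le> (\<integral>\<^sup>+x. ennreal (scale_bound * u powr (- 1 / \<alpha>)) * (ennreal (caputo_kernel \<alpha> x) * indicator {..<T} x) \<partial>lborel)"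
    unfolding inverse_density_def by (intro nn_integral_mono kernel_stable_density_le_scale assms)
  also have "\<dots> = ennreal (scale_bound * u powr (- 1 / \<alpha>)) * (\<integral>\<^sup>+x. ennreal (caputo_kernel \<alpha> x) * indicator {..<T} x \<partial>lborel)"
    by (rule nn_integral_cmult) measurable
  also have "\<dots> \<le> ennreal (scale_bound * u powr (- 1 / \<alpha>)) * ennreal (exp T)"
    using alpha by (intro mult_left_mono caputo_kernel_integral_bound) auto
  finally show ?thesis
    by (simp add: ennreal_mult scale_bound_nonneg mult_ac)
qed

text \<open>In the form \<open>\<integral> \<kappa>(x) g\<^sub>u(t - x) dx\<close> only the continuous bounded factor depends on \<open>t\<close>, and it vanishes for
  \<open>x > t\<close>; so dominated convergence applies although \<open>\<kappa>\<close> is unbounded near \<open>0\<close>.\<close>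

lemma inverse_density_tendsto:
  assumes "0 < u" "y \<longlonglongrightarrow> t"
  shows "(\<lambda>n. inverse_density (y n) u) \<longlonglongrightarrow> inverse_density t u"
proof -
  obtain T where T: "\<And>n. y n \<le> T" using LIMSEQ_bounded_above[OF assms(2)] by blast
  show ?thesis
    unfolding inverse_density_def
  proof (rule nn_integral_dominated_convergence[where w="\<lambda>x. ennreal (scale_bound * u powr (- 1 / \<alpha>)) * (ennreal (caputo_kernel \<alpha> x) * indicator {..<T} x)"])
    show "AE x in lborel. ennreal (caputo_kernel \<alpha> x) * ennreal (stable_density u (y j - x)) \<le>
         ennreal (scale_bound * u powr (- 1 / \<alpha>)) * (ennreal (caputo_kernel \<alpha> x) * indicator {..<T} x)" for j
      by (intro AE_I2 kernel_stable_density_le_scale assms T)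
    show "(\<integral>\<^sup>+x. ennreal (scale_bound * u powr (- 1 / \<alpha>)) * (ennreal (caputo_kernel \<alpha> x) * indicator {..<T} x) \<partial>lborel) < \<infinity>"
      using caputo_kernel_integral_bound[OF alpha(2), of T]
      by (subst nn_integral_cmult) (auto simp: ennreal_mult_less_top intro: order.strict_trans1)
    show "AE x in lborel. (\<lambda>i. ennreal (caputo_kernel \<alpha> x) * ennreal (stable_density u (y i - x))) \<longlonglongrightarrow> ennreal (caputo_kernel \<alpha> x) * ennreal (stable_density u (t - x))"
    proof (rule AE_I2)
      fix x
      have "(\<lambda>i. y i - x) \<longlonglongrightarrow> t - x" by (intro tendsto_intros assms)
      then have "(\<lambda>i. stable_density u (y i - x)) \<longlonglongrightarrow> stable_density u (t - x)"
        using continuous_on_stable_density[of u] unfolding continuous_on_sequentially by (auto simp: comp_def)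
      then show "(\<lambda>i. ennreal (caputo_kernel \<alpha> x) * ennreal (stable_density u (y i - x))) \<longlonglongrightarrow> ennreal (caputo_kernel \<alpha> x) * ennreal (stable_density u (t - x))"
        by (intro ennreal_tendsto_cmult tendsto_ennrealI) auto
    qed
  qed auto
qed

lemma inverse_density_tail_tendsto:
  assumes "0 < u" "y \<longlonglongrightarrow> t"
  shows "(\<lambda>n. \<integral>\<^sup>+w. inverse_density (y n) w * indicator {u<..} w \<partial>lborel) \<longlonglongrightarrow> (\<integral>\<^sup>+w. inverse_density t w * indicator {u<..} w \<partial>lborel)"
proof -
  obtain T where T: "\<And>n. y n \<le> T" using LIMSEQ_bounded_above[OF assms(2)] by blast
  show ?thesis
  proof (rule nn_integral_dominated_convergence[where w="\<lambda>w. ennreal (scale_bound * exp T) * (ennreal (w powr (- 1 / \<alpha>)) * indicator {u<..} w)"])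
    show "AE w in lborel. inverse_density (y j) w * indicator {u<..} w \<le> ennreal (scale_bound * exp T) * (ennreal (w powr (- 1 / \<alpha>)) * indicator {u<..} w)" for j
      using inverse_density_le_scale[OF _ T[of j]] assms by (auto simp: indicator_def)
    show "(\<integral>\<^sup>+w. ennreal (scale_bound * exp T) * (ennreal (w powr (- 1 / \<alpha>)) * indicator {u<..} w) \<partial>lborel) < \<infinity>"
      using nn_integral_powr_tail[OF assms(1)]
      by (subst nn_integral_cmult) (auto simp: ennreal_mult_less_top)
    show "AE w in lborel. (\<lambda>i. inverse_density (y i) w * indicator {u<..} w) \<longlonglongrightarrow> inverse_density t w * indicator {u<..} w"
      using inverse_density_tendsto[OF _ assms(2)] assms(1) by (auto simp: indicator_def)
  qed auto
qed

lemma laplace_inverse_density: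
  assumes "0 < w" "0 < s"
  shows "(\<integral>\<^sup>+t. ennreal (exp (- (s * t))) * inverse_density t w \<partial>lborel) = ennreal (s powr (\<alpha> - 1) * exp (- (w * s powr \<alpha>)))"
proof -
  have "(\<integral>\<^sup>+t. ennreal (exp (- (s * t))) * inverse_density t w \<partial>lborel)
    = (\<integral>\<^sup>+t. \<integral>\<^sup>+x. ennreal (exp (- (s * t))) * (ennreal (caputo_kernel \<alpha> x) * ennreal (stable_density w (t - x))) \<partial>lborel \<partial>lborel)"
    unfolding inverse_density_def by (intro nn_integral_cong nn_integral_cmult[symmetric]) measurable
  also have "\<dots> = (\<integral>\<^sup>+x. \<integral>\<^sup>+t. ennreal (exp (- (s * t))) * (ennreal (caputo_kernel \<alpha> x) * ennreal (stable_density w (t - x))) \<partial>lborel \<partial>lborel)"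
    by (rule lborel_pair.Fubini') measurable
  also have "\<dots> = (\<integral>\<^sup>+x. ennreal (exp (- (s * x))) * ennreal (caputo_kernel \<alpha> x) * ennreal (exp (- (w * s powr \<alpha>))) \<partial>lborel)"
  proof (intro nn_integral_cong)
    fix x
    have "(\<integral>\<^sup>+t. ennreal (exp (- (s * t))) * (ennreal (caputo_kernel \<alpha> x) * ennreal (stable_density w (t - x))) \<partial>lborel)
      = (\<integral>\<^sup>+t. ennreal (exp (- (s * (x + t)))) * (ennreal (caputo_kernel \<alpha> x) * ennreal (stable_density w t)) \<partial>lborel)"
      by (subst nn_integral_real_affine[where c=1 and t=x]) auto
    also have "\<dots> = (\<integral>\<^sup>+t. (ennreal (exp (- (s * x))) * ennreal (caputo_kernel \<alpha> x)) * (ennreal (exp (- (s * t))) * ennreal (stable_density w t)) \<partial>lborel)"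
    proof (intro nn_integral_cong)
      fix t
      have "exp (- (s * (x + t))) = exp (- (s * x)) * exp (- (s * t))"
        by (simp add: exp_add[symmetric] algebra_simps)
      then show "ennreal (exp (- (s * (x + t)))) * (ennreal (caputo_kernel \<alpha> x) * ennreal (stable_density w t))
        = (ennreal (exp (- (s * x))) * ennreal (caputo_kernel \<alpha> x)) * (ennreal (exp (- (s * t))) * ennreal (stable_density w t))"
        by (simp add: ennreal_mult mult_ac)
    qed
    also have "\<dots> = (ennreal (exp (- (s * x))) * ennreal (caputo_kernel \<alpha> x)) * ennreal (exp (- (w * s powr \<alpha>)))"
      by (subst nn_integral_cmult) (auto simp: nn_integral_exp_stable_density[OF assms])
    finally show "(\<integral>\<^sup>+t. ennreal (exp (- (s * t))) * (ennreal (caputo_kernel \<alpha> x) * ennreal (stable_density w (t - x))) \<partial>lborel)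
      = ennreal (exp (- (s * x))) * ennreal (caputo_kernel \<alpha> x) * ennreal (exp (- (w * s powr \<alpha>)))" .
  qed
  also have "\<dots> = ennreal (s powr (\<alpha> - 1)) * ennreal (exp (- (w * s powr \<alpha>)))"
    using assms alpha by (subst nn_integral_multc) (auto simp: laplace_caputo_kernel)
  finally show ?thesis by (simp add: ennreal_mult)
qed

lemma laplace_inverse_density_tail:
  assumes "0 < u" "0 < s"
  shows "(\<integral>\<^sup>+t. ennreal (exp (- (s * t))) * (\<integral>\<^sup>+w. inverse_density t w * indicator {u<..} w \<partial>lborel) \<partial>lborel)
     = ennreal (exp (- (u * s powr \<alpha>)) / s)"
proof -
  let ?a = "s powr \<alpha>"
  have a: "0 < ?a" using assms by simp
  have "(\<integral>\<^sup>+t. ennreal (exp (- (s * t))) * (\<integral>\<^sup>+w. inverse_density t w * indicator {u<..} w \<partial>lborel) \<partial>lborel)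
     = (\<integral>\<^sup>+t. \<integral>\<^sup>+w. ennreal (exp (- (s * t))) * (inverse_density t w * indicator {u<..} w) \<partial>lborel \<partial>lborel)"
    by (intro nn_integral_cong nn_integral_cmult[symmetric]) measurable
  also have "\<dots> = (\<integral>\<^sup>+w. \<integral>\<^sup>+t. ennreal (exp (- (s * t))) * (inverse_density t w * indicator {u<..} w) \<partial>lborel \<partial>lborel)"
    by (rule lborel_pair.Fubini') measurable
  also have "\<dots> = (\<integral>\<^sup>+w. ennreal (s powr (\<alpha> - 1) * exp (- (w * ?a))) * indicator {u<..} w \<partial>lborel)"
  proof (intro nn_integral_cong)
    fix w
    show "(\<integral>\<^sup>+t. ennreal (exp (- (s * t))) * (inverse_density t w * indicator {u<..} w) \<partial>lborel) = ennreal (s powr (\<alpha> - 1) * exp (- (w * ?a))) * indicator {u<..} w"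
      using laplace_inverse_density[of w s] assms by (auto simp: indicator_def)
  qed
  also have "\<dots> = (\<integral>\<^sup>+w. ennreal (s powr (\<alpha> - 1) * exp (- (w * ?a))) * indicator {u..} w \<partial>lborel)"
    by (intro nn_integral_cong_AE) (use AE_lborel_singleton[of u] in \<open>auto elim!: eventually_mono simp: indicator_def\<close>)
  also have "\<dots> = (\<integral>\<^sup>+w. ennreal (s powr (\<alpha> - 1)) * (ennreal (exp (- (?a * w))) * indicator {u..} w) \<partial>lborel)"
    by (simp add: ennreal_mult mult_ac)
  also have "\<dots> = ennreal (s powr (\<alpha> - 1)) * (ennreal (1 / ?a) * ennreal (exp (- (?a * u))))"
    by (subst nn_integral_cmult) (auto simp: nn_integral_exp_tail[OF a])
  also have "\<dots> = ennreal (s powr (\<alpha> - 1) / ?a * exp (- (u * ?a)))"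
    using a by (simp add: ennreal_mult[symmetric] mult.commute)
  also have "s powr (\<alpha> - 1) / ?a = 1 / s"
    using assms by (simp add: powr_diff)
  finally show ?thesis by simp
qed

lemma laplace_cdf:
  assumes "0 < u" "0 < s"
  shows "(\<integral>\<^sup>+t. ennreal (exp (- (s * t))) * ennreal (cdf (\<mu> u) t) \<partial>lborel) = ennreal (exp (- (u * s powr \<alpha>)) / s)"
proof -
  have "(\<integral>\<^sup>+t. ennreal (exp (- (s * t))) * ennreal (cdf (\<mu> u) t) \<partial>lborel)
     = (\<integral>\<^sup>+t. \<integral>\<^sup>+x. ennreal (exp (- (s * t))) * (ennreal (stable_density u x) * indicator {x..} t) \<partial>lborel \<partial>lborel)"
    unfolding cdf_eq_nn_integral[OF assms(1)]
    by (intro nn_integral_cong, subst nn_integral_cmult[symmetric]) (auto intro!: nn_integral_cong simp: indicator_def)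
  also have "\<dots> = (\<integral>\<^sup>+x. \<integral>\<^sup>+t. ennreal (exp (- (s * t))) * (ennreal (stable_density u x) * indicator {x..} t) \<partial>lborel \<partial>lborel)"
    by (rule lborel_pair.Fubini') (simp add: indicator_def, measurable)
  also have "\<dots> = (\<integral>\<^sup>+x. ennreal (1 / s) * (ennreal (exp (- (s * x))) * ennreal (stable_density u x)) \<partial>lborel)"
  proof (intro nn_integral_cong)
    fix x
    have "(\<integral>\<^sup>+t. ennreal (exp (- (s * t))) * (ennreal (stable_density u x) * indicator {x..} t) \<partial>lborel)
      = (\<integral>\<^sup>+t. ennreal (stable_density u x) * (ennreal (exp (- (s * t))) * indicator {x..} t) \<partial>lborel)"
      by (simp add: mult_ac)
    also have "\<dots> = ennreal (stable_density u x) * (ennreal (1 / s) * ennreal (exp (- (s * x))))"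
      by (subst nn_integral_cmult) (auto simp: nn_integral_exp_tail[OF assms(2)])
    finally show "(\<integral>\<^sup>+t. ennreal (exp (- (s * t))) * (ennreal (stable_density u x) * indicator {x..} t) \<partial>lborel)
      = ennreal (1 / s) * (ennreal (exp (- (s * x))) * ennreal (stable_density u x))" by (simp add: mult_ac)
  qed
  also have "\<dots> = ennreal (1 / s) * ennreal (exp (- (u * s powr \<alpha>)))"
    by (subst nn_integral_cmult) (auto simp: nn_integral_exp_stable_density[OF assms])
  finally show ?thesis using assms by (simp add: ennreal_mult[symmetric])
qed

text \<open>Both sides have the Laplace transform \<open>exp(- u s\<^sup>\<alpha>) / s\<close>, hence agree for almost every \<open>t\<close>; both are
  continuous in \<open>t\<close>, and a set of full measure is dense.\<close>

lemma cdf_eq_inverse_density_tail: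
  assumes "0 < u"
  shows "ennreal (cdf (\<mu> u) t) = (\<integral>\<^sup>+w. inverse_density t w * indicator {u<..} w \<partial>lborel)"
proof -
  let ?V = "\<lambda>t. \<integral>\<^sup>+w. inverse_density t w * indicator {u<..} w \<partial>lborel"
  interpret real_distribution "\<mu> u" by (rule real_distribution[OF assms])
  have cont: "isCont (cdf (\<mu> u)) t" for t
    using DERIV_cdf[OF assms] by (rule DERIV_isCont)
  then have [measurable]: "cdf (\<mu> u) \<in> borel_measurable borel"
    by (intro borel_measurable_continuous_onI continuous_at_imp_continuous_on) auto
  have "AE t in lborel. ennreal (cdf (\<mu> u) t) = ?V t"
    by (rule AE_eq_if_Laplace_eq)
       (auto simp: laplace_cdf[OF assms] laplace_inverse_density_tail[OF assms] cdf_eq_0[OF assms] inverse_density_eq_0)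
  then have AE: "AE t in lborel. t \<in> {t. ennreal (cdf (\<mu> u) t) = ?V t}" by simp
  have "\<exists>x\<in>{t - inverse (real (Suc n))<..<t}. ennreal (cdf (\<mu> u) x) = ?V x" for n
  proof (rule ccontr)
    assume *: "\<not> ?thesis"
    from AE have "AE x in lborel. x \<notin> {t - inverse (real (Suc n))<..<t}"
      by eventually_elim (use * in auto)
    then have "{t - inverse (real (Suc n))<..<t} \<in> null_sets lborel"
      by (subst AE_iff_null_sets) auto
    then show False by (simp add: null_sets_def)
  qed
  then obtain y where y: "\<And>n. y n \<in> {t - inverse (real (Suc n))<..<t}" "\<And>n. ennreal (cdf (\<mu> u) (y n)) = ?V (y n)"
    by metis
  have "y \<longlonglongrightarrow> t"
  proof (rule tendsto_sandwich)
    have "(\<lambda>n. t - inverse (real (Suc n))) \<longlonglongrightarrow> t - 0"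
      by (intro tendsto_intros LIMSEQ_inverse_real_of_nat)
    then show "(\<lambda>n. t - inverse (real (Suc n))) \<longlonglongrightarrow> t" by simp
    show "eventually (\<lambda>n. t - inverse (real (Suc n)) \<le> y n) sequentially" "eventually (\<lambda>n. y n \<le> t) sequentially"
      using y(1) unfolding greaterThanLessThan_iff by (auto intro!: always_eventually less_imp_le simp del: of_nat_Suc)
  qed simp
  then have "(\<lambda>n. ennreal (cdf (\<mu> u) (y n))) \<longlonglongrightarrow> ennreal (cdf (\<mu> u) t)" "(\<lambda>n. ?V (y n)) \<longlonglongrightarrow> ?V t"
    using inverse_density_tail_tendsto[OF assms] isCont_tendsto_compose[OF cont] by (auto intro!: tendsto_ennrealI)
  then show ?thesis
    unfolding y(2) by (rule LIMSEQ_unique)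
qed

text \<open>The convolution integral is split at \<open>t / 2\<close>. For \<open>x < t / 2\<close> the stable density is evaluated at
  \<open>t - x > t / 2\<close>, where it is bounded uniformly in \<open>u\<close>, and the kernel is integrable near \<open>0\<close>; for
  \<open>x \<ge> t / 2\<close> the kernel is bounded and the density has total mass \<open>1\<close>.\<close>

lemma inverse_density_bounded:
  assumes "0 < t"
  obtains B where "0 \<le> B" "\<And>u. 0 < u \<Longrightarrow> inverse_density t u \<le> ennreal B"
proof -
  have tb: "0 \<le> tail_bound" using mult_stable_density_le[of 0 1] by simp
  \<comment> \<open>The kernel decreases, so this bounds it on \<open>[t / 2, \<infinity>)\<close>.\<close>
  define k where "k = caputo_kernel \<alpha> (t / 2)"
  have k0: "0 \<le> k" using alpha by (simp add: k_def caputo_kernel_nonneg)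
  have k: "caputo_kernel \<alpha> x \<le> k" if "t / 2 \<le> x" for x
    unfolding k_def caputo_kernel_def using that assms alpha
    by (auto intro!: divide_right_mono powr_mono2' simp: Gamma_real_nonneg)
  have "inverse_density t u \<le> ennreal (tail_bound / (t / 2) * exp (t / 2) + k)" if u: "0 < u" for u
  proof -
    have "inverse_density t u \<le> (\<integral>\<^sup>+x. ennreal (tail_bound / (t / 2)) * (ennreal (caputo_kernel \<alpha> x) * indicator {..<t / 2} x) + ennreal k * ennreal (stable_density u (t - x)) \<partial>lborel)"
      unfolding inverse_density_def
    proof (intro nn_integral_mono)
      fix x
      show "ennreal (caputo_kernel \<alpha> x) * ennreal (stable_density u (t - x))
         \<le> ennreal (tail_bound / (t / 2)) * (ennreal (caputo_kernel \<alpha> x) * indicator {..<t / 2} x) + ennreal k * ennreal (stable_density u (t - x))"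
      proof (cases "x < t / 2")
        case True
        have "stable_density u (t - x) \<le> tail_bound / (t - x)"
          using True assms by (intro stable_density_le_tail) auto
        also have "\<dots> \<le> tail_bound / (t / 2)"
          using True assms tb by (intro divide_left_mono) auto
        finally have "ennreal (caputo_kernel \<alpha> x) * ennreal (stable_density u (t - x)) \<le> ennreal (caputo_kernel \<alpha> x) * ennreal (tail_bound / (t / 2))"
          by (intro mult_left_mono ennreal_leI) auto
        then show ?thesis using True by (auto simp: mult.commute intro: order_trans add_increasing2)
      next
        case False
        then have "ennreal (caputo_kernel \<alpha> x) * ennreal (stable_density u (t - x)) \<le> ennreal k * ennreal (stable_density u (t - x))"
          by (intro mult_right_mono ennreal_leI k) auto
        then show ?thesis by (auto intro: add_increasing)
      qed
    qed
    also have "\<dots> = ennreal (tail_bound / (t / 2)) * (\<integral>\<^sup>+x. ennreal (caputo_kernel \<alpha> x) * indicator {..<t / 2} x \<partial>lborel)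
        + ennreal k * (\<integral>\<^sup>+x. ennreal (stable_density u (t - x)) \<partial>lborel)"
      by (simp add: nn_integral_add nn_integral_cmult)
    also have "(\<integral>\<^sup>+x. ennreal (stable_density u (t - x)) \<partial>lborel) = 1"
      using nn_integral_real_affine[of "\<lambda>x. ennreal (stable_density u x)" "-1" t] nn_integral_stable_density[OF u] by simp
    also have "ennreal (tail_bound / (t / 2)) * (\<integral>\<^sup>+x. ennreal (caputo_kernel \<alpha> x) * indicator {..<t / 2} x \<partial>lborel)
      \<le> ennreal (tail_bound / (t / 2)) * ennreal (exp (t / 2))"
      using alpha by (intro mult_left_mono caputo_kernel_integral_bound) auto
    finally show ?thesis
      using tb k0 assms by (simp add: ennreal_mult[symmetric] ennreal_plus[symmetric] del: ennreal_plus)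
  qed
  then show thesis
    using tb k0 assms by (intro that[of "tail_bound / (t / 2) * exp (t / 2) + k"]) auto
qed

end

section \<open>Caputo derivatives of mixtures of stable distribution functions\<close>

context stable_family
begin

text \<open>The distribution function of \<open>\<mu> u\<close> for \<open>u > 0\<close>, in a form that is measurable in \<open>u\<close>.\<close>

definition stable_cdf :: "real \<Rightarrow> real \<Rightarrow> real" where
  "stable_cdf u s = enn2real (\<integral>\<^sup>+x. ennreal (stable_density u x) * indicator {..s} x \<partial>lborel)"

lemma stable_cdf_eq_cdf: "0 < u \<Longrightarrow> stable_cdf u s = cdf (\<mu> u) s"
  by (simp add: stable_cdf_def cdf_eq_nn_integral[symmetric] finite_borel_measure.cdf_nonneg real_distribution real_distribution.axioms
      real_distribution.finite_borel_measure_M)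

lemma borel_measurable_stable_cdf [measurable]: "(\<lambda>u. stable_cdf u s) \<in> borel_measurable borel"
  unfolding stable_cdf_def by measurable

lemma stable_cdf_nonneg: "0 \<le> stable_cdf u s"
  by (simp add: stable_cdf_def)

lemma stable_cdf_le_1: "0 < u \<Longrightarrow> stable_cdf u s \<le> 1"
  by (simp add: stable_cdf_eq_cdf real_distribution.cdf_bounded_prob real_distribution)

lemma stable_cdf_lipschitz:
  assumes "0 < u" "0 < a" "a \<le> x" "a \<le> y"
  shows "\<bar>stable_cdf u x - stable_cdf u y\<bar> \<le> tail_bound / a * \<bar>x - y\<bar>"
proof -
  have tb: "0 \<le> tail_bound" using mult_stable_density_le[of 0 1] by simp
  have "norm (cdf (\<mu> u) x - cdf (\<mu> u) y) \<le> tail_bound / a * norm (x - y)"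
  proof (rule field_differentiable_bound[where S="{a..}" and f'="stable_density u"])
    fix z assume z: "z \<in> {a..}"
    show "(cdf (\<mu> u) has_field_derivative stable_density u z) (at z within {a..})"
      using DERIV_cdf[OF assms(1)] by (rule DERIV_subset) simp
    have "stable_density u z \<le> tail_bound / z" using z assms by (intro stable_density_le_tail) auto
    also have "\<dots> \<le> tail_bound / a" using z assms tb by (intro divide_left_mono) auto
    finally show "norm (stable_density u z) \<le> tail_bound / a" by (simp add: stable_density_nonneg)
  qed (use assms in auto)
  then show ?thesis using assms(1) by (simp add: stable_cdf_eq_cdf)
qed

lemma integrable_mixture:
  fixes \<Psi> :: "real \<Rightarrow> real"
  assumes \<Psi>: "integrable lborel \<Psi>" "\<And>u. u \<le> 0 \<Longrightarrow> \<Psi> u = 0"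
  shows "integrable lborel (\<lambda>u. \<Psi> u * stable_cdf u s)"
proof (rule Bochner_Integration.integrable_bound[OF \<Psi>(1)])
  have "norm (\<Psi> u * stable_cdf u s) \<le> norm (\<Psi> u)" for u
    using stable_cdf_le_1[of u s] \<Psi>(2)[of u] stable_cdf_nonneg[of u s]
    by (cases "0 < u") (auto simp: abs_mult intro: mult_left_le)
  then show "AE u in lborel. norm (\<Psi> u * stable_cdf u s) \<le> norm (\<Psi> u)" by simp
qed (use \<Psi>(1) in auto)

lemma cdf_le_exp:
  assumes "0 < u" shows "cdf (\<mu> u) t \<le> exp (t - u)"
proof -
  have "ennreal (cdf (\<mu> u) t) \<le> (\<integral>\<^sup>+x. ennreal (exp t) * (ennreal (exp (- (1 * x))) * ennreal (stable_density u x)) \<partial>lborel)"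
    unfolding cdf_eq_nn_integral[OF assms]
  proof (intro nn_integral_mono)
    fix x
    have "stable_density u x * indicator {..t} x \<le> exp t * (exp (- (1 * x)) * stable_density u x)"
    proof (cases "x \<le> t")
      case True
      have "1 * stable_density u x \<le> (exp t * exp (- x)) * stable_density u x"
        using True by (intro mult_right_mono stable_density_nonneg) (auto simp flip: exp_add)
      then show ?thesis using True by (simp add: mult.assoc)
    qed (simp add: stable_density_nonneg)
    then have "ennreal (stable_density u x * indicator {..t} x) \<le> ennreal (exp t * (exp (- (1 * x)) * stable_density u x))"
      by (rule ennreal_leI)
    then show "ennreal (stable_density u x) * indicator {..t} x \<le> ennreal (exp t) * (ennreal (exp (- (1 * x))) * ennreal (stable_density u x))"
      by (simp add: ennreal_mult stable_density_nonneg ennreal_indicator[symmetric] del: ennreal_indicator)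
  qed
  also have "\<dots> = ennreal (exp t) * ennreal (exp (- u))"
    using nn_integral_exp_stable_density[OF assms, of 1] by (subst nn_integral_cmult) auto
  also have "\<dots> = ennreal (exp (t - u))" by (simp add: ennreal_mult[symmetric] exp_diff exp_minus divide_inverse)
  finally show ?thesis by simp
qed

lemma cdf_0: "0 < u \<Longrightarrow> cdf (\<mu> u) 0 = 0"
  using cdf_eq_inverse_density_tail[of u 0]
  by (simp add: inverse_density_eq_0 finite_borel_measure.cdf_nonneg real_distribution real_distribution.finite_borel_measure_M ennreal_eq_0_iff antisym)

text \<open>Near \<open>s > 0\<close> the distribution functions are Lipschitz with a constant that does not depend on \<open>u\<close>, so the
  difference quotients are dominated by a multiple of \<open>\<bar>\<Psi>\<bar>\<close>.\<close>

lemma DERIV_mixture: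
  fixes \<Psi> :: "real \<Rightarrow> real"
  assumes \<Psi>: "integrable lborel \<Psi>" "\<And>u. u \<le> 0 \<Longrightarrow> \<Psi> u = 0" and s: "0 < s"
  shows "((\<lambda>s. LBINT u. \<Psi> u * stable_cdf u s) has_real_derivative (LBINT u. \<Psi> u * stable_density u s)) (at s)"
  unfolding has_field_derivative_iff tendsto_at_iff_sequentially
proof (intro allI impI)
  have [measurable]: "\<Psi> \<in> borel_measurable borel" using \<Psi>(1) by auto
  have int: "integrable lborel (\<lambda>u. \<Psi> u * stable_cdf u s)" for s
    by (rule integrable_mixture[OF \<Psi>])
  fix y :: "nat \<Rightarrow> real"
  assume y: "\<forall>i. y i \<in> UNIV - {s}" and lim: "y \<longlonglongrightarrow> s"
  from order_tendstoD(1)[OF lim, of "s / 2"] s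
  obtain N where N: "\<And>n. N \<le> n \<Longrightarrow> s / 2 < y n"
    by (auto simp: eventually_sequentially)
  have "(\<lambda>n. LBINT u. \<Psi> u * ((stable_cdf u (y (n + N)) - stable_cdf u s) / (y (n + N) - s))) \<longlonglongrightarrow> (LBINT u. \<Psi> u * stable_density u s)"
  proof (rule integral_dominated_convergence[where w="\<lambda>u. \<bar>\<Psi> u\<bar> * (tail_bound / (s / 2))"])
    show "AE u in lborel. (\<lambda>n. \<Psi> u * ((stable_cdf u (y (n + N)) - stable_cdf u s) / (y (n + N) - s))) \<longlonglongrightarrow> \<Psi> u * stable_density u s"
    proof (rule AE_I2)
      fix u
      show "(\<lambda>n. \<Psi> u * ((stable_cdf u (y (n + N)) - stable_cdf u s) / (y (n + N) - s))) \<longlonglongrightarrow> \<Psi> u * stable_density u s"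
      proof (cases "0 < u")
        case True
        then have "((\<lambda>x. (stable_cdf u x - stable_cdf u s) / (x - s)) \<longlongrightarrow> stable_density u s) (at s)"
          using DERIV_cdf[OF True, of s] by (simp add: has_field_derivative_iff stable_cdf_eq_cdf)
        from this[unfolded tendsto_at_iff_sequentially, rule_format, of y]
        have "(\<lambda>n. (stable_cdf u (y n) - stable_cdf u s) / (y n - s)) \<longlonglongrightarrow> stable_density u s"
          using y lim by (simp add: comp_def)
        then have "(\<lambda>n. (stable_cdf u (y (n + N)) - stable_cdf u s) / (y (n + N) - s)) \<longlonglongrightarrow> stable_density u s"
          by (rule LIMSEQ_ignore_initial_segment)
        then show ?thesis by (intro tendsto_intros)
      qed (simp add: \<Psi>(2))
    qed
    show "AE u in lborel. norm (\<Psi> u * ((stable_cdf u (y (n + N)) - stable_cdf u s) / (y (n + N) - s))) \<le> \<bar>\<Psi> u\<bar> * (tail_bound / (s / 2))" for n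
    proof (rule AE_I2)
      fix u
      show "norm (\<Psi> u * ((stable_cdf u (y (n + N)) - stable_cdf u s) / (y (n + N) - s))) \<le> \<bar>\<Psi> u\<bar> * (tail_bound / (s / 2))"
      proof (cases "0 < u")
        case True
        have "\<bar>stable_cdf u (y (n + N)) - stable_cdf u s\<bar> \<le> tail_bound / (s / 2) * \<bar>y (n + N) - s\<bar>"
          using True N[of "n + N"] s by (intro stable_cdf_lipschitz) auto
        moreover have "0 < \<bar>y (n + N) - s\<bar>" using y by simp
        ultimately have "\<bar>(stable_cdf u (y (n + N)) - stable_cdf u s) / (y (n + N) - s)\<bar> \<le> tail_bound / (s / 2)"
          by (simp only: abs_divide pos_divide_le_eq)
        then show ?thesis unfolding real_norm_def abs_mult by (intro mult_left_mono) auto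
      qed (simp add: \<Psi>(2))
    qed
  qed (use \<Psi>(1) in auto)
  moreover have "(LBINT u. \<Psi> u * ((stable_cdf u x - stable_cdf u s) / (x - s))) = ((LBINT u. \<Psi> u * stable_cdf u x) - (LBINT u. \<Psi> u * stable_cdf u s)) / (x - s)" for x
  proof -
    have "(LBINT u. \<Psi> u * ((stable_cdf u x - stable_cdf u s) / (x - s))) = (LBINT u. (\<Psi> u * stable_cdf u x - \<Psi> u * stable_cdf u s) / (x - s))"
      by (simp add: algebra_simps)
    then show ?thesis by (simp add: int)
  qed
  ultimately have "(\<lambda>n. ((LBINT u. \<Psi> u * stable_cdf u (y (n + N))) - (LBINT u. \<Psi> u * stable_cdf u s)) / (y (n + N) - s)) \<longlonglongrightarrow> (LBINT u. \<Psi> u * stable_density u s)"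
    by (simp only:)
  then show "((\<lambda>x. ((LBINT u. \<Psi> u * stable_cdf u x) - (LBINT u. \<Psi> u * stable_cdf u s)) / (x - s)) \<circ> y) \<longlonglongrightarrow> (LBINT u. \<Psi> u * stable_density u s)"
    unfolding comp_def by (rule LIMSEQ_offset)
qed

text \<open>Fubini's theorem for \<open>\<Psi> u * g\<^sub>u(s) * \<kappa>(t - s)\<close>. Integrating its modulus over \<open>s\<close> first leaves \<open>\<bar>\<Psi>\<bar>\<close> times
  \<open>inverse_density t\<close>, which is bounded. In particular the derivative, which may be unbounded near \<open>s = 0\<close>, is
  integrable against the kernel.\<close>

lemma caputo_mixture:
  fixes \<Psi> :: "real \<Rightarrow> real"
  assumes \<Psi>: "integrable lborel \<Psi>" "\<And>u. u \<le> 0 \<Longrightarrow> \<Psi> u = 0" and t: "0 < t"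
  shows "integrable lborel (\<lambda>u. \<Psi> u * enn2real (inverse_density t u))"
    and "set_integrable lborel {0<..<t} (\<lambda>s. (LBINT u. \<Psi> u * stable_density u s) / (t - s) powr \<alpha>)"
    and "1 / Gamma (1 - \<alpha>) * (LBINT s:{0<..<t}. (LBINT u. \<Psi> u * stable_density u s) / (t - s) powr \<alpha>) = (LBINT u. \<Psi> u * enn2real (inverse_density t u))"
proof -
  have [measurable]: "\<Psi> \<in> borel_measurable borel" using \<Psi>(1) by auto
  have Gam: "0 < Gamma (1 - \<alpha>)" using alpha by (intro Gamma_real_pos) auto
  define K where "K s = caputo_kernel \<alpha> (t - s)" for s
  have K_nonneg: "0 \<le> K s" for s using alpha by (simp add: K_def caputo_kernel_nonneg)
  have [measurable]: "K \<in> borel_measurable borel" unfolding K_def by measurable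
  obtain B where B: "0 \<le> B" "\<And>u. 0 < u \<Longrightarrow> inverse_density t u \<le> ennreal B"
    using inverse_density_bounded[OF t] by blast
  show int1: "integrable lborel (\<lambda>u. \<Psi> u * enn2real (inverse_density t u))"
  proof (rule Bochner_Integration.integrable_bound[where f="\<lambda>u. \<Psi> u * B"])
    have "norm (\<Psi> u * enn2real (inverse_density t u)) \<le> norm (\<Psi> u * B)" for u
    proof (cases "0 < u")
      case True
      have "enn2real (inverse_density t u) \<le> B" using enn2real_mono[OF B(2)[OF True]] B(1) by simp
      then show ?thesis using B(1) by (simp add: abs_mult mult_left_mono)
    qed (simp add: \<Psi>(2))
    then show "AE u in lborel. norm (\<Psi> u * enn2real (inverse_density t u)) \<le> norm (\<Psi> u * B)" by simp
  qed (use \<Psi>(1) in auto)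
  let ?F = "\<lambda>u s. \<Psi> u * stable_density u s * K s"
  have inner: "integrable lborel (\<lambda>s. stable_density u s * K s)" "(LBINT s. stable_density u s * K s) = enn2real (inverse_density t u)" if "0 < u" for u
  proof -
    have eq: "(\<integral>\<^sup>+s. ennreal (stable_density u s * K s) \<partial>lborel) = inverse_density t u"
      unfolding inverse_density_eq by (intro nn_integral_cong) (simp add: K_def[symmetric] ennreal_mult stable_density_nonneg K_nonneg mult.commute)
    then show "integrable lborel (\<lambda>s. stable_density u s * K s)"
      using B(2)[OF that] by (intro integrableI_nonneg) (auto simp: stable_density_nonneg K_nonneg intro: order.strict_trans1)
    show "(LBINT s. stable_density u s * K s) = enn2real (inverse_density t u)"
      by (subst integral_eq_nn_integral) (auto simp: stable_density_nonneg K_nonneg eq)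
  qed
  have F_int: "integrable (lborel \<Otimes>\<^sub>M lborel) (\<lambda>(u, s). ?F u s)"
  proof (rule lborel_pair.Fubini_integrable)
    have "(LBINT s. norm (?F u s)) = norm (\<Psi> u * enn2real (inverse_density t u))" for u
    proof (cases "0 < u")
      case True
      have "(LBINT s. norm (?F u s)) = (LBINT s. \<bar>\<Psi> u\<bar> * (stable_density u s * K s))"
        by (simp add: abs_mult stable_density_nonneg K_nonneg mult.assoc)
      then show ?thesis by (simp add: inner[OF True] abs_mult)
    qed (simp add: \<Psi>(2))
    then show "integrable lborel (\<lambda>u. LBINT s. norm ((\<lambda>(u, s). ?F u s) (u, s)))"
      using int1 by simp
    show "AE u in lborel. integrable lborel (\<lambda>s. (\<lambda>(u, s). ?F u s) (u, s))"
    proof (rule AE_I2)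
      fix u show "integrable lborel (\<lambda>s. (\<lambda>(u, s). ?F u s) (u, s))"
        using inner(1)[of u] \<Psi>(2)[of u] by (cases "0 < u") (auto simp: mult.assoc)
    qed
  qed measurable
  have swap: "(LBINT s. LBINT u. ?F u s) = (LBINT u. LBINT s. ?F u s)"
    by (rule lborel_pair.Fubini_integral[OF F_int])
  have int2: "integrable lborel (\<lambda>s. LBINT u. ?F u s)"
    by (rule lborel_pair.integrable_snd[OF F_int])
  have eq: "indicator {0<..<t} s * ((LBINT u. \<Psi> u * stable_density u s) / (t - s) powr \<alpha>) = Gamma (1 - \<alpha>) * (LBINT u. ?F u s)" for s
  proof (cases "0 < s \<and> s < t")
    case True
    have "(LBINT u. ?F u s) = (LBINT u. \<Psi> u * stable_density u s) * K s"
      by simp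
    then show ?thesis using True Gam
      by (simp add: K_def caputo_kernel_def powr_minus field_simps)
  next
    case False
    then show ?thesis by (auto simp: K_def caputo_kernel_def stable_density_eq_0)
  qed
  show "set_integrable lborel {0<..<t} (\<lambda>s. (LBINT u. \<Psi> u * stable_density u s) / (t - s) powr \<alpha>)"
    unfolding set_integrable_def real_scaleR_def eq using int2 by simp
  have "(LBINT s:{0<..<t}. (LBINT u. \<Psi> u * stable_density u s) / (t - s) powr \<alpha>) = Gamma (1 - \<alpha>) * (LBINT s. LBINT u. ?F u s)"
    unfolding set_lebesgue_integral_def real_scaleR_def eq by simp
  also have "\<dots> = Gamma (1 - \<alpha>) * (LBINT u. \<Psi> u * enn2real (inverse_density t u))"
    unfolding swap
  proof (intro arg_cong[where f="\<lambda>x. Gamma (1 - \<alpha>) * x"] Bochner_Integration.integral_cong refl)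
    fix u show "(LBINT s. ?F u s) = \<Psi> u * enn2real (inverse_density t u)"
      using inner(2)[of u] \<Psi>(2)[of u] by (cases "0 < u") (auto simp: mult.assoc)
  qed
  finally show "1 / Gamma (1 - \<alpha>) * (LBINT s:{0<..<t}. (LBINT u. \<Psi> u * stable_density u s) / (t - s) powr \<alpha>) = (LBINT u. \<Psi> u * enn2real (inverse_density t u))"
    using Gam by simp
qed

end

section \<open>The inverse stable subordinator\<close>

locale stable_inverse = prob_space M for M :: "'a measure" +
  fixes \<alpha> :: real and L :: "real \<Rightarrow> 'a \<Rightarrow> real"
  assumes stable: "stable_subordinator M \<alpha> L" and alpha: "0 < \<alpha>" "\<alpha> < 1"
begin

abbreviation "Y \<equiv> inverse_process L"

lemma levy: "levy_process M L"
  using stable by (simp add: stable_subordinator_def subordinator_def)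

lemma L_mono: "\<omega> \<in> space M \<Longrightarrow> 0 \<le> s \<Longrightarrow> s \<le> t \<Longrightarrow> L s \<omega> \<le> L t \<omega>"
  using stable unfolding stable_subordinator_def subordinator_def monotone_on_def by auto

lemma L_measurable: "0 \<le> t \<Longrightarrow> L t \<in> borel_measurable M"
  using levy by (simp add: levy_process_def)

sublocale F: stable_family "\<lambda>u. distr M borel (L u)" \<alpha>
proof (rule stable_family.intro)
  fix u :: real assume u: "0 < u"
  have [measurable]: "L u \<in> borel_measurable M" using u by (simp add: L_measurable)
  have "AE \<omega> in M. L 0 \<omega> = 0" using levy by (simp add: levy_process_def)
  then have "AE \<omega> in M. 0 \<le> L u \<omega>"
    using AE_space
  proof eventually_elim
    fix \<omega> assume "L 0 \<omega> = 0" "\<omega> \<in> space M"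
    then show "0 \<le> L u \<omega>" using L_mono[of \<omega> 0 u] u by auto
  qed
  then have nonneg: "AE x in distr M borel (L u). 0 \<le> x" by (simp add: AE_distr_iff)
  show "stable_law (distr M borel (L u)) \<alpha> u"
  proof (intro stable_law.intro stable_law_axioms.intro alpha u nonneg)
    show "real_distribution (distr M borel (L u))" by (rule real_distribution_distr) simp
    fix s :: real assume "0 < s"
    then show "(LINT x|distr M borel (L u). exp (- (s * x))) = exp (- (u * s powr \<alpha>))"
      using stable u by (simp add: integral_distr stable_subordinator_def)
  qed
qed

lemma cdf_L: "0 \<le> u \<Longrightarrow> cdf (distr M borel (L u)) t = prob {\<omega> \<in> space M. L u \<omega> \<le> t}"
  by (simp add: cdf_def2 measure_distr L_measurable vimage_def Int_def conj_commute)

text \<open>The next two lemmas say that the paths of \<open>Y\<close> are the generalised inverses of those of \<open>L\<close>; the events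
  \<open>u < Y t\<close> and \<open>L u \<le> t\<close> can differ only where \<open>Y t = u\<close> or where the path of \<open>L\<close> never exceeds \<open>t\<close>.\<close>

lemma less_inverse_imp:
  assumes "0 < u" "u < Y t \<omega>"
  shows "L u \<omega> \<le> t"
proof (rule ccontr)
  assume "\<not> L u \<omega> \<le> t"
  then have "Y t \<omega> \<le> u"
    unfolding inverse_process_def using assms(1) by (intro cInf_lower bdd_belowI[of _ 0]) auto
  then show False using assms by simp
qed

lemma le_inverse:
  assumes "\<omega> \<in> space M" "0 < u" "L u \<omega> \<le> t" "\<exists>u>0. t < L u \<omega>"
  shows "u \<le> Y t \<omega>"
  unfolding inverse_process_def
proof (rule cInf_greatest)
  fix v assume v: "v \<in> {u. 0 < u \<and> t < L u \<omega>}"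
  show "u \<le> v"
  proof (rule ccontr)
    assume "\<not> u \<le> v"
    then have "L v \<omega> \<le> L u \<omega>" using v assms by (intro L_mono) auto
    then show False using v assms by auto
  qed
qed (use assms in auto)

text \<open>Markov's inequality for \<open>exp(- L n)\<close>: the probability of \<open>L n \<le> t\<close> is at most \<open>exp(t - n)\<close>.\<close>

lemma AE_exceeds: "AE \<omega> in M. \<exists>u>0. t < L u \<omega>"
proof -
  let ?A = "{\<omega> \<in> space M. \<forall>n. L (real (Suc n)) \<omega> \<le> t}"
  have [measurable]: "L (real (Suc n)) \<in> borel_measurable M" for n by (simp add: L_measurable)
  have A: "?A \<in> events" by measurable
  have "prob ?A \<le> exp (t - real (Suc n))" for n
  proof -
    have "prob ?A \<le> prob {\<omega> \<in> space M. L (real (Suc n)) \<omega> \<le> t}"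
      by (rule finite_measure_mono) (blast, measurable)
    also have "\<dots> \<le> exp (t - real (Suc n))"
      using F.cdf_le_exp[of "real (Suc n)" t] by (simp add: cdf_L del: of_nat_Suc)
    finally show ?thesis .
  qed
  moreover have "(\<lambda>n. exp (t - real (Suc n))) \<longlonglongrightarrow> 0"
    by real_asymp
  ultimately have "prob ?A \<le> 0"
    by (intro LIMSEQ_le_const) auto
  then have "prob ?A = 0" by (simp add: measure_le_0_iff)
  then have "AE \<omega> in M. \<omega> \<notin> ?A" using prob_eq_0[OF A] by simp
  then show ?thesis using AE_space
  proof eventually_elim
    fix \<omega> assume "\<omega> \<notin> ?A" "\<omega> \<in> space M"
    then obtain n where "t < L (real (Suc n)) \<omega>" by (auto simp: not_le)
    then show "\<exists>u>0. t < L u \<omega>" by (intro exI[of _ "real (Suc n)"]) auto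
  qed
qed

text \<open>Almost every path of \<open>L\<close> is positive at each of the times \<open>1 / n\<close>, because the stable laws do not charge
  \<open>0\<close>.\<close>

lemma AE_inverse_0: "AE \<omega> in M. Y 0 \<omega> = 0"
proof -
  have pos: "AE \<omega> in M. 0 < L (inverse (real (Suc n))) \<omega>" for n
  proof -
    let ?u = "inverse (real (Suc n))"
    have [measurable]: "L ?u \<in> borel_measurable M" by (simp add: L_measurable)
    have A: "{\<omega> \<in> space M. L ?u \<omega> \<le> 0} \<in> events" by measurable
    have "prob {\<omega> \<in> space M. L ?u \<omega> \<le> 0} = 0"
      using F.cdf_0[of ?u] by (simp add: cdf_L del: of_nat_Suc)
    then have "AE \<omega> in M. \<omega> \<notin> {\<omega> \<in> space M. L ?u \<omega> \<le> 0}"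
      using prob_eq_0[OF A] by (simp del: of_nat_Suc)
    then show ?thesis using AE_space by eventually_elim auto
  qed
  then have "AE \<omega> in M. \<forall>n. 0 < L (inverse (real (Suc n))) \<omega>"
    by (simp add: AE_all_countable del: of_nat_Suc)
  then show ?thesis
  proof eventually_elim
    fix \<omega> assume pos: "\<forall>n. 0 < L (inverse (real (Suc n))) \<omega>"
    have "Y 0 \<omega> \<le> inverse (real (Suc n))" for n
      unfolding inverse_process_def using pos by (intro cInf_lower bdd_belowI[of _ 0]) (auto simp del: of_nat_Suc)
    then have "Y 0 \<omega> \<le> 0"
      by (intro LIMSEQ_le_const[OF LIMSEQ_inverse_real_of_nat]) auto
    moreover have "0 \<le> Y 0 \<omega>"
      unfolding inverse_process_def
      by (rule cInf_greatest) (use pos[rule_format, of 0] in \<open>auto intro: less_imp_le exI[of _ 1]\<close>)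
    ultimately show "Y 0 \<omega> = 0" by simp
  qed
qed

context
  fixes t :: real and d :: "real \<Rightarrow> real"
  assumes density: "has_density_on_pos M (Y t) d"
begin

lemma distributed_inverse: "distributed M lborel (Y t) (\<lambda>u. ennreal (indicator {0<..} u * d u))"
  using density by (simp add: has_density_on_pos_def)

lemma measurable_inverse [measurable]: "Y t \<in> borel_measurable M"
  using distributed_measurable[OF distributed_inverse] by simp

lemma measurable_density [measurable]: "(\<lambda>u. ennreal (indicator {0<..} u * d u)) \<in> borel_measurable borel"
  using distributed_borel_measurable[OF distributed_inverse] by simp

lemma AE_inverse_neq: "AE \<omega> in M. Y t \<omega> \<noteq> u"
proof -
  have "emeasure M (Y t -` {u} \<inter> space M) = (\<integral>\<^sup>+x. ennreal (indicator {0<..} x * d x) * indicator {u} x \<partial>lborel)"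
    by (rule distributed_emeasure[OF distributed_inverse]) simp
  also have "\<dots> = (\<integral>\<^sup>+x. 0 \<partial>(lborel :: real measure))"
    by (intro nn_integral_cong_AE) (use AE_lborel_singleton[of u] in \<open>auto elim!: eventually_mono simp: indicator_def\<close>)
  finally have "Y t -` {u} \<inter> space M \<in> null_sets M"
    by (intro null_setsI) auto
  from AE_not_in[OF this] AE_space show ?thesis
    by eventually_elim auto
qed

lemma AE_inverse_pos: "AE \<omega> in M. 0 < Y t \<omega>"
proof -
  have "emeasure M (Y t -` {..0} \<inter> space M) = (\<integral>\<^sup>+x. ennreal (indicator {0<..} x * d x) * indicator {..0} x \<partial>lborel)"
    by (rule distributed_emeasure[OF distributed_inverse]) simp
  also have "\<dots> = (\<integral>\<^sup>+x. 0 \<partial>(lborel :: real measure))"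
    by (intro nn_integral_cong) (auto simp: indicator_def)
  finally have "Y t -` {..0} \<inter> space M \<in> null_sets M"
    by (intro null_setsI) auto
  from AE_not_in[OF this] AE_space show ?thesis
    by eventually_elim auto
qed

lemma prob_less_inverse:
  assumes "0 < u"
  shows "prob {\<omega> \<in> space M. u < Y t \<omega>} = F.stable_cdf u t"
proof -
  have [measurable]: "L u \<in> borel_measurable M" using assms by (simp add: L_measurable)
  have "prob {\<omega> \<in> space M. u < Y t \<omega>} = prob {\<omega> \<in> space M. L u \<omega> \<le> t}"
  proof (rule measure_eq_AE)
    show "AE \<omega> in M. \<omega> \<in> {\<omega> \<in> space M. u < Y t \<omega>} \<longleftrightarrow> \<omega> \<in> {\<omega> \<in> space M. L u \<omega> \<le> t}"
      using AE_exceeds[of t] AE_inverse_neq[of u] AE_space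
    proof eventually_elim
      fix \<omega> assume "\<exists>u>0. t < L u \<omega>" "Y t \<omega> \<noteq> u" "\<omega> \<in> space M"
      then show "\<omega> \<in> {\<omega> \<in> space M. u < Y t \<omega>} \<longleftrightarrow> \<omega> \<in> {\<omega> \<in> space M. L u \<omega> \<le> t}"
        using less_inverse_imp[OF assms, of t \<omega>] le_inverse[of \<omega> u t] assms by auto
    qed
  qed measurable
  then show ?thesis using assms by (simp add: F.stable_cdf_eq_cdf cdf_L)
qed

text \<open>Both functions have the integral \<open>P[Y t > u]\<close> over \<open>(u, \<infinity>)\<close>.\<close>

lemma density_eq_inverse_density: "AE w in lborel. 0 < w \<longrightarrow> ennreal (d w) = F.inverse_density t w"
proof -
  have "AE w in lborel. 0 < w \<longrightarrow> ennreal (indicator {0<..} w * d w) = F.inverse_density t w"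
  proof (rule AE_eq_if_tail_integrals_eq)
    fix u :: real assume u: "0 < u"
    have "(\<integral>\<^sup>+w. ennreal (indicator {0<..} w * d w) * indicator {u<..} w \<partial>lborel) = emeasure M (Y t -` {u<..} \<inter> space M)"
      by (rule distributed_emeasure[OF distributed_inverse, symmetric]) simp
    also have "\<dots> = prob {\<omega> \<in> space M. u < Y t \<omega>}"
      by (simp add: emeasure_eq_measure vimage_def Int_def conj_commute)
    also have "\<dots> = cdf (distr M borel (L u)) t"
      using u by (simp add: prob_less_inverse F.stable_cdf_eq_cdf)
    finally have *: "(\<integral>\<^sup>+w. ennreal (indicator {0<..} w * d w) * indicator {u<..} w \<partial>lborel) = ennreal (cdf (distr M borel (L u)) t)" .
    show "(\<integral>\<^sup>+w. ennreal (indicator {0<..} w * d w) * indicator {u<..} w \<partial>lborel) = (\<integral>\<^sup>+w. F.inverse_density t w * indicator {u<..} w \<partial>lborel)"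
      unfolding * by (rule F.cdf_eq_inverse_density_tail[OF u])
    show "(\<integral>\<^sup>+w. ennreal (indicator {0<..} w * d w) * indicator {u<..} w \<partial>lborel) < \<infinity>"
      unfolding * by simp
  qed measurable
  then show ?thesis by eventually_elim simp
qed

text \<open>Write \<open>\<phi> (Y t)\<close> as \<open>a\<close> plus the integral of \<open>\<Psi> w\<close> over \<open>w < Y t\<close> and take expectations inside the
  integral.\<close>

lemma expectation_inverse:
  fixes \<phi> \<Psi> :: "real \<Rightarrow> real"
  assumes \<Psi>: "integrable lborel \<Psi>" "\<And>u. u \<le> 0 \<Longrightarrow> \<Psi> u = 0"
    and \<phi>: "\<And>u. 0 < u \<Longrightarrow> \<phi> u = a + (LBINT w. \<Psi> w * indicator {..<u} w)"
    and [measurable]: "(\<lambda>\<omega>. \<phi> (Y t \<omega>)) \<in> borel_measurable M"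
  shows "(LINT \<omega>|M. \<phi> (Y t \<omega>)) = a + (LBINT w. \<Psi> w * F.stable_cdf w t)"
proof -
  interpret P: pair_sigma_finite M lborel ..
  have [measurable]: "\<Psi> \<in> borel_measurable borel" using \<Psi>(1) by auto
  let ?F = "\<lambda>\<omega> w. \<Psi> w * indicator {..<Y t \<omega>} w"
  have inner: "integrable lborel (?F \<omega>)" for \<omega>
    using integrable_mult_indicator[OF _ \<Psi>(1), of "{..<Y t \<omega>}"] by (simp add: mult.commute)
  have [measurable]: "(\<lambda>(\<omega>, w). ?F \<omega> w) \<in> borel_measurable (M \<Otimes>\<^sub>M lborel)"
    unfolding indicator_def lessThan_iff by measurable
  have F_int: "integrable (M \<Otimes>\<^sub>M lborel) (\<lambda>(\<omega>, w). ?F \<omega> w)"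
  proof (rule P.Fubini_integrable)
    have "(LBINT w. norm (?F \<omega> w)) \<le> (LBINT w. norm (\<Psi> w))" for \<omega>
      using \<Psi>(1) integrable_norm[OF inner] by (intro integral_mono) (auto simp: indicator_def)
    then show "integrable M (\<lambda>\<omega>. LBINT w. norm ((\<lambda>(\<omega>, w). ?F \<omega> w) (\<omega>, w)))"
      by (intro integrable_const_bound[where B="LBINT w. norm (\<Psi> w)"]) (auto intro!: AE_I2)
  qed (use inner in auto)
  have "(LINT \<omega>|M. \<phi> (Y t \<omega>)) = (LINT \<omega>|M. a + (LBINT w. ?F \<omega> w))"
    by (rule integral_cong_AE) (use AE_inverse_pos in \<open>auto elim!: eventually_mono simp: \<phi>\<close>)
  also have "\<dots> = a + (LINT \<omega>|M. (LBINT w. ?F \<omega> w))"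
    using P.integrable_fst[OF F_int] by (simp add: prob_space)
  also have "(LINT \<omega>|M. (LBINT w. ?F \<omega> w)) = (LBINT w. (LINT \<omega>|M. ?F \<omega> w))"
    by (rule P.Fubini_integral[OF F_int, symmetric])
  also have "\<dots> = (LBINT w. \<Psi> w * F.stable_cdf w t)"
  proof (intro Bochner_Integration.integral_cong refl)
    fix w
    show "(LINT \<omega>|M. ?F \<omega> w) = \<Psi> w * F.stable_cdf w t"
    proof (cases "0 < w")
      case True
      have "(LINT \<omega>|M. ?F \<omega> w) = (LINT \<omega>|M. \<Psi> w * indicator {\<omega> \<in> space M. w < Y t \<omega>} \<omega>)"
        by (intro Bochner_Integration.integral_cong refl) (auto simp: indicator_def)
      then show ?thesis using prob_less_inverse[OF True] by simp
    qed (simp add: \<Psi>(2))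
  qed
  finally show ?thesis .
qed

end

end

section \<open>The Kolmogorov system of the Poisson process of order \<open>k\<close>\<close>

text \<open>The probability that \<open>l\<close> independent steps, uniform on \<open>{1..k}\<close>, add up to \<open>m\<close>, by conditioning on the last
  step.\<close>

fun step_prob :: "nat \<Rightarrow> nat \<Rightarrow> nat \<Rightarrow> real" where
  "step_prob k 0 m = (if m = 0 then 1 else 0)"
| "step_prob k (Suc l) m = (\<Sum>j = 1..min m k. step_prob k l (m - j)) / real k"

lemma step_prob_nonneg: "0 \<le> step_prob k l m"
  by (induction l arbitrary: m) (auto intro!: divide_nonneg_nonneg sum_nonneg)

lemma step_prob_eq_0: "m < l \<Longrightarrow> step_prob k l m = 0"
proof (induction l arbitrary: m)
  case (Suc l)
  have "step_prob k l (m - j) = 0" if "j \<in> {1..min m k}" for j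
    using Suc.prems that by (intro Suc.IH) auto
  then show ?case by simp
qed simp

text \<open>The probability that a Poisson number, of mean \<open>k x\<close>, of uniform steps adds up to \<open>m\<close>. Steps are at least
  \<open>1\<close>, so the sum over the number of steps stops at \<open>m\<close>.\<close>

definition poisson_order_pmf :: "nat \<Rightarrow> nat \<Rightarrow> real \<Rightarrow> real" where
  "poisson_order_pmf k m x = (\<Sum>l\<le>m. exp (- (real k * x)) * (real k * x) ^ l / fact l * step_prob k l m)"

lemma poisson_order_pmf_extend:
  assumes "m \<le> n"
  shows "poisson_order_pmf k m x = (\<Sum>l\<le>n. exp (- (real k * x)) * (real k * x) ^ l / fact l * step_prob k l m)"
  unfolding poisson_order_pmf_def
  by (rule sum.mono_neutral_left) (use assms in \<open>auto simp: step_prob_eq_0\<close>)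

lemma poisson_order_pmf_nonneg: "0 \<le> x \<Longrightarrow> 0 \<le> poisson_order_pmf k m x"
  unfolding poisson_order_pmf_def by (intro sum_nonneg) (simp add: step_prob_nonneg)

lemma continuous_on_poisson_order_pmf: "continuous_on S (poisson_order_pmf k m)"
  unfolding poisson_order_pmf_def by (intro continuous_intros) auto

lemma borel_measurable_poisson_order_pmf [measurable]: "poisson_order_pmf k m \<in> borel_measurable borel"
  by (intro borel_measurable_continuous_onI continuous_on_poisson_order_pmf)

definition poisson_order_rhs :: "nat \<Rightarrow> nat \<Rightarrow> real \<Rightarrow> real" where
  "poisson_order_rhs k m x = - real k * poisson_order_pmf k m x + (\<Sum>j = 1..min m k. poisson_order_pmf k (m - j) x)"

lemma continuous_on_poisson_order_rhs: "continuous_on S (poisson_order_rhs k m)"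
  unfolding poisson_order_rhs_def by (intro continuous_intros continuous_on_poisson_order_pmf)

lemma borel_measurable_poisson_order_rhs [measurable]: "poisson_order_rhs k m \<in> borel_measurable borel"
  by (intro borel_measurable_continuous_onI continuous_on_poisson_order_rhs)

text \<open>Differentiating \<open>(k x) ^ (l + 1) / (l + 1)!\<close> lowers the number of steps by one, and the factor \<open>k\<close> cancels the
  \<open>1 / k\<close> in the recursion of \<open>step_prob\<close>; the remaining sum over the last step produces the terms \<open>m - j\<close>.\<close>

lemma DERIV_poisson_order_pmf:
  assumes "0 < k"
  shows "(poisson_order_pmf k m has_real_derivative poisson_order_rhs k m x) (at x)"
proof -
  define Q where "Q n x = (\<Sum>l\<le>n. (real k * x) ^ l / fact l * step_prob k l m)" for n x
  define Q' where "Q' n x = (\<Sum>l<n. (real k * x) ^ l / fact l * (\<Sum>j = 1..min m k. step_prob k l (m - j)))" for n x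
  have Q: "(Q n has_real_derivative Q' n x) (at x)" for n
  proof (induction n)
    case 0
    show ?case by (simp add: Q_def Q'_def)
  next
    case (Suc n)
    have "((\<lambda>x. (real k * x) ^ Suc n / fact (Suc n) * step_prob k (Suc n) m) has_real_derivative
       (real (Suc n) * (real k * x) ^ n * real k) / fact (Suc n) * step_prob k (Suc n) m) (at x)"
      by (rule derivative_eq_intros refl | simp)+
    moreover have "(real (Suc n) * (real k * x) ^ n * real k) / fact (Suc n) * step_prob k (Suc n) m
       = (real k * x) ^ n / fact n * (\<Sum>j = 1..min m k. step_prob k n (m - j))"
      using assms by (simp del: of_nat_Suc add: fact_Suc)
    ultimately have "((\<lambda>x. (real k * x) ^ Suc n / fact (Suc n) * step_prob k (Suc n) m) has_real_derivative
        (real k * x) ^ n / fact n * (\<Sum>j = 1..min m k. step_prob k n (m - j))) (at x)"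
      by (rule DERIV_cong)
    from DERIV_add[OF Suc.IH this] show ?case
      unfolding Q_def[abs_def] Q'_def sum.atMost_Suc sum.lessThan_Suc .
  qed
  have pmf: "poisson_order_pmf k m x = exp (- (real k * x)) * Q m x" for x
    by (simp add: poisson_order_pmf_def Q_def sum_distrib_left mult.assoc)
  have sum: "exp (- (real k * x)) * Q' m x = (\<Sum>j = 1..min m k. poisson_order_pmf k (m - j) x)"
  proof -
    have "exp (- (real k * x)) * Q' m x
       = (\<Sum>l<m. \<Sum>j = 1..min m k. exp (- (real k * x)) * (real k * x) ^ l / fact l * step_prob k l (m - j))"
      by (simp add: Q'_def sum_distrib_left mult.assoc)
    also have "\<dots> = (\<Sum>j = 1..min m k. \<Sum>l<m. exp (- (real k * x)) * (real k * x) ^ l / fact l * step_prob k l (m - j))"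
      by (rule sum.swap)
    also have "\<dots> = (\<Sum>j = 1..min m k. poisson_order_pmf k (m - j) x)"
    proof (intro sum.cong refl)
      fix j assume j: "j \<in> {1..min m k}"
      then have "{..<m} = {..m - 1}" by auto
      moreover have "poisson_order_pmf k (m - j) x = (\<Sum>l\<le>m - 1. exp (- (real k * x)) * (real k * x) ^ l / fact l * step_prob k l (m - j))"
        using j by (intro poisson_order_pmf_extend) auto
      ultimately show "(\<Sum>l<m. exp (- (real k * x)) * (real k * x) ^ l / fact l * step_prob k l (m - j)) = poisson_order_pmf k (m - j) x"
        by (simp only:)
    qed
    finally show ?thesis .
  qed
  have "((\<lambda>x. exp (- (real k * x)) * Q m x) has_real_derivative
      (exp (- (real k * x)) * - real k) * Q m x + Q' m x * exp (- (real k * x))) (at x)"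
    by (rule DERIV_mult[OF _ Q]) (auto intro!: derivative_eq_intros)
  moreover have "(exp (- (real k * x)) * - real k) * Q m x + Q' m x * exp (- (real k * x)) = poisson_order_rhs k m x"
    unfolding poisson_order_rhs_def sum[symmetric] pmf by (simp add: mult_ac)
  moreover have "poisson_order_pmf k m = (\<lambda>x. exp (- (real k * x)) * Q m x)"
    by (rule ext) (rule pmf)
  ultimately show ?thesis by (simp only:)
qed

text \<open>Up to the factor \<open>1 / k\<close> the Poisson weights are Erlang densities in \<open>x\<close>.\<close>

lemma nn_integral_poisson_order_pmf_finite:
  assumes "0 < k"
  shows "(\<integral>\<^sup>+x. ennreal (poisson_order_pmf k m x) * indicator {0..} x \<partial>lborel) < \<infinity>"
proof -
  have "(\<integral>\<^sup>+x. ennreal (poisson_order_pmf k m x) * indicator {0..} x \<partial>lborel)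
     = (\<integral>\<^sup>+x. (\<Sum>l\<le>m. ennreal (step_prob k l m / real k) * ennreal (erlang_density l (real k) x)) \<partial>lborel)"
  proof (intro nn_integral_cong)
    fix x
    show "ennreal (poisson_order_pmf k m x) * indicator {0..} x
      = (\<Sum>l\<le>m. ennreal (step_prob k l m / real k) * ennreal (erlang_density l (real k) x))"
    proof (cases "0 \<le> x")
      case True
      then show ?thesis
        using assms unfolding poisson_order_pmf_def
        by (subst sum_ennreal[symmetric])
           (auto simp: erlang_density_def ennreal_mult[symmetric] step_prob_nonneg power_mult_distrib mult_ac intro!: sum.cong)
    qed (simp add: erlang_density_def)
  qed
  also have "\<dots> = (\<Sum>l\<le>m. ennreal (step_prob k l m / real k) * (\<integral>\<^sup>+x. ennreal (erlang_density l (real k) x) \<partial>lborel))"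
    by (simp add: nn_integral_sum nn_integral_cmult)
  also have "\<dots> = (\<Sum>l\<le>m. ennreal (step_prob k l m / real k))"
  proof (intro sum.cong refl)
    fix l
    interpret prob_space "density lborel (erlang_density l (real k))"
      using assms by (intro prob_space_erlang_density) simp
    have "(\<integral>\<^sup>+x. ennreal (erlang_density l (real k) x) \<partial>lborel) = 1"
      using emeasure_space_1 by (simp add: emeasure_density)
    then show "ennreal (step_prob k l m / real k) * (\<integral>\<^sup>+x. ennreal (erlang_density l (real k) x) \<partial>lborel) = ennreal (step_prob k l m / real k)"
      by simp
  qed
  also have "\<dots> < \<infinity>" by (simp add: less_top)
  finally show ?thesis .
qed

section \<open>Substitution along the cumulative rate\<close>

text \<open>The substitution \<open>x = A w\<close> for an absolutely continuous \<open>A\<close> with a density that is merely locally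
  integrable.\<close>

locale locally_integrable_rate =
  fixes \<rho> :: "real \<Rightarrow> real"
  assumes nonneg: "\<And>w. 0 \<le> w \<Longrightarrow> 0 \<le> \<rho> w"
    and integrable: "\<And>T. 0 < T \<Longrightarrow> set_integrable lborel {0..T} \<rho>"
begin

abbreviation "A \<equiv> cumulative_rate \<rho>"

lemma integrable_Icc: "set_integrable lborel {0..T} \<rho>"
proof (cases "0 < T")
  case False
  have "set_integrable lborel {0..1} \<rho>" by (intro integrable) simp
  then show ?thesis
    by (rule set_integrable_subset) (use False in auto)
qed (rule integrable)

lemma integrable_Ioc: "0 \<le> s \<Longrightarrow> set_integrable lborel {s<..t} \<rho>"
  by (rule set_integrable_subset[OF integrable_Icc[of t]]) auto

lemma cumulative_rate_neg: "t \<le> 0 \<Longrightarrow> A t = 0"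
proof -
  assume "t \<le> 0"
  then have "A t = integral\<^sup>L lborel (\<lambda>x::real. 0::real)"
    unfolding cumulative_rate_def set_lebesgue_integral_def
    by (intro integral_cong_AE)
       (use integrable_Icc[of t] AE_lborel_singleton[of "0::real"] in
          \<open>auto simp: set_integrable_def indicator_def elim!: eventually_mono\<close>)
  then show ?thesis by simp
qed

lemma cumulative_rate_diff:
  assumes "0 \<le> s" "s \<le> t"
  shows "A t - A s = (LBINT x:{s<..t}. \<rho> x)"
proof -
  have "{0..t} = {0..s} \<union> {s<..t}" using assms by auto
  then have "A t = A s + (LBINT x:{s<..t}. \<rho> x)"
    unfolding cumulative_rate_def
    by (simp only:) (rule set_integral_Un, use assms in \<open>auto intro: integrable_Icc integrable_Ioc\<close>)
  then show ?thesis by simp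
qed

lemma mono_cumulative_rate: "mono A"
proof (rule monoI)
  fix s t :: real assume st: "s \<le> t"
  have le: "A s \<le> A t" if "0 \<le> s" "s \<le> t" for s t
  proof -
    have "0 \<le> (LBINT x:{s<..t}. \<rho> x)"
      unfolding set_lebesgue_integral_def using that by (intro Bochner_Integration.integral_nonneg) (auto simp: indicator_def nonneg)
    then show ?thesis using cumulative_rate_diff[OF that] by simp
  qed
  show "A s \<le> A t"
    using le[of s t] le[of 0 t] st cumulative_rate_neg[of s] cumulative_rate_neg[of t] cumulative_rate_neg[of 0]
    by (cases "0 \<le> s"; cases "0 \<le> t") auto
qed

lemma borel_measurable_cumulative_rate [measurable]: "A \<in> borel_measurable borel"
  by (rule borel_measurable_mono[OF mono_cumulative_rate])

lemma cumulative_rate_nonneg: "0 \<le> A t"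
  using monoD[OF mono_cumulative_rate, of "min 0 t" t] cumulative_rate_neg[of "min 0 t"] by simp

lemma continuous_on_cumulative_rate: "continuous_on {0..} A"
proof -
  have T: "continuous_on {0..T} A" for T
  proof -
    have eq: "A t = integral {0..t} \<rho>" for t
      unfolding cumulative_rate_def by (rule set_borel_integral_eq_integral(2)[OF integrable_Icc])
    have "continuous_on {0..T} (\<lambda>t. integral {0..t} \<rho>)"
      by (intro indefinite_integral_continuous_1 set_borel_integral_eq_integral(1) integrable_Icc)
    then show ?thesis by (simp add: eq[abs_def])
  qed
  show ?thesis
    unfolding continuous_on_eq_continuous_within
  proof
    fix x :: real assume "x \<in> {0..}"
    then have "continuous (at x within {0..x + 1}) A"
      using T[of "x + 1"] by (auto simp: continuous_on_eq_continuous_within)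
    moreover have "at x within {0..} = at x within {0..x + 1}"
      by (rule at_within_nhd[of x "{..<x + 1}"]) auto
    ultimately show "continuous (at x within {0..}) A" by simp
  qed
qed

lemma nn_integral_rate_Ioc:
  assumes "0 \<le> s" "s \<le> t"
  shows "(\<integral>\<^sup>+w. ennreal (\<rho> w) * indicator {s<..t} w \<partial>lborel) = ennreal (A t - A s)"
proof -
  have "(\<integral>\<^sup>+w. ennreal (\<rho> w) * indicator {s<..t} w \<partial>lborel) = (\<integral>\<^sup>+w. ennreal (indicator {s<..t} w *\<^sub>R \<rho> w) \<partial>lborel)"
    by (intro nn_integral_cong) (auto simp: indicator_def)
  also have "\<dots> = ennreal (LBINT x:{s<..t}. \<rho> x)"
    unfolding set_lebesgue_integral_def using integrable_Ioc[of s t] assms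
    by (intro nn_integral_eq_integral) (auto simp: set_integrable_def indicator_def nonneg)
  finally show ?thesis by (simp add: cumulative_rate_diff[OF assms])
qed

lemma measurable_rate: "(\<lambda>w. ennreal (\<rho> w) * indicator {0<..u} w) \<in> borel_measurable borel"
proof -
  have "(\<lambda>w. ennreal (indicator {0<..u} w *\<^sub>R \<rho> w)) \<in> borel_measurable borel"
    using integrable_Ioc[of 0 u] by (auto simp: set_integrable_def)
  then show ?thesis
    by (rule measurable_cong[THEN iffD1, rotated]) (auto simp: indicator_def)
qed

text \<open>The set where \<open>A > a\<close> is the half-open interval from the last point \<open>w0\<close> with \<open>A w0 = a\<close> to \<open>u\<close>, and
  the rate integrates over it to \<open>A u - a\<close>. Taking the last point takes care of intervals on which \<open>A\<close> is
  constant.\<close>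

lemma distr_cumulative_rate:
  assumes u: "0 \<le> u"
  shows "distr (density lborel (\<lambda>w. ennreal (\<rho> w) * indicator {0<..u} w)) borel A = density lborel (indicator {0<..A u})"
proof (rule measure_eqI_lessThan)
  note [measurable] = measurable_rate[of u]
  fix a :: real
  have L: "emeasure (distr (density lborel (\<lambda>w. ennreal (\<rho> w) * indicator {0<..u} w)) borel A) {a<..}
     = (\<integral>\<^sup>+w. ennreal (\<rho> w) * indicator {w. 0 < w \<and> w \<le> u \<and> a < A w} w \<partial>lborel)"
  proof -
    have [measurable]: "A -` {a<..} \<in> sets borel"
      using measurable_sets_borel[OF borel_measurable_cumulative_rate, of "{a<..}"] by simp
    have "emeasure (distr (density lborel (\<lambda>w. ennreal (\<rho> w) * indicator {0<..u} w)) borel A) {a<..}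
       = emeasure (density lborel (\<lambda>w. ennreal (\<rho> w) * indicator {0<..u} w)) (A -` {a<..})"
      by (subst emeasure_distr) (auto simp: space_density)
    also have "\<dots> = (\<integral>\<^sup>+w. ennreal (\<rho> w) * indicator {0<..u} w * indicator (A -` {a<..}) w \<partial>lborel)"
      by (subst emeasure_density) auto
    finally show ?thesis
      by (auto intro!: nn_integral_cong simp: indicator_def)
  qed
  have R: "emeasure (density lborel (indicator {0<..A u})) {a<..} = emeasure lborel {max 0 a<..A u}"
  proof -
    have "emeasure (density lborel (indicator {0<..A u})) {a<..} = (\<integral>\<^sup>+x. indicator {0<..A u} x * indicator {a<..} x \<partial>lborel)"
      by (subst emeasure_density) auto
    also have "\<dots> = (\<integral>\<^sup>+x. indicator {max 0 a<..A u} x \<partial>lborel)"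
      by (intro nn_integral_cong) (auto simp: indicator_def)
    also have "\<dots> = emeasure lborel {max 0 a<..A u}" by (rule nn_integral_indicator) simp
    finally show ?thesis .
  qed
  show "emeasure (distr (density lborel (\<lambda>w. ennreal (\<rho> w) * indicator {0<..u} w)) borel A) {a<..}
      = emeasure (density lborel (indicator {0<..A u})) {a<..}"
  proof (cases "A u \<le> a")
    case True
    then have "{w. 0 < w \<and> w \<le> u \<and> a < A w} = {}"
      using monoD[OF mono_cumulative_rate] by (auto simp: not_less intro: order_trans)
    then show ?thesis unfolding L R using True by simp
  next
    case False
    define b where "b = max 0 a"
    have b: "0 \<le> b" "b \<le> A u" using False cumulative_rate_nonneg[of u] by (auto simp: b_def)
    \<comment> \<open>The supremum of this closed set is the last point at which \<open>A\<close> has the value \<open>b\<close>.\<close>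
    define S where "S = {w \<in> {0..u}. A w \<le> b}"
    have cont: "continuous_on {0..u} A"
      using continuous_on_cumulative_rate by (rule continuous_on_subset) auto
    have S0: "0 \<in> S" using u b by (simp add: S_def cumulative_rate_neg)
    have "closed ({0..u} \<inter> A -` {..b})"
      by (intro continuous_closed_preimage cont) auto
    moreover have "{0..u} \<inter> A -` {..b} = S" by (auto simp: S_def)
    ultimately have "closed S" by simp
    moreover have bdd: "bdd_above S" by (auto simp: S_def)
    ultimately have w0: "Sup S \<in> S" using S0 by (intro closed_contains_Sup) auto
    define w0 where "w0 = Sup S"
    have w0': "0 \<le> w0" "w0 \<le> u" "A w0 \<le> b" using w0 by (auto simp: S_def w0_def)
    obtain w1 where w1: "0 \<le> w1" "w1 \<le> u" "A w1 = b"
      using IVT'[of A 0 b u] u b cont by (auto simp: cumulative_rate_neg)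
    have "w1 \<le> w0" unfolding w0_def using w1 by (intro cSup_upper bdd) (auto simp: S_def)
    then have Aw0: "A w0 = b" using w1 w0' monoD[OF mono_cumulative_rate, of w1 w0] by simp
    have eq: "b < A w \<longleftrightarrow> w0 < w" if "0 < w" "w \<le> u" for w
    proof
      assume "b < A w"
      then show "w0 < w" using Aw0 monoD[OF mono_cumulative_rate, of w w0] by (auto simp: not_less[symmetric])
    next
      assume "w0 < w"
      show "b < A w"
      proof (rule ccontr)
        assume "\<not> b < A w"
        then have "w \<in> S" using that by (auto simp: S_def)
        then have "w \<le> w0" unfolding w0_def by (intro cSup_upper bdd)
        then show False using \<open>w0 < w\<close> by simp
      qed
    qed
    have "(\<integral>\<^sup>+w. ennreal (\<rho> w) * indicator {w. 0 < w \<and> w \<le> u \<and> a < A w} w \<partial>lborel) = ennreal (A u - A w0)"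
    proof (cases "a < 0")
      case True
      then have "b = 0" by (simp add: b_def)
      have "{w. 0 < w \<and> w \<le> u \<and> a < A w} = {0<..u}"
        using True cumulative_rate_nonneg by (auto intro: less_le_trans)
      then show ?thesis using nn_integral_rate_Ioc[of 0 u] u Aw0 \<open>b = 0\<close> by (simp add: cumulative_rate_neg)
    next
      case False
      then have "b = a" by (simp add: b_def)
      then have "{w. 0 < w \<and> w \<le> u \<and> a < A w} = {w0<..u}"
        using eq w0' by auto
      then show ?thesis using nn_integral_rate_Ioc[of w0 u] w0' by simp
    qed
    then show ?thesis
      unfolding L R using Aw0 b by (simp add: b_def)
  qed
  show "emeasure (distr (density lborel (\<lambda>w. ennreal (\<rho> w) * indicator {0<..u} w)) borel A) {a<..} < \<infinity>"
  proof -
    have "(\<integral>\<^sup>+w. ennreal (\<rho> w) * indicator {w. 0 < w \<and> w \<le> u \<and> a < A w} w \<partial>lborel)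
       \<le> (\<integral>\<^sup>+w. ennreal (\<rho> w) * indicator {0<..u} w \<partial>lborel)"
      by (intro nn_integral_mono) (auto simp: indicator_def)
    then show ?thesis unfolding L using nn_integral_rate_Ioc[of 0 u] u by (auto intro: order.strict_trans1)
  qed
qed (auto)

lemma nn_integral_rate_substitution:
  assumes "0 \<le> u" and [measurable]: "f \<in> borel_measurable borel"
  shows "(\<integral>\<^sup>+w. f (A w) * (ennreal (\<rho> w) * indicator {0<..u} w) \<partial>lborel) = (\<integral>\<^sup>+x. f x * indicator {0<..A u} x \<partial>lborel)"
proof -
  note [measurable] = measurable_rate[of u]
  have "(\<integral>\<^sup>+x. f x \<partial>distr (density lborel (\<lambda>w. ennreal (\<rho> w) * indicator {0<..u} w)) borel A)
      = (\<integral>\<^sup>+x. f x \<partial>density lborel (indicator {0<..A u}))"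
    by (simp only: distr_cumulative_rate[OF assms(1)])
  then show ?thesis
    by (simp add: nn_integral_distr nn_integral_density mult.commute)
qed

lemma nn_integral_rate_substitution_le:
  assumes [measurable]: "f \<in> borel_measurable borel"
  shows "(\<integral>\<^sup>+w. f (A w) * (ennreal (\<rho> w) * indicator {0<..} w) \<partial>lborel) \<le> (\<integral>\<^sup>+x. f x * indicator {0..} x \<partial>lborel)"
proof -
  note [measurable] = measurable_rate
  let ?h = "\<lambda>n w. f (A w) * (ennreal (\<rho> w) * indicator {0<..real n} w)"
  have sup: "f (A w) * (ennreal (\<rho> w) * indicator {0<..} w) = (SUP n. ?h n w)" for w
  proof (cases "0 < w")
    case True
    obtain n0 where n0: "w \<le> real n0" using real_arch_simple by blast
    show ?thesis
    proof (rule antisym)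
      show "f (A w) * (ennreal (\<rho> w) * indicator {0<..} w) \<le> (SUP n. ?h n w)"
        using True n0 by (intro SUP_upper2[of n0]) auto
      show "(SUP n. ?h n w) \<le> f (A w) * (ennreal (\<rho> w) * indicator {0<..} w)"
        by (intro SUP_least) (auto simp: indicator_def)
    qed
  qed simp
  have "(\<integral>\<^sup>+w. f (A w) * (ennreal (\<rho> w) * indicator {0<..} w) \<partial>lborel) = (SUP n. \<integral>\<^sup>+w. ?h n w \<partial>lborel)"
    unfolding sup
  proof (rule nn_integral_monotone_convergence_SUP)
    show "incseq ?h" by (auto simp: incseq_def le_fun_def indicator_def)
  qed measurable
  also have "\<dots> \<le> (\<integral>\<^sup>+x. f x * indicator {0..} x \<partial>lborel)"
  proof (rule SUP_least)
    fix n
    have "(\<integral>\<^sup>+w. ?h n w \<partial>lborel) = (\<integral>\<^sup>+x. f x * indicator {0<..A (real n)} x \<partial>lborel)"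
      by (rule nn_integral_rate_substitution) auto
    also have "\<dots> \<le> (\<integral>\<^sup>+x. f x * indicator {0..} x \<partial>lborel)"
      by (intro nn_integral_mono) (auto simp: indicator_def)
    finally show "(\<integral>\<^sup>+w. ?h n w \<partial>lborel) \<le> (\<integral>\<^sup>+x. f x * indicator {0..} x \<partial>lborel)" .
  qed
  finally show ?thesis .
qed

lemma measurable_rate_Ioi: "(\<lambda>w. indicator {0<..} w * \<rho> w) \<in> borel_measurable borel"
proof -
  have [measurable]: "(\<lambda>w. indicator {0<..real n} w * \<rho> w) \<in> borel_measurable borel" for n
    using integrable_Ioc[of 0 "real n"] by (auto simp: set_integrable_def)
  show ?thesis
  proof (rule borel_measurable_LIMSEQ_real)
    show "(\<lambda>n. indicator {0<..real n} w * \<rho> w) \<longlonglongrightarrow> indicator {0<..} w * \<rho> w" for w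
    proof -
      obtain n0 where n0: "w \<le> real n0" using real_arch_simple by blast
      have "eventually (\<lambda>n. indicator {0<..real n} w * \<rho> w = indicator {0<..} w * \<rho> w) sequentially"
        using eventually_ge_at_top[of n0] by eventually_elim (use n0 in \<open>auto simp: indicator_def\<close>)
      then show ?thesis by (rule tendsto_eventually)
    qed
  qed measurable
qed

text \<open>The fundamental theorem of calculus for \<open>F\<close>, pulled back along \<open>A\<close>.\<close>

lemma rate_substitution:
  fixes f F :: "real \<Rightarrow> real"
  assumes "0 \<le> u" and F: "\<And>x. (F has_real_derivative f x) (at x)" and f: "continuous_on UNIV f"
  shows "(LBINT w. indicator {0<..u} w * (\<rho> w * f (A w))) = F (A u) - F 0"
proof -
  have [measurable]: "f \<in> borel_measurable borel" using f by (rule borel_measurable_continuous_onI)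
  have [measurable]: "(\<lambda>w. indicator {0<..u} w * \<rho> w) \<in> borel_measurable borel"
    using integrable_Ioc[of 0 u] by (auto simp: set_integrable_def)
  have eq: "(\<lambda>w. ennreal (\<rho> w) * indicator {0<..u} w) = (\<lambda>w. ennreal (indicator {0<..u} w * \<rho> w))"
    by (auto simp: indicator_def)
  have "(LBINT w. indicator {0<..u} w * (\<rho> w * f (A w))) = (LINT w|density lborel (\<lambda>w. ennreal (indicator {0<..u} w * \<rho> w)). f (A w))"
  proof (subst integral_density)
    show "AE w in lborel. 0 \<le> indicator {0<..u} w * \<rho> w" by (auto simp: indicator_def nonneg)
  qed (measurable, simp add: mult.assoc)
  also have "\<dots> = (LINT x|distr (density lborel (\<lambda>w. ennreal (indicator {0<..u} w * \<rho> w))) borel A. f x)"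
    by (rule integral_distr[symmetric]) auto
  also have "\<dots> = (LINT x|density lborel (\<lambda>x. ennreal (indicator {0<..A u} x)). f x)"
    unfolding eq[symmetric] distr_cumulative_rate[OF assms(1)] by (simp add: ennreal_indicator)
  also have "\<dots> = (LBINT x. indicator {0<..A u} x *\<^sub>R f x)"
    by (subst integral_density) auto
  also have "\<dots> = (LBINT x. indicator {0..A u} x *\<^sub>R f x)"
    by (intro integral_cong_AE) (use AE_lborel_singleton[of "0::real"] in \<open>auto elim!: eventually_mono simp: indicator_def\<close>)
  also have "\<dots> = F (A u) - F 0"
  proof (rule integral_FTC_Icc)
    show "(F has_vector_derivative f x) (at x within {0..A u})" for x
      using F[of x] by (auto simp: has_real_derivative_iff_has_vector_derivative intro: has_vector_derivative_at_within)
    show "continuous_on {0..A u} f" using f by (rule continuous_on_subset) auto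
  qed (rule cumulative_rate_nonneg)
  finally show ?thesis .
qed

lemma integrable_rate_pmf:
  assumes "0 < k"
  shows "integrable lborel (\<lambda>w. indicator {0<..} w * (\<rho> w * poisson_order_pmf k m (A w)))"
proof (rule integrableI_nonneg)
  note [measurable] = measurable_rate_Ioi
  have "(\<lambda>w. (indicator {0<..} w * \<rho> w) * poisson_order_pmf k m (A w)) \<in> borel_measurable lborel"
    by measurable
  then show "(\<lambda>w. indicator {0<..} w * (\<rho> w * poisson_order_pmf k m (A w))) \<in> borel_measurable lborel"
    by (simp add: mult.assoc)
  show "AE w in lborel. 0 \<le> indicator {0<..} w * (\<rho> w * poisson_order_pmf k m (A w))"
    by (auto simp: indicator_def nonneg poisson_order_pmf_nonneg cumulative_rate_nonneg)
  have "(\<integral>\<^sup>+w. ennreal (indicator {0<..} w * (\<rho> w * poisson_order_pmf k m (A w))) \<partial>lborel)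
     = (\<integral>\<^sup>+w. ennreal (poisson_order_pmf k m (A w)) * (ennreal (\<rho> w) * indicator {0<..} w) \<partial>lborel)"
    by (intro nn_integral_cong)
       (auto simp: indicator_def ennreal_mult nonneg poisson_order_pmf_nonneg cumulative_rate_nonneg mult.commute)
  also have "\<dots> \<le> (\<integral>\<^sup>+x. ennreal (poisson_order_pmf k m x) * indicator {0..} x \<partial>lborel)"
    by (rule nn_integral_rate_substitution_le) measurable
  also have "\<dots> < \<infinity>" by (rule nn_integral_poisson_order_pmf_finite[OF assms])
  finally show "(\<integral>\<^sup>+w. ennreal (indicator {0<..} w * (\<rho> w * poisson_order_pmf k m (A w))) \<partial>lborel) < \<infinity>" .
qed

lemma integrable_rate_rhs:
  assumes "0 < k"
  shows "integrable lborel (\<lambda>w. indicator {0<..} w * (\<rho> w * poisson_order_rhs k m (A w)))"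
proof -
  let ?f = "\<lambda>m w. indicator {0<..} w * (\<rho> w * poisson_order_pmf k m (A w))"
  have *: "indicator {0<..} w * (\<rho> w * poisson_order_rhs k m (A w)) = - real k * ?f m w + (\<Sum>j = 1..min m k. ?f (m - j) w)" for w
    by (simp add: poisson_order_rhs_def algebra_simps sum_distrib_left)
  show ?thesis
    unfolding *
    by (intro Bochner_Integration.integrable_add Bochner_Integration.integrable_mult_right
        Bochner_Integration.integrable_sum integrable_rate_pmf assms)
qed

end

lemma (in locally_integrable_rate) shift_rate:
  assumes v: "0 \<le> v"
  shows "locally_integrable_rate (\<lambda>w. \<rho> (w + v))"
proof
  fix T :: real assume "0 < T"
  have "set_integrable lborel {v..T + v} \<rho>"
    by (rule set_integrable_subset[OF integrable_Icc[of "T + v"]]) (use v in auto)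
  then have "integrable lborel (\<lambda>x. indicator {v..T + v} (v + 1 * x) * \<rho> (v + 1 * x))"
    unfolding set_integrable_def real_scaleR_def by (rule lborel_integrable_real_affine) simp
  then show "set_integrable lborel {0..T} (\<lambda>w. \<rho> (w + v))"
    unfolding set_integrable_def by (rule Bochner_Integration.integrable_cong[THEN iffD1, rotated 2]) (auto simp: indicator_def add.commute)
qed (use v nonneg in auto)

lemma (in locally_integrable_rate) cumulative_rate_shift:
  assumes v: "0 \<le> v" and u: "0 \<le> u"
  shows "cumulative_rate (\<lambda>w. \<rho> (w + v)) u = A (u + v) - A v"
proof -
  interpret S: locally_integrable_rate "\<lambda>w. \<rho> (w + v)" by (rule shift_rate[OF v])
  have "A (u + v) - A v = (LBINT x. indicator {v<..u + v} x * \<rho> x)"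
    using cumulative_rate_diff[of v "u + v"] u v by (simp add: set_lebesgue_integral_def)
  also have "\<dots> = (LBINT w. indicator {v<..u + v} (v + 1 * w) * \<rho> (v + 1 * w))"
    by (subst lborel_integral_real_affine[of 1 _ v]) auto
  also have "\<dots> = (LBINT w. indicator {0<..u} w * \<rho> (w + v))"
    by (intro Bochner_Integration.integral_cong refl) (auto simp: indicator_def add.commute)
  also have "\<dots> = cumulative_rate (\<lambda>w. \<rho> (w + v)) u"
    using S.cumulative_rate_diff[of 0 u] u by (simp add: S.cumulative_rate_neg set_lebesgue_integral_def)
  finally show ?thesis by simp
qed

section \<open>Increments of the process and the independent time change\<close>

text \<open>The sigma-algebra of \<open>process_events\<close> as a measure space, so that membership of events in it can be
  derived as measurability.\<close>

definition process_algebra :: "'a measure \<Rightarrow> 'i set \<Rightarrow> 'b measure \<Rightarrow> ('i \<Rightarrow> 'a \<Rightarrow> 'b) \<Rightarrow> 'a measure" where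
  "process_algebra M I S A = sigma (space M) {A i -` E \<inter> space M | i E. i \<in> I \<and> E \<in> sets S}"

lemma space_process_algebra [simp]: "space (process_algebra M I S A) = space M"
  unfolding process_algebra_def by (rule space_measure_of) auto

lemma sets_process_algebra: "sets (process_algebra M I S A) = process_events M I S A"
  unfolding process_algebra_def process_events_def by (rule sets_measure_of) auto

lemma measurable_process_algebra:
  assumes "i \<in> I" "\<And>\<omega>. \<omega> \<in> space M \<Longrightarrow> A i \<omega> \<in> space S"
  shows "A i \<in> measurable (process_algebra M I S A) S"
proof (rule measurableI)
  fix E assume "E \<in> sets S"
  then show "A i -` E \<inter> space (process_algebra M I S A) \<in> sets (process_algebra M I S A)"
    using assms(1) unfolding sets_process_algebra process_events_def by (auto intro!: sigma_sets.Basic)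
qed (use assms in auto)

context prob_space
begin

lemma indep_processes_prob:
  assumes "indep_processes M I S A J T B"
    and "E \<in> sets (process_algebra M I S A)" "F \<in> sets (process_algebra M J T B)"
  shows "prob (E \<inter> F) = prob E * prob F"
  using assms unfolding indep_processes_def sets_process_algebra by (intro indep_setD)

lemma indep_processes_events:
  assumes "indep_processes M I S A J T B"
  shows "sets (process_algebra M I S A) \<subseteq> events" "sets (process_algebra M J T B) \<subseteq> events"
  using assms unfolding indep_processes_def sets_process_algebra indep_set_def indep_sets_def
  by (auto split: bool.splits)

lemma emeasure_eq_suminf_fibres:
  fixes g :: "'a \<Rightarrow> nat"
  assumes [measurable]: "g \<in> measurable M (count_space UNIV)" "E \<in> events"
  shows "emeasure M E = (\<Sum>n. emeasure M (E \<inter> {\<omega> \<in> space M. g \<omega> = n}))"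
proof -
  have "(\<Sum>n. emeasure M (E \<inter> {\<omega> \<in> space M. g \<omega> = n})) = emeasure M (\<Union>n. E \<inter> {\<omega> \<in> space M. g \<omega> = n})"
    by (rule suminf_emeasure) (auto simp: disjoint_family_on_def)
  also have "(\<Union>n. E \<inter> {\<omega> \<in> space M. g \<omega> = n}) = E"
    using sets.sets_into_space[OF assms(2)] by auto
  finally show ?thesis by simp
qed

text \<open>Summation over the fibres of \<open>g\<close>. This replaces conditioning on a random time with countably many values.\<close>

lemma prob_mixture:
  fixes g :: "'a \<Rightarrow> nat" and c :: "nat \<Rightarrow> real"
  assumes [measurable]: "g \<in> measurable M (count_space UNIV)" "E \<in> events"
    and c: "\<And>n. 0 \<le> c n" "\<And>n. c n \<le> 1"
    and split: "\<And>n. prob (E \<inter> {\<omega> \<in> space M. g \<omega> = n}) = prob {\<omega> \<in> space M. g \<omega> = n} * c n"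
  shows "prob E = (LINT \<omega>|M. c (g \<omega>))"
proof -
  have "emeasure M E = (\<Sum>n. emeasure M (E \<inter> {\<omega> \<in> space M. g \<omega> = n}))"
    by (rule emeasure_eq_suminf_fibres) auto
  also have "\<dots> = (\<Sum>n. \<integral>\<^sup>+\<omega>. ennreal (c n) * indicator {\<omega> \<in> space M. g \<omega> = n} \<omega> \<partial>M)"
    by (intro suminf_cong) (simp add: emeasure_eq_measure split ennreal_mult c nn_integral_cmult_indicator mult.commute)
  also have "\<dots> = (\<integral>\<^sup>+\<omega>. (\<Sum>n. ennreal (c n) * indicator {\<omega> \<in> space M. g \<omega> = n} \<omega>) \<partial>M)"
    by (rule nn_integral_suminf[symmetric]) measurable
  also have "\<dots> = (\<integral>\<^sup>+\<omega>. ennreal (c (g \<omega>)) \<partial>M)"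
  proof (intro nn_integral_cong)
    fix \<omega> assume "\<omega> \<in> space M"
    then show "(\<Sum>n. ennreal (c n) * indicator {\<omega> \<in> space M. g \<omega> = n} \<omega>) = ennreal (c (g \<omega>))"
      by (subst suminf_finite[of "{g \<omega>}"]) auto
  qed
  also have "\<dots> = ennreal (LINT \<omega>|M. c (g \<omega>))"
    by (intro nn_integral_eq_integral integrable_const_bound[where B=1]) (auto simp: c)
  finally show ?thesis
    by (simp add: emeasure_eq_measure c)
qed

end

locale order_k_model = prob_space M for M :: "'a measure" +
  fixes k :: nat and X :: "nat \<Rightarrow> 'a \<Rightarrow> nat" and N1 :: "real \<Rightarrow> 'a \<Rightarrow> nat"
  assumes k: "1 \<le> k"
    and X_indep: "indep_vars (\<lambda>_. count_space UNIV) X {1..}"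
    and X_uniform: "\<And>i m. 1 \<le> i \<Longrightarrow> m \<in> {1..k} \<Longrightarrow> prob {\<omega> \<in> space M. X i \<omega> = m} = 1 / real k"
    and poisson: "poisson_process M 1 N1"
    and N1_X_indep: "indep_processes M {0..} (count_space UNIV) N1 {1..} (count_space UNIV) X"
begin

lemma X_measurable: "1 \<le> i \<Longrightarrow> X i \<in> measurable M (count_space UNIV)"
  using X_indep by (simp add: indep_vars_def)

lemma AE_X_range:
  assumes i: "1 \<le> i"
  shows "AE \<omega> in M. X i \<omega> \<in> {1..k}"
proof -
  have [measurable]: "X i \<in> measurable M (count_space UNIV)" by (rule X_measurable[OF i])
  have "prob {\<omega> \<in> space M. X i \<omega> \<in> {1..k}} = prob (\<Union>j\<in>{1..k}. {\<omega> \<in> space M. X i \<omega> = j})"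
    by (intro arg_cong[where f=prob]) auto
  also have "\<dots> = (\<Sum>j\<in>{1..k}. prob {\<omega> \<in> space M. X i \<omega> = j})"
    by (rule finite_measure_finite_Union) (auto simp: disjoint_family_on_def)
  also have "\<dots> = (\<Sum>j\<in>{1..k}. 1 / real k)"
    by (intro sum.cong refl X_uniform i)
  also have "\<dots> = 1" using k by simp
  finally have *: "prob {\<omega> \<in> space M. X i \<omega> \<in> {1..k}} = 1" .
  have "{\<omega> \<in> space M. X i \<omega> \<in> {1..k}} \<in> events"
    using measurable_sets[OF X_measurable[OF i], of "{1..k}"] by (simp add: vimage_def Int_def conj_commute)
  from AE_in_set_eq_1[OF this] * have "AE \<omega> in M. \<omega> \<in> {\<omega> \<in> space M. X i \<omega> \<in> {1..k}}" by blast
  then show ?thesis by eventually_elim auto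
qed

lemma prob_sum_X: "prob {\<omega> \<in> space M. (\<Sum>i\<in>{Suc n..n + l}. X i \<omega>) = m} = step_prob k l m"
proof (induction l arbitrary: m)
  case 0
  show ?case by (cases "m = 0") (auto simp: prob_space)
next
  case (Suc l)
  let ?S = "\<lambda>\<omega>. \<Sum>i\<in>{Suc n..n + l}. X i \<omega>" and ?T = "X (Suc (n + l))"
  have sum_eq: "(\<Sum>i\<in>{Suc n..n + Suc l}. X i \<omega>) = ?S \<omega> + ?T \<omega>" for \<omega>
    by simp
  have T [measurable]: "?T \<in> measurable M (count_space UNIV)" by (rule X_measurable) simp
  have X' [measurable]: "(\<lambda>\<omega>. real (X i \<omega>)) \<in> borel_measurable M" if "1 \<le> i" for i
    using measurable_compose[OF X_measurable[OF that], of real borel] by simp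
  have S_real: "(\<lambda>\<omega>. \<Sum>i\<in>{Suc n..n + l}. real (X i \<omega>)) \<in> borel_measurable M"
    by (intro borel_measurable_sum X') auto
  have S_event: "{\<omega> \<in> space M. ?S \<omega> = j} = (\<lambda>\<omega>. \<Sum>i\<in>{Suc n..n + l}. real (X i \<omega>)) -` {real j} \<inter> space M" for j
    by (auto simp flip: of_nat_sum)
  have S [measurable]: "{\<omega> \<in> space M. ?S \<omega> = j} \<in> events" for j
    unfolding S_event using S_real by (rule measurable_sets) simp
  have indep: "prob ({\<omega> \<in> space M. ?T \<omega> = i} \<inter> {\<omega> \<in> space M. ?S \<omega> = j})
       = prob {\<omega> \<in> space M. ?T \<omega> = i} * prob {\<omega> \<in> space M. ?S \<omega> = j}" for i j
  proof -
    have "indep_vars (\<lambda>_. borel) (\<lambda>i \<omega>. real (X i \<omega>)) {1..}"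
      by (rule indep_vars_compose2[OF X_indep]) simp
    then have "indep_vars (\<lambda>_. borel) (\<lambda>i \<omega>. real (X i \<omega>)) (insert (Suc (n + l)) {Suc n..n + l})"
      by (rule indep_vars_subset) auto
    then have "indep_var borel (\<lambda>\<omega>. real (?T \<omega>)) borel (\<lambda>\<omega>. \<Sum>i\<in>{Suc n..n + l}. real (X i \<omega>))"
      by (intro indep_vars_sum) auto
    from indep_varD[OF this, of "{real i}" "{real j}"]
    show ?thesis unfolding S_event
      by (simp add: vimage_def Int_def conj_commute conj_left_commute)
  qed
  have "prob {\<omega> \<in> space M. (\<Sum>i\<in>{Suc n..n + Suc l}. X i \<omega>) = m}
      = prob (\<Union>j\<in>{1..min m k}. {\<omega> \<in> space M. ?T \<omega> = j} \<inter> {\<omega> \<in> space M. ?S \<omega> = m - j})"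
  proof (rule measure_eq_AE)
    have "AE \<omega> in M. ?T \<omega> \<in> {1..k}" by (rule AE_X_range) simp
    then show "AE \<omega> in M. \<omega> \<in> {\<omega> \<in> space M. (\<Sum>i\<in>{Suc n..n + Suc l}. X i \<omega>) = m}
       \<longleftrightarrow> \<omega> \<in> (\<Union>j\<in>{1..min m k}. {\<omega> \<in> space M. ?T \<omega> = j} \<inter> {\<omega> \<in> space M. ?S \<omega> = m - j})"
      unfolding sum_eq by eventually_elim auto
    have "{\<omega> \<in> space M. (\<Sum>i\<in>{Suc n..n + Suc l}. X i \<omega>) = m}
       = (\<lambda>\<omega>. \<Sum>i\<in>{Suc n..n + Suc l}. real (X i \<omega>)) -` {real m} \<inter> space M"
      by (auto simp flip: of_nat_sum simp del: sum.cl_ivl_Suc)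
    also have "\<dots> \<in> events"
      by (intro measurable_sets[of _ M borel] borel_measurable_sum X') auto
    finally show "{\<omega> \<in> space M. (\<Sum>i\<in>{Suc n..n + Suc l}. X i \<omega>) = m} \<in> events" .
  qed measurable
  also have "\<dots> = (\<Sum>j\<in>{1..min m k}. prob ({\<omega> \<in> space M. ?T \<omega> = j} \<inter> {\<omega> \<in> space M. ?S \<omega> = m - j}))"
    by (rule finite_measure_finite_Union) (auto simp: disjoint_family_on_def)
  also have "\<dots> = (\<Sum>j\<in>{1..min m k}. 1 / real k * step_prob k l (m - j))"
    by (intro sum.cong refl, subst indep) (simp add: Suc.IH X_uniform)
  also have "\<dots> = step_prob k (Suc l) m" by (simp add: sum_divide_distrib)
  finally show ?case .
qed

lemma N1_measurable: "0 \<le> t \<Longrightarrow> N1 t \<in> measurable M (count_space UNIV)"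
  using poisson by (simp add: poisson_process_def)

lemma N1_mono: "\<omega> \<in> space M \<Longrightarrow> 0 \<le> s \<Longrightarrow> s \<le> t \<Longrightarrow> N1 s \<omega> \<le> N1 t \<omega>"
  using poisson unfolding poisson_process_def subordinator_def monotone_on_def by auto

lemma prob_N1_increment:
  assumes "0 \<le> a" "a \<le> b"
  shows "prob {\<omega> \<in> space M. N1 b \<omega> - N1 a \<omega> = l} = exp (- (b - a)) * (b - a) ^ l / fact l"
proof -
  have [measurable]: "N1 a \<in> measurable M (count_space UNIV)" "N1 b \<in> measurable M (count_space UNIV)"
    "N1 (b - a) \<in> measurable M (count_space UNIV)"
    using assms by (auto intro: N1_measurable)
  have "stationary_increments M (\<lambda>t \<omega>. real (N1 t \<omega>))"
    using poisson by (simp add: poisson_process_def subordinator_def levy_process_def)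
  then have "distr M borel (\<lambda>\<omega>. real (N1 (a + (b - a)) \<omega>) - real (N1 a \<omega>)) = distr M borel (\<lambda>\<omega>. real (N1 (b - a) \<omega>))"
    using assms unfolding stationary_increments_def by (metis diff_ge_0_iff_ge)
  then have "measure (distr M borel (\<lambda>\<omega>. real (N1 b \<omega>) - real (N1 a \<omega>))) {real l}
      = measure (distr M borel (\<lambda>\<omega>. real (N1 (b - a) \<omega>))) {real l}"
    by simp
  then have "prob {\<omega> \<in> space M. real (N1 b \<omega>) - real (N1 a \<omega>) = real l} = prob {\<omega> \<in> space M. N1 (b - a) \<omega> = l}"
    by (simp add: measure_distr vimage_def Int_def conj_commute)
  moreover have "{\<omega> \<in> space M. real (N1 b \<omega>) - real (N1 a \<omega>) = real l} = {\<omega> \<in> space M. N1 b \<omega> - N1 a \<omega> = l}"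
    using N1_mono[OF _ assms] by (auto simp: of_nat_diff)
  ultimately show ?thesis
    using poisson assms by (simp add: poisson_process_def)
qed

text \<open>On the event that \<open>N1 a = n\<close> and that \<open>N1\<close> grows by \<open>l\<close> between \<open>a\<close> and \<open>b\<close>, the increment is the sum of the \<open>l\<close> steps
  following the \<open>n\<close>-th, whose distribution does not depend on \<open>n\<close>. Hence summation over \<open>n\<close> leaves the
  distribution of \<open>N1 b - N1 a\<close>, which is Poisson by stationarity.\<close>

lemma prob_compound_increment:
  assumes ab: "0 \<le> a" "a \<le> b"
  shows "prob {\<omega> \<in> space M. int (\<Sum>i = 1..N1 b \<omega>. X i \<omega>) - int (\<Sum>i = 1..N1 a \<omega>. X i \<omega>) = int m}
     = (\<Sum>l\<le>m. exp (- (b - a)) * (b - a) ^ l / fact l * step_prob k l m)"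
proof -
  let ?PN = "process_algebra M {0..} (count_space UNIV) N1" and ?PX = "process_algebra M {1..} (count_space UNIV) X"
  have [measurable]: "N1 a \<in> measurable M (count_space UNIV)" "N1 b \<in> measurable M (count_space UNIV)"
    using ab by (auto intro: N1_measurable)
  have N1_alg [measurable]: "N1 a \<in> measurable ?PN (count_space UNIV)" "N1 b \<in> measurable ?PN (count_space UNIV)"
    using ab by (auto intro!: measurable_process_algebra)
  let ?D = "\<lambda>l. {\<omega> \<in> space M. N1 b \<omega> - N1 a \<omega> = l}"
  let ?C = "\<lambda>l n. {\<omega> \<in> space M. N1 b \<omega> - N1 a \<omega> = l \<and> N1 a \<omega> = n}"
  let ?S = "\<lambda>l n. {\<omega> \<in> space M. (\<Sum>i\<in>{Suc n..n + l}. X i \<omega>) = m}"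
  define E where "E = {\<omega> \<in> space M. int (\<Sum>i = 1..N1 b \<omega>. X i \<omega>) - int (\<Sum>i = 1..N1 a \<omega>. X i \<omega>) = int m}"
  have S_alg: "?S l n \<in> sets ?PX" for l n
  proof -
    have X_alg: "(\<lambda>\<omega>. real (X i \<omega>)) \<in> borel_measurable ?PX" if "i \<in> {Suc n..n + l}" for i
      using that by (intro measurable_compose[OF measurable_process_algebra, of i _ M X "count_space UNIV" real borel]) auto
    have "?S l n = (\<lambda>\<omega>. \<Sum>i\<in>{Suc n..n + l}. real (X i \<omega>)) -` {real m} \<inter> space ?PX"
      by (auto simp flip: of_nat_sum)
    also have "\<dots> \<in> sets ?PX"
      by (intro measurable_sets[of _ ?PX borel] borel_measurable_sum X_alg) auto
    finally show ?thesis .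
  qed
  then have S_ev [measurable]: "?S l n \<in> events" for l n
    using indep_processes_events[OF N1_X_indep] by auto
  have C_alg: "?C l n \<in> sets ?PN" for l n
  proof -
    have "{\<omega> \<in> space ?PN. N1 b \<omega> - N1 a \<omega> = l \<and> N1 a \<omega> = n} \<in> sets ?PN" by measurable
    then show ?thesis by simp
  qed
  have split: "E \<inter> ?C l n = ?C l n \<inter> ?S l n" for l n
  proof -
    have "(int (\<Sum>i = 1..N1 b \<omega>. X i \<omega>) - int (\<Sum>i = 1..N1 a \<omega>. X i \<omega>) = int m) \<longleftrightarrow> (\<Sum>i\<in>{Suc n..n + l}. X i \<omega>) = m"
      if "\<omega> \<in> ?C l n" for \<omega>
    proof -
      have b: "N1 b \<omega> = n + l" and a: "N1 a \<omega> = n" using that N1_mono[OF _ ab, of \<omega>] by auto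
      have "(\<Sum>i = 1..n + l. X i \<omega>) = (\<Sum>i = 1..n. X i \<omega>) + (\<Sum>i\<in>{Suc n..n + l}. X i \<omega>)"
        using sum.ub_add_nat[of 1 n "\<lambda>i. X i \<omega>" l] by simp
      then show ?thesis unfolding a b by (auto simp del: of_nat_sum)
    qed
    then show ?thesis by (auto simp: E_def)
  qed
  have E_ev [measurable]: "E \<in> events"
  proof -
    have "E = (\<Union>l. \<Union>n. E \<inter> ?C l n)" by (auto simp: E_def)
    also have "\<dots> \<in> events" unfolding split by measurable
    finally show ?thesis .
  qed
  have prob_C: "prob (E \<inter> ?C l n) = prob (?C l n) * step_prob k l m" for l n
    unfolding split by (subst indep_processes_prob[OF N1_X_indep C_alg S_alg]) (simp only: prob_sum_X)
  have E_D: "emeasure M (E \<inter> ?D l) = emeasure M (?D l) * ennreal (step_prob k l m)" for l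
  proof -
    have "emeasure M (E \<inter> ?D l) = (\<Sum>n. emeasure M (E \<inter> ?D l \<inter> {\<omega> \<in> space M. N1 a \<omega> = n}))"
      by (rule emeasure_eq_suminf_fibres) measurable
    also have "\<dots> = (\<Sum>n. emeasure M (?D l \<inter> {\<omega> \<in> space M. N1 a \<omega> = n}) * ennreal (step_prob k l m))"
    proof (intro suminf_cong)
      fix n
      have "E \<inter> ?D l \<inter> {\<omega> \<in> space M. N1 a \<omega> = n} = E \<inter> ?C l n" "?D l \<inter> {\<omega> \<in> space M. N1 a \<omega> = n} = ?C l n"
        by auto
      then show "emeasure M (E \<inter> ?D l \<inter> {\<omega> \<in> space M. N1 a \<omega> = n}) = emeasure M (?D l \<inter> {\<omega> \<in> space M. N1 a \<omega> = n}) * ennreal (step_prob k l m)"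
        by (simp only: emeasure_eq_measure prob_C) (simp add: ennreal_mult step_prob_nonneg)
    qed
    also have "\<dots> = (\<Sum>n. emeasure M (?D l \<inter> {\<omega> \<in> space M. N1 a \<omega> = n})) * ennreal (step_prob k l m)"
      by (rule ennreal_suminf_multc)
    also have "(\<Sum>n. emeasure M (?D l \<inter> {\<omega> \<in> space M. N1 a \<omega> = n})) = emeasure M (?D l)"
      by (rule emeasure_eq_suminf_fibres[symmetric]) measurable
    finally show ?thesis .
  qed
  have "emeasure M E = (\<Sum>l. emeasure M (E \<inter> ?D l))"
    by (rule emeasure_eq_suminf_fibres) measurable
  also have "\<dots> = (\<Sum>l. emeasure M (?D l) * ennreal (step_prob k l m))"
    by (simp only: E_D)
  also have "\<dots> = (\<Sum>l\<le>m. emeasure M (?D l) * ennreal (step_prob k l m))"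
    by (rule suminf_finite) (auto simp: step_prob_eq_0)
  also have "\<dots> = (\<Sum>l\<le>m. ennreal (exp (- (b - a)) * (b - a) ^ l / fact l * step_prob k l m))"
    using ab by (intro sum.cong refl) (simp add: emeasure_eq_measure prob_N1_increment ennreal_mult''[symmetric] step_prob_nonneg)
  also have "\<dots> = ennreal (\<Sum>l\<le>m. exp (- (b - a)) * (b - a) ^ l / fact l * step_prob k l m)"
    using ab by (intro sum_ennreal) (simp add: step_prob_nonneg)
  finally have "ennreal (prob E) = ennreal (\<Sum>l\<le>m. exp (- (b - a)) * (b - a) ^ l / fact l * step_prob k l m)"
    by (simp only: emeasure_eq_measure)
  moreover have "0 \<le> (\<Sum>l\<le>m. exp (- (b - a)) * (b - a) ^ l / fact l * step_prob k l m)"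
    using ab by (intro sum_nonneg) (simp add: step_prob_nonneg)
  ultimately show ?thesis unfolding E_def[symmetric] by simp
qed

end

locale order_k_process = order_k_model M k X N1 + rate: locally_integrable_rate r
  for M :: "'a measure" and k X N1 and r :: "real \<Rightarrow> real"
begin

abbreviation "N \<equiv> poisson_order k r X N1"
abbreviation "\<Lambda> \<equiv> cumulative_rate r"

text \<open>At negative times the cumulative rate is an integral over the empty set, so the process is frozen there. This
  makes sense of the time change on the null set where \<open>Y\<close> is unspecified.\<close>

lemma N_max: "N (max 0 t) = N t"
  by (cases "0 \<le> t") (auto simp: poisson_order_def fun_eq_iff rate.cumulative_rate_neg max_def)

lemma incr_prob_eq:
  assumes "0 \<le> u" "0 \<le> v"
  shows "incr_prob M N m u v = poisson_order_pmf k m (\<Lambda> (u + v) - \<Lambda> v)"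
proof -
  have "\<Lambda> v \<le> \<Lambda> (u + v)" using assms by (intro monoD[OF rate.mono_cumulative_rate]) simp
  then have "incr_prob M N m u v = (\<Sum>l\<le>m. exp (- (real k * \<Lambda> (u + v) - real k * \<Lambda> v)) *
      (real k * \<Lambda> (u + v) - real k * \<Lambda> v) ^ l / fact l * step_prob k l m)"
    unfolding incr_prob_def poisson_order_def
    by (intro prob_compound_increment mult_left_mono mult_nonneg_nonneg rate.cumulative_rate_nonneg) auto
  then show ?thesis
    by (simp add: poisson_order_pmf_def right_diff_distrib)
qed

lemma cumulative_rate_tendsto:
  assumes lim: "y \<longlonglongrightarrow> t"
  shows "(\<lambda>n. \<Lambda> (y n)) \<longlonglongrightarrow> \<Lambda> t"
proof -
  have max: "\<Lambda> (max 0 s) = \<Lambda> s" for s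
    by (cases "0 \<le> s") (auto simp: rate.cumulative_rate_neg max_def)
  have "(\<lambda>n. max 0 (y n)) \<longlonglongrightarrow> max 0 t"
    by (intro tendsto_intros lim)
  then have "(\<lambda>n. \<Lambda> (max 0 (y n))) \<longlonglongrightarrow> \<Lambda> (max 0 t)"
    using rate.continuous_on_cumulative_rate unfolding continuous_on_sequentially by (auto simp: comp_def)
  then show ?thesis by (simp only: max)
qed

text \<open>A right-continuous function with integer values is locally constant to the right, and the continuous
  nondecreasing clock \<open>k \<Lambda>\<close> carries this over from \<open>N1\<close> to \<open>N\<close>.\<close>

lemma N_eventually_eq_right:
  assumes \<omega>: "\<omega> \<in> space M" and lim: "y \<longlonglongrightarrow> t" and ge: "\<And>n. t \<le> y n"
  shows "eventually (\<lambda>n. N (y n) \<omega> = N t \<omega>) sequentially"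
proof -
  let ?s = "real k * \<Lambda> t"
  have s: "0 \<le> ?s" by (simp add: rate.cumulative_rate_nonneg)
  have "cadlag (\<lambda>t. real (N1 t \<omega>))"
    using poisson \<omega> by (simp add: poisson_process_def subordinator_def levy_process_def)
  then have "((\<lambda>x. real (N1 x \<omega>)) \<longlongrightarrow> real (N1 ?s \<omega>)) (at_right ?s)"
    using s by (simp add: cadlag_def continuous_within)
  then have "eventually (\<lambda>x. dist (real (N1 x \<omega>)) (real (N1 ?s \<omega>)) < 1) (at_right ?s)"
    by (rule tendstoD) simp
  then have "eventually (\<lambda>x. N1 x \<omega> = N1 ?s \<omega>) (at_right ?s)"
    by eventually_elim (simp add: dist_real_def)
  then obtain b where b: "?s < b" "\<And>x. ?s < x \<Longrightarrow> x < b \<Longrightarrow> N1 x \<omega> = N1 ?s \<omega>"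
    by (auto simp: eventually_at_right_field)
  have "(\<lambda>n. real k * \<Lambda> (y n)) \<longlonglongrightarrow> ?s"
    by (intro tendsto_intros cumulative_rate_tendsto lim)
  from order_tendstoD(2)[OF this b(1)] show ?thesis
  proof eventually_elim
    fix n assume "real k * \<Lambda> (y n) < b"
    moreover have "?s \<le> real k * \<Lambda> (y n)"
      using ge[of n] by (intro mult_left_mono monoD[OF rate.mono_cumulative_rate]) auto
    ultimately have "N1 (real k * \<Lambda> (y n)) \<omega> = N1 ?s \<omega>"
      using b(2)[of "real k * \<Lambda> (y n)"] by (cases "?s = real k * \<Lambda> (y n)") auto
    then show "N (y n) \<omega> = N t \<omega>" by (simp add: poisson_order_def)
  qed
qed

text \<open>\<open>Y t\<close> is approximated from above by the dyadic times \<open>Z n = (\<lfloor>2 ^ n * Y t\<rfloor> + 1) / 2 ^ n\<close>. For these,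
  conditioning on the countably many values is elementary; as \<open>n\<close> grows, the approximating events are eventually
  constant at every sample point by right-continuity of \<open>N\<close>. This gives both measurability of the limiting
  event and its probability, and avoids joint measurability of \<open>N\<close> in time and sample point.\<close>

lemma time_changed_incr_prob:
  fixes Y :: "real \<Rightarrow> 'a \<Rightarrow> real"
  assumes indep: "indep_processes M {0..} borel Y {0..} (count_space UNIV) N"
    and t: "0 \<le> t" and v: "0 \<le> v"
  shows "{\<omega> \<in> space M. time_changed_incr N Y t v \<omega> = int m} \<in> events"
    and "AE \<omega> in M. 0 \<le> Y t \<omega> \<Longrightarrow> time_changed_incr_prob M N Y m t v = (LINT \<omega>|M. poisson_order_pmf k m (\<Lambda> (Y t \<omega> + v) - \<Lambda> v))"
proof -
  let ?PY = "process_algebra M {0..} borel Y" and ?PN = "process_algebra M {0..} (count_space UNIV) N"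
  have Y_alg [measurable]: "Y t \<in> borel_measurable ?PY"
    using t by (intro measurable_process_algebra) auto
  have N_alg [measurable]: "N s \<in> measurable ?PN (count_space UNIV)" for s
    using measurable_process_algebra[of "max 0 s" "{0..}" M N "count_space UNIV"] by (simp add: N_max)
  have Y_meas [measurable]: "Y t \<in> borel_measurable M"
    using Y_alg indep_processes_events(1)[OF indep] unfolding measurable_def by auto
  have N_meas [measurable]: "N s \<in> measurable M (count_space UNIV)" for s
    using N_alg[of s] indep_processes_events(2)[OF indep] unfolding measurable_def by auto
  define J where "J n \<omega> = \<lfloor>2 ^ n * Y t \<omega>\<rfloor> + 1" for n :: nat and \<omega>
  define Z where "Z n \<omega> = real_of_int (J n \<omega>) / 2 ^ n" for n :: nat and \<omega>
  define d where "d n i = real_of_int (int_decode i) / 2 ^ n" for n i :: nat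
  define c where "c n i = incr_prob M N m (d n i) v" for n i
  \<comment> \<open>The dyadic numerators are integers; they are numbered by naturals to apply \<open>prob_mixture\<close>.\<close>
  let ?g = "\<lambda>n \<omega>. int_encode (J n \<omega>)"
  have Z_bounds: "Y t \<omega> \<le> Z n \<omega>" "Z n \<omega> \<le> Y t \<omega> + (1 / 2) ^ n" for n \<omega>
    unfolding Z_def J_def by (simp_all add: field_simps power_divide) linarith+
  have Z_lim: "(\<lambda>n. Z n \<omega>) \<longlonglongrightarrow> Y t \<omega>" for \<omega>
  proof (rule tendsto_sandwich[where f="\<lambda>_. Y t \<omega>" and h="\<lambda>n. Y t \<omega> + (1 / 2) ^ n"])
    have "(\<lambda>n. Y t \<omega> + (1 / 2) ^ n) \<longlonglongrightarrow> Y t \<omega> + 0"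
      by (intro tendsto_intros) auto
    then show "(\<lambda>n. Y t \<omega> + (1 / 2) ^ n) \<longlonglongrightarrow> Y t \<omega>" by simp
  qed (use Z_bounds in auto)
  have J_alg: "?g n \<in> measurable ?PY (count_space UNIV)" for n
    unfolding J_def by measurable
  have J_meas [measurable]: "?g n \<in> measurable M (count_space UNIV)" for n
    unfolding J_def by measurable
  define E where "E = {\<omega> \<in> space M. time_changed_incr N Y t v \<omega> = int m}"
  define En where "En n = {\<omega> \<in> space M. int (N (Z n \<omega> + v) \<omega>) - int (N v \<omega>) = int m}" for n
  let ?I = "\<lambda>n i. {\<omega> \<in> space M. int (N (d n i + v) \<omega>) - int (N v \<omega>) = int m}"
  have split: "En n \<inter> {\<omega> \<in> space M. ?g n \<omega> = i} = {\<omega> \<in> space M. ?g n \<omega> = i} \<inter> ?I n i" for n i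
    by (auto simp: En_def Z_def d_def)
  have I_alg: "?I n i \<in> sets ?PN" for n i
  proof -
    have "{\<omega> \<in> space ?PN. int (N (d n i + v) \<omega>) - int (N v \<omega>) = int m} \<in> sets ?PN" by measurable
    then show ?thesis by simp
  qed
  have J_ev: "{\<omega> \<in> space M. ?g n \<omega> = i} \<in> sets ?PY" for n i
    using measurable_sets[OF J_alg[of n], of "{i}"] by (simp add: vimage_def Int_def conj_commute)
  have En_ev: "En n \<in> events" for n
  proof -
    have "En n = (\<Union>i. En n \<inter> {\<omega> \<in> space M. ?g n \<omega> = i})" by (auto simp: En_def)
    also have "\<dots> \<in> events" unfolding split by measurable
    finally show ?thesis .
  qed
  have ev: "eventually (\<lambda>n. \<omega> \<in> En n \<longleftrightarrow> \<omega> \<in> E) sequentially" if "\<omega> \<in> space M" for \<omega>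
  proof -
    have "(\<lambda>n. Z n \<omega> + v) \<longlonglongrightarrow> Y t \<omega> + v" by (intro tendsto_intros Z_lim)
    from N_eventually_eq_right[OF that this] Z_bounds(1) show ?thesis
      by (auto elim!: eventually_mono simp: En_def E_def time_changed_incr_def)
  qed
  have "E = {\<omega> \<in> space M. \<exists>n0. \<forall>n\<ge>n0. \<omega> \<in> En n}"
  proof (intro equalityI subsetI)
    fix \<omega> assume "\<omega> \<in> E"
    then have "\<omega> \<in> space M" by (simp add: E_def)
    with ev[OF this] \<open>\<omega> \<in> E\<close> show "\<omega> \<in> {\<omega> \<in> space M. \<exists>n0. \<forall>n\<ge>n0. \<omega> \<in> En n}"
      by (auto simp: eventually_sequentially)
  next
    fix \<omega> assume *: "\<omega> \<in> {\<omega> \<in> space M. \<exists>n0. \<forall>n\<ge>n0. \<omega> \<in> En n}"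
    then have "\<omega> \<in> space M" "eventually (\<lambda>n. \<omega> \<in> En n) sequentially"
      by (auto simp: eventually_sequentially)
    from eventually_conj[OF ev[OF this(1)] this(2)] have "eventually (\<lambda>n. \<omega> \<in> E) sequentially"
      by eventually_elim auto
    then show "\<omega> \<in> E" by simp
  qed
  also have "\<dots> \<in> events"
    using En_ev by measurable
  finally have E_ev: "E \<in> events" .
  then show "{\<omega> \<in> space M. time_changed_incr N Y t v \<omega> = int m} \<in> events" by (simp add: E_def)
  assume nonneg: "AE \<omega> in M. 0 \<le> Y t \<omega>"
  let ?f = "\<lambda>y. poisson_order_pmf k m (\<Lambda> (y + v) - \<Lambda> v)"
  have prob_En: "prob (En n) = (LINT \<omega>|M. c n (?g n \<omega>))" for n
  proof (rule prob_mixture)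
    show "0 \<le> c n i" "c n i \<le> 1" for i by (auto simp: c_def incr_prob_def)
    show "prob (En n \<inter> {\<omega> \<in> space M. ?g n \<omega> = i}) = prob {\<omega> \<in> space M. ?g n \<omega> = i} * c n i" for i
      unfolding split by (subst indep_processes_prob[OF indep J_ev I_alg]) (simp add: c_def incr_prob_def)
  qed (use En_ev in auto)
  have lim1: "(\<lambda>n. LINT \<omega>|M. c n (?g n \<omega>)) \<longlonglongrightarrow> (LINT \<omega>|M. ?f (Y t \<omega>))"
  proof (rule integral_dominated_convergence[where w="\<lambda>_. 1"])
    have [measurable]: "(\<lambda>y. \<Lambda> (y + v)) \<in> borel_measurable borel"
      by (intro measurable_compose[OF _ rate.borel_measurable_cumulative_rate]) measurable
    show "(\<lambda>\<omega>. ?f (Y t \<omega>)) \<in> borel_measurable M" by measurable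
    show "AE \<omega> in M. (\<lambda>n. c n (?g n \<omega>)) \<longlonglongrightarrow> ?f (Y t \<omega>)"
      using nonneg
    proof eventually_elim
      fix \<omega> assume pos: "0 \<le> Y t \<omega>"
      have "c n (?g n \<omega>) = ?f (Z n \<omega>)" for n
        unfolding c_def d_def using Z_bounds(1)[of \<omega> n] pos v
        by (subst incr_prob_eq) (auto simp: Z_def)
      moreover have "(\<lambda>n. ?f (Z n \<omega>)) \<longlonglongrightarrow> ?f (Y t \<omega>)"
      proof -
        have "(\<lambda>n. \<Lambda> (Z n \<omega> + v) - \<Lambda> v) \<longlonglongrightarrow> \<Lambda> (Y t \<omega> + v) - \<Lambda> v"
          by (intro tendsto_intros cumulative_rate_tendsto Z_lim)
        then show ?thesis
          using continuous_on_poisson_order_pmf[of UNIV k m] unfolding continuous_on_sequentially by (auto simp: comp_def)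
      qed
      ultimately show "(\<lambda>n. c n (?g n \<omega>)) \<longlonglongrightarrow> ?f (Y t \<omega>)" by simp
    qed
    show "(\<lambda>\<omega>. c n (?g n \<omega>)) \<in> borel_measurable M" for n
      by (rule measurable_compose[OF J_meas]) simp
    show "AE \<omega> in M. norm (c n (?g n \<omega>)) \<le> 1" for n
      by (auto simp: c_def incr_prob_def)
  qed simp
  have lim2: "(\<lambda>n. LINT \<omega>|M. indicator (En n) \<omega>) \<longlonglongrightarrow> (LINT \<omega>|M. indicator E \<omega> :: real)"
  proof (rule integral_dominated_convergence[where w="\<lambda>_. 1"])
    show "AE \<omega> in M. (\<lambda>n. indicator (En n) \<omega> :: real) \<longlonglongrightarrow> indicator E \<omega>"
    proof (rule AE_I2)
      fix \<omega> assume "\<omega> \<in> space M"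
      from ev[OF this] have "eventually (\<lambda>n. (indicator (En n) \<omega> :: real) = indicator E \<omega>) sequentially"
        by eventually_elim (auto simp: indicator_def)
      then show "(\<lambda>n. indicator (En n) \<omega> :: real) \<longlonglongrightarrow> indicator E \<omega>"
        by (rule tendsto_eventually)
    qed
  qed (use E_ev En_ev in \<open>auto simp: indicator_def\<close>)
  have "(\<lambda>n. prob (En n)) \<longlonglongrightarrow> prob E"
    using lim2 E_ev En_ev sets.sets_into_space[OF E_ev] sets.sets_into_space[OF En_ev] by (simp add: Int_absorb2)
  with lim1 have "prob E = (LINT \<omega>|M. ?f (Y t \<omega>))"
    unfolding prob_En by (rule LIMSEQ_unique[rotated])
  then show "time_changed_incr_prob M N Y m t v = (LINT \<omega>|M. ?f (Y t \<omega>))"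
    by (simp add: time_changed_incr_prob_def E_def)
qed

end

section \<open>The fractional equations\<close>

theorem theorem3p3:
  fixes M :: "'a measure"
    and \<alpha> :: real
    and k :: nat
    and r :: "real \<Rightarrow> real"
    and X :: "nat \<Rightarrow> 'a \<Rightarrow> nat"
    and N1 :: "real \<Rightarrow> 'a \<Rightarrow> nat"
    and L :: "real \<Rightarrow> 'a \<Rightarrow> real"
    and h :: "real \<Rightarrow> real \<Rightarrow> real"
    and v :: real
  defines "N \<equiv> poisson_order k r X N1"
    and "Y \<equiv> inverse_process L"
  defines "p \<equiv> incr_prob M N"
    and "q \<equiv> time_changed_incr_prob M N Y"
  assumes "prob_space M"
    and "0 < \<alpha>" and "\<alpha> < 1"
    and "1 \<le> k"
    and rate_nonneg: "\<And>u. 0 \<le> u \<Longrightarrow> 0 \<le> r u"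
    and rate_integrable: "\<And>t. 0 < t \<Longrightarrow> set_integrable lborel {0..t} r"
    and X_indep: "prob_space.indep_vars M (\<lambda>_. count_space UNIV) X {1..}"
    and X_uniform: "\<And>i m. 1 \<le> i \<Longrightarrow> m \<in> {1..k} \<Longrightarrow>
                      measure M {\<omega> \<in> space M. X i \<omega> = m} = 1 / real k"
    and poisson: "poisson_process M 1 N1"
    and N1_X_indep: "indep_processes M {0..} (count_space UNIV) N1 {1..} (count_space UNIV) X"
    and stable: "stable_subordinator M \<alpha> L"
    and Y_N_indep: "indep_processes M {0..} borel Y {0..} (count_space UNIV) N"
    and density: "\<And>t. 0 < t \<Longrightarrow> has_density_on_pos M (Y t) (h t)"
    and "0 \<le> v"
  shows "(\<forall>t>0.
            caputo_differentiable \<alpha> (\<lambda>s. q 0 s v) t \<and>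
            set_integrable lborel {0<..} (\<lambda>u. r (u + v) * p 0 u v * h t u) \<and>
            caputo_deriv \<alpha> (\<lambda>s. q 0 s v) t =
              - real k * (LBINT u:{0<..}. r (u + v) * p 0 u v * h t u)) \<and>
         (\<forall>t>0. \<forall>m\<ge>1.
            caputo_differentiable \<alpha> (\<lambda>s. q m s v) t \<and>
            set_integrable lborel {0<..}
              (\<lambda>u. (- real k * r (u + v) * p m u v
                    + r (u + v) * (\<Sum>j = 1..min m k. p (m - j) u v)) * h t u) \<and>
            caputo_deriv \<alpha> (\<lambda>s. q m s v) t =
              (LBINT u:{0<..}.
                 (- real k * r (u + v) * p m u v
                  + r (u + v) * (\<Sum>j = 1..min m k. p (m - j) u v)) * h t u)) \<and>
         (\<forall>m. q m 0 v = (if m = 0 then 1 else 0))"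
proof -
  interpret prob_space M by fact
  interpret S: stable_inverse M \<alpha> L
    by unfold_locales fact+
  interpret P: order_k_process M k X N1 r
    by unfold_locales fact+
  interpret R: locally_integrable_rate "\<lambda>w. r (w + v)"
    by (rule P.rate.shift_rate) fact
  have k: "0 < k" using \<open>1 \<le> k\<close> by simp
  note v = \<open>0 \<le> v\<close>
  have p_eq: "p m u v = poisson_order_pmf k m (R.A u)" if "0 \<le> u" for m u
    unfolding p_def N_def using that v by (simp add: P.incr_prob_eq P.rate.cumulative_rate_shift)
  \<comment> \<open>The factor in front of \<open>h\<close>; at continuity points of the rate it is the derivative of \<open>p\<close> in \<open>u\<close>.\<close>
  define \<Psi> where "\<Psi> m u = indicator {0<..} u * (r (u + v) * poisson_order_rhs k m (R.A u))" for m u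
  have \<Psi>: "integrable lborel (\<Psi> m)" "\<And>u. u \<le> 0 \<Longrightarrow> \<Psi> m u = 0" for m
    unfolding \<Psi>_def[abs_def] using R.integrable_rate_rhs[OF k] by (auto simp: \<Psi>_def)
  have q_eq: "q m t v = poisson_order_pmf k m 0 + (LBINT w. \<Psi> m w * S.F.stable_cdf w t)" if t: "0 < t" for m t
  proof -
    let ?\<phi> = "\<lambda>u. poisson_order_pmf k m (cumulative_rate r (u + v) - cumulative_rate r v)"
    note d = density[OF t, unfolded Y_def]
    note [measurable] = S.measurable_inverse[OF d]
    have [measurable]: "(\<lambda>y. cumulative_rate r (y + v)) \<in> borel_measurable borel"
      by (intro measurable_compose[OF _ P.rate.borel_measurable_cumulative_rate]) measurable
    have "AE \<omega> in M. 0 \<le> Y t \<omega>"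
      unfolding Y_def using S.AE_inverse_pos[OF d] by eventually_elim simp
    then have "q m t v = (LINT \<omega>|M. ?\<phi> (Y t \<omega>))"
      unfolding q_def N_def
      using t v by (intro P.time_changed_incr_prob(2)[OF Y_N_indep[unfolded N_def]]) auto
    also have "\<dots> = poisson_order_pmf k m 0 + (LBINT w. \<Psi> m w * S.F.stable_cdf w t)"
      unfolding Y_def
    proof (rule S.expectation_inverse[OF d \<Psi>])
      fix u :: real assume u: "0 < u"
      have "?\<phi> u = poisson_order_pmf k m (R.A u)"
        using u v by (simp add: P.rate.cumulative_rate_shift)
      also have "\<dots> = poisson_order_pmf k m 0 + (LBINT w. indicator {0<..u} w * (r (w + v) * poisson_order_rhs k m (R.A w)))"
        using u by (subst R.rate_substitution[OF _ DERIV_poisson_order_pmf[OF k] continuous_on_poisson_order_rhs]) auto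
      also have "(LBINT w. indicator {0<..u} w * (r (w + v) * poisson_order_rhs k m (R.A w))) = (LBINT w. \<Psi> m w * indicator {..<u} w)"
      proof (rule integral_cong_AE)
        have "integrable lborel (\<lambda>w. indicator {0<..u} w *\<^sub>R \<Psi> m w)"
          by (rule integrable_mult_indicator[OF _ \<Psi>(1)]) simp
        moreover have "(\<lambda>w. indicator {0<..u} w *\<^sub>R \<Psi> m w) = (\<lambda>w. indicator {0<..u} w * (r (w + v) * poisson_order_rhs k m (R.A w)))"
          by (auto simp: \<Psi>_def indicator_def)
        ultimately show "(\<lambda>w. indicator {0<..u} w * (r (w + v) * poisson_order_rhs k m (R.A w))) \<in> borel_measurable lborel"
          by (metis borel_measurable_integrable)
        show "(\<lambda>w. \<Psi> m w * indicator {..<u} w) \<in> borel_measurable lborel"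
          using \<Psi>(1)[of m] by measurable
        show "AE w in lborel. indicator {0<..u} w * (r (w + v) * poisson_order_rhs k m (R.A w)) = \<Psi> m w * indicator {..<u} w"
          using AE_lborel_singleton[of u] by eventually_elim (auto simp: \<Psi>_def indicator_def)
      qed
      finally show "?\<phi> u = poisson_order_pmf k m 0 + (LBINT w. \<Psi> m w * indicator {..<u} w)" .
    qed measurable
    finally show ?thesis .
  qed
  have deriv: "((\<lambda>s. q m s v) has_real_derivative (LBINT u. \<Psi> m u * S.F.stable_density u s)) (at s)" if s: "0 < s" for m s
  proof (rule has_field_derivative_transform_within_open[where S="{0<..}"])
    show "((\<lambda>s. poisson_order_pmf k m 0 + (LBINT w. \<Psi> m w * S.F.stable_cdf w s)) has_real_derivative (LBINT u. \<Psi> m u * S.F.stable_density u s)) (at s)"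
      using DERIV_add[OF DERIV_const S.F.DERIV_mixture[OF \<Psi> s]] by simp
  qed (use s q_eq in auto)
  have inverse_density_eq: "AE u in lborel. \<Psi> m u * enn2real (S.F.inverse_density t u) = \<Psi> m u * h t u" if t: "0 < t" for m t
    using S.density_eq_inverse_density[OF density[OF t, unfolded Y_def]]
  proof eventually_elim
    fix u assume *: "0 < u \<longrightarrow> ennreal (h t u) = S.F.inverse_density t u"
    have "0 < u \<Longrightarrow> 0 \<le> h t u" using density[OF t] by (simp add: has_density_on_pos_def)
    then show "\<Psi> m u * enn2real (S.F.inverse_density t u) = \<Psi> m u * h t u"
      using * \<Psi>(2)[of u m] by (cases "0 < u") (auto simp flip: *[rule_format])
  qed
  have h_meas: "(\<lambda>u. \<Psi> m u * h t u) \<in> borel_measurable lborel" if t: "0 < t" for m t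
  proof -
    note [measurable] = S.measurable_density[OF density[OF t, unfolded Y_def]]
    have "(\<lambda>u. \<Psi> m u * enn2real (ennreal (indicator {0<..} u * h t u))) \<in> borel_measurable lborel"
      using \<Psi>(1)[of m] by measurable
    moreover have "\<Psi> m u * enn2real (ennreal (indicator {0<..} u * h t u)) = \<Psi> m u * h t u" for u
      using density[OF t] \<Psi>(2)[of u m] by (cases "0 < u") (auto simp: has_density_on_pos_def)
    ultimately show ?thesis by simp
  qed
  have int: "integrable lborel (\<lambda>u. \<Psi> m u * h t u)" if t: "0 < t" for m t
    using S.F.caputo_mixture(1)[OF \<Psi> t] inverse_density_eq[OF t]
    by (rule integrable_cong_AE_imp[OF _ h_meas[OF t]]) (auto elim: eventually_mono)
  have caputo: "caputo_differentiable \<alpha> (\<lambda>s. q m s v) t"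
    "caputo_deriv \<alpha> (\<lambda>s. q m s v) t = (LBINT u. \<Psi> m u * h t u)" if t: "0 < t" for m t
  proof -
    let ?D = "\<lambda>s. LBINT u. \<Psi> m u * S.F.stable_density u s"
    have D: "deriv (\<lambda>s. q m s v) s = ?D s" if "0 < s" for s
      by (rule DERIV_imp_deriv[OF deriv[OF that]])
    have "set_integrable lborel {0<..<t} (\<lambda>s. deriv (\<lambda>s. q m s v) s / (t - s) powr \<alpha>)"
      using S.F.caputo_mixture(2)[OF \<Psi> t]
      by (rule set_integrable_cong[THEN iffD1, rotated 3]) (auto simp: D)
    moreover have "(\<lambda>s. q m s v) differentiable (at s)" if "s \<in> {0<..<t}" for s
      using deriv[of s m] that by (auto simp: real_differentiable_def)
    ultimately show "caputo_differentiable \<alpha> (\<lambda>s. q m s v) t"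
      by (simp add: caputo_differentiable_def)
    have "caputo_deriv \<alpha> (\<lambda>s. q m s v) t = 1 / Gamma (1 - \<alpha>) * (LBINT s:{0<..<t}. ?D s / (t - s) powr \<alpha>)"
      unfolding caputo_deriv_def
      by (intro arg_cong[where f="\<lambda>x. 1 / Gamma (1 - \<alpha>) * x"] set_lebesgue_integral_cong) (auto simp: D)
    also have "\<dots> = (LBINT u. \<Psi> m u * enn2real (S.F.inverse_density t u))"
      by (rule S.F.caputo_mixture(3)[OF \<Psi> t])
    also have "\<dots> = (LBINT u. \<Psi> m u * h t u)"
      by (rule integral_cong_AE[OF _ h_meas[OF t] inverse_density_eq[OF t]]) (use S.F.caputo_mixture(1)[OF \<Psi> t] in auto)
    finally show "caputo_deriv \<alpha> (\<lambda>s. q m s v) t = (LBINT u. \<Psi> m u * h t u)" .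
  qed
  have integrand: "indicator {0<..} u * ((- real k * r (u + v) * p m u v
                    + r (u + v) * (\<Sum>j = 1..min m k. p (m - j) u v)) * h t u) = \<Psi> m u * h t u" for m t u
    by (cases "0 < u") (auto simp: \<Psi>_def p_eq poisson_order_rhs_def algebra_simps)
  have integrand0: "indicator {0<..} u * (r (u + v) * p 0 u v * h t u) = - (1 / real k) * (\<Psi> 0 u * h t u)" for t u
    using k by (cases "0 < u") (auto simp: \<Psi>_def p_eq poisson_order_rhs_def)
  have initial: "q m 0 v = (if m = 0 then 1 else 0)" for m
  proof -
    have "q m 0 v = prob {\<omega> \<in> space M. m = 0}"
      unfolding q_def time_changed_incr_prob_def
    proof (rule measure_eq_AE)
      show "AE \<omega> in M. \<omega> \<in> {\<omega> \<in> space M. time_changed_incr N Y 0 v \<omega> = int m} \<longleftrightarrow> \<omega> \<in> {\<omega> \<in> space M. m = 0}"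
        using S.AE_inverse_0 by eventually_elim (auto simp: time_changed_incr_def Y_def)
      show "{\<omega> \<in> space M. time_changed_incr N Y 0 v \<omega> = int m} \<in> events"
        unfolding N_def using v by (intro P.time_changed_incr_prob(1)[OF Y_N_indep[unfolded N_def]]) auto
    qed auto
    then show ?thesis by (cases "m = 0") (auto simp: prob_space)
  qed
  have int0: "set_integrable lborel {0<..} (\<lambda>u. r (u + v) * p 0 u v * h t u)"
    "caputo_deriv \<alpha> (\<lambda>s. q 0 s v) t = - real k * (LBINT u:{0<..}. r (u + v) * p 0 u v * h t u)" if t: "0 < t" for t
    unfolding set_integrable_def set_lebesgue_integral_def real_scaleR_def integrand0 caputo(2)[OF t]
    using int[OF t] k by simp_all
  have int1: "set_integrable lborel {0<..} (\<lambda>u. (- real k * r (u + v) * p m u v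
                    + r (u + v) * (\<Sum>j = 1..min m k. p (m - j) u v)) * h t u)"
    "caputo_deriv \<alpha> (\<lambda>s. q m s v) t = (LBINT u:{0<..}. (- real k * r (u + v) * p m u v
                    + r (u + v) * (\<Sum>j = 1..min m k. p (m - j) u v)) * h t u)" if t: "0 < t" for m t
    unfolding set_integrable_def set_lebesgue_integral_def real_scaleR_def integrand caputo(2)[OF t]
    using int[OF t] by simp_all
  show ?thesis
    using caputo(1) int0 int1 initial by blast
qed

end
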